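(* Let $G=\Gamma_{p,m_1,\dots,m_n}$ be an $n$-clique graph with $p>1$. Then the following are equivalent: (1) either $m_i>1$ for all $1\le i\le n$, or there is exactly one $i\in\{1,\dots,n\}$ with $m_i=1$ and $m_j>1$ for all $j\ne i$, $1\le j\le n$; (2) $J(G)^{(k)}$ has linear quotients for all $k\ge 1$; (3) $J(G)^{(k)}$ is a componentwise linear ideal for all $k\ge 1$; (4) $J(G)^{(k)}$ is a componentwise linear ideal for some $k\ge 2$.
   Context: $n$-clique graph: for positive integers $p,n,m_1,\dots,m_n$, let $V=\{x_1,\dots,x_p\}\cup\{y_{ij} : 1\le i\le n,\ 1\le j\le m_i\}$ (all distinct), and let $G_{p,m_i}$ be the complete graph on $\{x_1,\dots,x_p,y_{i1},\dots,y_{im_i}\}$. The $n$-clique graph $\Gamma_{p,m_1,\dots,m_n}$ has vertex set $V$ and edge set $\bigcup_{1\le i\le n}E(G_{p,m_i})$. In the polynomial ring over a field $\mathbb{K}$ whose variables are the vertices of $G$, the cover ideal is $J(G)=\bigcap_{\{u,v\}\in E(G)}(u,v)$, and its $k$-th symbolic power is $J(G)^{(k)}=\bigcap_{\{u,v\}\in E(G)}(u,v)^k$. A homogeneous ideal $I$ is componentwise linear if for each $\ell$ the ideal generated by all degree $\ell$ elements of $I$ has a linear resolution. A monomial ideal $I$ has linear quotients if its minimal monomial generators can be ordered $u_1,\dots,u_t$ so that for every $2\le i\le t$ the ideal $(u_1,\dots,u_{i-1}):(u_i)$ is generated by a subset of the variables. *)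

theory Defs
  imports
    "HOL-Library.Poly_Mapping"
    "HOL-Algebra.Ideal_Product"
    "Jordan_Normal_Form.Matrix"
begin

section \<open>Polynomial rings in a given set of variables\<close>

text \<open>
  A monomial is its exponent function of type \<open>'v \<Rightarrow>\<^sub>0 nat\<close>.  The type \<open>('v, 'k) mpoly\<close> has all of
  \<open>'v\<close> as its variables; the polynomial ring \<open>K[V]\<close> is carved out of it as a carrier, and every
  ideal-theoretic notion below is relative to \<open>K[V]\<close>.
\<close>

type_synonym ('v, 'k) mpoly = "('v \<Rightarrow>\<^sub>0 nat) \<Rightarrow>\<^sub>0 'k"

definition poly_ring :: "'v set \<Rightarrow> ('v, 'k::field) mpoly ring" where
  "poly_ring V = \<lparr>carrier = {f. \<forall>t\<in>Poly_Mapping.keys f. Poly_Mapping.keys t \<subseteq> V},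
     monoid.mult = (*), one = 1, ring.zero = 0, add = (+)\<rparr>"

definition pvar :: "'v \<Rightarrow> ('v, 'k::field) mpoly" where
  "pvar v = Poly_Mapping.single (Poly_Mapping.single v 1) 1"

definition monomials :: "'v set \<Rightarrow> ('v, 'k::field) mpoly set" where
  "monomials V = {Poly_Mapping.single t 1 | t. Poly_Mapping.keys t \<subseteq> V}"

definition mdeg :: "('v \<Rightarrow>\<^sub>0 nat) \<Rightarrow> nat" where
  "mdeg t = (\<Sum>v\<in>Poly_Mapping.keys t. Poly_Mapping.lookup t v)"

text \<open>
  The zero polynomial is homogeneous of every degree, and it is the only homogeneous polynomial of
  negative degree.
\<close>

definition homogeneous :: "int \<Rightarrow> ('v, 'k::field) mpoly \<Rightarrow> bool" where
  "homogeneous d f \<longleftrightarrow> (\<forall>t\<in>Poly_Mapping.keys f. int (mdeg t) = d)"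

definition homogeneous_ideal :: "'v set \<Rightarrow> ('v, 'k::field) mpoly set \<Rightarrow> bool" where
  "homogeneous_ideal V I \<longleftrightarrow>
     (\<exists>B \<subseteq> carrier (poly_ring V). (\<forall>f\<in>B. \<exists>d. homogeneous d f) \<and> I = Idl\<^bsub>poly_ring V\<^esub> B)"

lemma poly_ring_cring: "cring (poly_ring V :: ('v, 'k::field) mpoly ring)"
proof -
  let ?C = "{f :: ('v, 'k) mpoly. \<forall>t\<in>Poly_Mapping.keys f. Poly_Mapping.keys t \<subseteq> V}"
  have add: "f + g \<in> ?C" if "f \<in> ?C" "g \<in> ?C" for f g
    using that Poly_Mapping.keys_add[of f g] by blast
  have uminus: "- f \<in> ?C" if "f \<in> ?C" for f
    using that by simp
  have mult: "f * g \<in> ?C" if fg: "f \<in> ?C" "g \<in> ?C" for f g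
  proof (rule CollectI, rule ballI)
    fix t assume "t \<in> Poly_Mapping.keys (f * g)"
    then obtain a b where "t = a + b" "a \<in> Poly_Mapping.keys f" "b \<in> Poly_Mapping.keys g"
      using keys_mult[of f g] by blast
    then show "Poly_Mapping.keys t \<subseteq> V"
      using fg Poly_Mapping.keys_add[of a b] by blast
  qed
  have neg: "\<exists>g\<in>?C. g + f = 0" if "f \<in> ?C" for f
    using uminus[OF that] by (intro bexI[of _ "- f"]) simp_all
  have one: "(1 :: ('v, 'k) mpoly) \<in> ?C"
    by simp
  show ?thesis
  proof (intro cringI abelian_groupI comm_monoidI)
    fix f :: "('v, 'k) mpoly"
    assume "f \<in> carrier (poly_ring V)"
    then show "\<exists>g\<in>carrier (poly_ring V). g \<oplus>\<^bsub>poly_ring V\<^esub> f = \<zero>\<^bsub>poly_ring V\<^esub>"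
      using neg[of f] by (simp only: poly_ring_def ring_record_simps monoid.simps partial_object.simps)
  qed (use add mult one in \<open>auto simp only: poly_ring_def ring_record_simps
         monoid.simps partial_object.simps keys_zero algebra_simps
         add_0 add_0_right mult_1 mult_1_right\<close>)
qed


section \<open>Linear quotients\<close>

definition colon_ideal ::
  "'v set \<Rightarrow> ('v, 'k::field) mpoly set \<Rightarrow> ('v, 'k) mpoly set \<Rightarrow> ('v, 'k) mpoly set" where
  "colon_ideal V I J = {f \<in> carrier (poly_ring V). \<forall>g\<in>J. f * g \<in> I}"

definition minimal_monomial_generators ::
  "'v set \<Rightarrow> ('v, 'k::field) mpoly set \<Rightarrow> ('v, 'k) mpoly set \<Rightarrow> bool" where
  "minimal_monomial_generators V I B \<longleftrightarrow>
     B \<subseteq> monomials V \<and> Idl\<^bsub>poly_ring V\<^esub> B = I \<and> (\<forall>B'. B' \<subset> B \<longrightarrow> Idl\<^bsub>poly_ring V\<^esub> B' \<noteq> I)"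

text \<open>The list is indexed from 0, so the colon conditions start at index 1.\<close>

definition has_linear_quotients :: "'v set \<Rightarrow> ('v, 'k::field) mpoly set \<Rightarrow> bool" where
  "has_linear_quotients V I \<longleftrightarrow>
     (\<exists>us. distinct us \<and> minimal_monomial_generators V I (set us) \<and>
       (\<forall>i. 1 \<le> i \<and> i < length us \<longrightarrow>
         (\<exists>W \<subseteq> V. colon_ideal V (Idl\<^bsub>poly_ring V\<^esub> (set (take i us))) (Idl\<^bsub>poly_ring V\<^esub> {us ! i})
            = Idl\<^bsub>poly_ring V\<^esub> (pvar ` W))))"


section \<open>Graded free resolutions and componentwise linear ideals\<close>

definition free_mod :: "'v set \<Rightarrow> nat \<Rightarrow> ('v, 'k::field) mpoly vec set" where
  "free_mod V n = {x \<in> carrier_vec n. \<forall>j<n. x $ j \<in> carrier (poly_ring V)}"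

text \<open>
  With \<open>S = K[V]\<close>, the data \<open>r, a, g, D\<close> describe a complex
  \<open>\<dots> \<rightarrow> F\<^sub>2 \<rightarrow> F\<^sub>1 \<rightarrow> F\<^sub>0 \<rightarrow> I \<rightarrow> 0\<close> with \<open>F\<^sub>i = \<Oplus>j<r i. S(-a i j)\<close>; the augmentation
  \<open>F\<^sub>0 \<rightarrow> I\<close> is given by the row vector \<open>g\<close>, and the differential \<open>F\<^sub>i\<^sub>+\<^sub>1 \<rightarrow> F\<^sub>i\<close> by the matrix \<open>D i\<close>.
  The homogeneity conditions say that these maps have degree 0.  Ranks may be 0 from some point on.
\<close>

definition graded_free_resolution ::
  "'v set \<Rightarrow> ('v, 'k::field) mpoly set \<Rightarrow> (nat \<Rightarrow> nat) \<Rightarrow> (nat \<Rightarrow> nat \<Rightarrow> int) \<Rightarrow>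
   ('v, 'k) mpoly vec \<Rightarrow> (nat \<Rightarrow> ('v, 'k) mpoly mat) \<Rightarrow> bool" where
  "graded_free_resolution V I r a g D \<longleftrightarrow>
     g \<in> free_mod V (r 0) \<and> (\<forall>j<r 0. homogeneous (a 0 j) (g $ j)) \<and>
     (\<forall>i. D i \<in> carrier_mat (r i) (r (Suc i)) \<and>
        (\<forall>j<r i. \<forall>k<r (Suc i). D i $$ (j, k) \<in> carrier (poly_ring V) \<and>
           homogeneous (a (Suc i) k - a i j) (D i $$ (j, k)))) \<and>
     (\<lambda>x. g \<bullet> x) ` free_mod V (r 0) = I \<and>
     {x \<in> free_mod V (r 0). g \<bullet> x = 0} = (\<lambda>x. D 0 *\<^sub>v x) ` free_mod V (r 1) \<and>
     (\<forall>i. {x \<in> free_mod V (r (Suc i)). D i *\<^sub>v x = 0\<^sub>v (r i)}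
            = (\<lambda>x. D (Suc i) *\<^sub>v x) ` free_mod V (r (Suc (Suc i))))"

text \<open>Minimality: every differential maps into the graded maximal ideal times its target.\<close>

definition minimal_graded_free_resolution ::
  "'v set \<Rightarrow> ('v, 'k::field) mpoly set \<Rightarrow> (nat \<Rightarrow> nat) \<Rightarrow> (nat \<Rightarrow> nat \<Rightarrow> int) \<Rightarrow>
   ('v, 'k) mpoly vec \<Rightarrow> (nat \<Rightarrow> ('v, 'k) mpoly mat) \<Rightarrow> bool" where
  "minimal_graded_free_resolution V I r a g D \<longleftrightarrow>
     graded_free_resolution V I r a g D \<and>
     (\<forall>i. \<forall>j<r i. \<forall>k<r (Suc i). D i $$ (j, k) \<in> Idl\<^bsub>poly_ring V\<^esub> (pvar ` V))"

text \<open>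
  A linear resolution has \<open>F\<^sub>i = S(-d-i)\<^bsup>r i\<^esup>\<close> for a fixed \<open>d\<close>.  The zero ideal has a linear
  resolution (all ranks 0).
\<close>

definition has_linear_resolution :: "'v set \<Rightarrow> ('v, 'k::field) mpoly set \<Rightarrow> bool" where
  "has_linear_resolution V I \<longleftrightarrow>
     (\<exists>d r a g D. minimal_graded_free_resolution V I r a g D \<and>
        (\<forall>i. \<forall>j<r i. a i j = d + int i))"

definition componentwise_linear :: "'v set \<Rightarrow> ('v, 'k::field) mpoly set \<Rightarrow> bool" where
  "componentwise_linear V I \<longleftrightarrow>
     homogeneous_ideal V I \<and>
     (\<forall>l::nat. has_linear_resolution V (Idl\<^bsub>poly_ring V\<^esub> {f \<in> I. homogeneous (int l) f}))"


section \<open>Cover ideals and clique graphs\<close>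

text \<open>
  A simple graph is given by its vertex set \<open>V\<close> and a set \<open>E\<close> of two-element edges, so that for an
  edge \<open>e = {u, v}\<close> the ideal \<open>(u, v)\<close> is generated by \<open>pvar ` e\<close>.  The power is taken in the monoid
  of ideals under ideal multiplication.  Intersecting with the carrier only matters for edgeless
  graphs, where the ideal is the whole ring.
\<close>

definition cover_ideal :: "'v set \<Rightarrow> 'v set set \<Rightarrow> ('v, 'k::field) mpoly set" where
  "cover_ideal V E = carrier (poly_ring V) \<inter> (\<Inter>e\<in>E. Idl\<^bsub>poly_ring V\<^esub> (pvar ` e))"

definition cover_ideal_symbolic_power ::
  "'v set \<Rightarrow> 'v set set \<Rightarrow> nat \<Rightarrow> ('v, 'k::field) mpoly set" where
  "cover_ideal_symbolic_power V E k =
     carrier (poly_ring V) \<inter>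
     (\<Inter>e\<in>E. (Idl\<^bsub>poly_ring V\<^esub> (pvar ` e)) [^]\<^bsub>ideals_set (poly_ring V)\<^esub> k)"

datatype clique_vertex = X nat | Y nat nat

definition clique_block :: "nat \<Rightarrow> (nat \<Rightarrow> nat) \<Rightarrow> nat \<Rightarrow> clique_vertex set" where
  "clique_block p m i = X ` {1..p} \<union> Y i ` {1..m i}"

definition n_clique_vertices :: "nat \<Rightarrow> nat \<Rightarrow> (nat \<Rightarrow> nat) \<Rightarrow> clique_vertex set" where
  "n_clique_vertices p n m = X ` {1..p} \<union> (\<Union>i\<in>{1..n}. Y i ` {1..m i})"

definition complete_edges :: "'v set \<Rightarrow> 'v set set" where
  "complete_edges W = {{u, v} | u v. u \<in> W \<and> v \<in> W \<and> u \<noteq> v}"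

definition n_clique_edges :: "nat \<Rightarrow> nat \<Rightarrow> (nat \<Rightarrow> nat) \<Rightarrow> clique_vertex set set" where
  "n_clique_edges p n m = (\<Union>i\<in>{1..n}. complete_edges (clique_block p m i))"

lemma cover_ideal_symbolic_power_1:
  assumes "\<And>e. e \<in> E \<Longrightarrow> e \<subseteq> V"
  shows "cover_ideal_symbolic_power V E 1 = (cover_ideal V E :: ('v, 'k::field) mpoly set)"
proof -
  let ?R = "poly_ring V :: ('v, 'k) mpoly ring"
  interpret cring ?R
    by (rule poly_ring_cring)
  interpret M: comm_monoid "ideals_set ?R"
    by (rule ideals_set_is_comm_monoid)
  have "(Idl\<^bsub>?R\<^esub> (pvar ` e)) [^]\<^bsub>ideals_set ?R\<^esub> (1::nat) = Idl\<^bsub>?R\<^esub> (pvar ` e)" if "e \<in> E" for e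
  proof -
    have "pvar ` e \<subseteq> carrier ?R"
      using assms[OF that] by (auto simp: poly_ring_def pvar_def)
    then have "Idl\<^bsub>?R\<^esub> (pvar ` e) \<in> carrier (ideals_set ?R)"
      by (simp add: ideals_set_def genideal_ideal)
    then show ?thesis
      by (simp only: One_nat_def M.nat_pow_Suc M.nat_pow_0 M.l_one)
  qed
  then show ?thesis
    by (simp add: cover_ideal_symbolic_power_def cover_ideal_def)
qed

end

theory Submission
  imports Defs "HOL-Library.Product_Lexorder"
begin

text \<open>
  Monomials in \<open>J(G)\<^sup>(\<^sup>k\<^sup>)\<close> are \<open>k\<close>-covers: exponent vectors \<open>a\<close> with \<open>a\<^sub>x + a\<^sub>y \<ge> k\<close> on every edge.
  If at most one \<open>m i\<close> is 1, order the minimal \<open>k\<close>-covers by a convex energy \<open>\<Sum>x. a\<^sub>x\<^sup>2\<close>, with small weights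
  breaking ties.  Whenever another cover \<open>v\<close> has no more energy than a minimal cover \<open>u\<close>, one can raise \<open>u\<close>
  at a vertex where \<open>v\<close> is larger and lower it at a second vertex, keeping a cover and losing energy;
  this exchange gives linear quotients.  Linear quotients pass to the degree components of the ideal, and
  from a list of homogeneous vectors with linear quotients to a generating list of its syzygies, which has
  linear entries.  Iteration gives the linear resolutions.
  If \<open>m i = m j = 1\<close> for some \<open>i \<noteq> j\<close> and \<open>k \<ge> 2\<close>, then in a suitable degree the covers below a fixed
  monomial fall into two classes that are not connected by linear syzygies.
\<close>

section \<open>Monomial ideals\<close>

text \<open>The obstacle is that lowering a vertex breaks the covering condition unless all its
  tight neighbours rise, while linear quotients allow only a single rise. If all shared vertices
  have value at least \<open>k/2\<close>, a minimal cover has one low vertex among two or more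
  private vertices of a block, the others take the complementary value, and a unit can move to the
  low vertex whenever this loses energy. The private vertex of a one-vertex block can trade only
  with shared vertices; if two such vertices are tight, raising one does not free a unit at a shared
  vertex. This is where the condition on the \<open>m i\<close> enters. The squares in the energy
  reflect that units move from larger to smaller values. On the algebraic side, no uniqueness of
  minimal resolutions is invoked: one direction constructs a resolution, the other tests an
  arbitrary one at a single monomial.\<close>

abbreviation lookup where "lookup \<equiv> Poly_Mapping.lookup"
abbreviation keys where "keys \<equiv> Poly_Mapping.keys"
abbreviation single where "single \<equiv> Poly_Mapping.single"

abbreviation pp :: "('v \<Rightarrow>\<^sub>0 nat) \<Rightarrow> ('v, 'k::field) mpoly" where
  "pp t \<equiv> single t 1"

abbreviation var :: "'v \<Rightarrow> 'v \<Rightarrow>\<^sub>0 nat" where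
  "var v \<equiv> single v (Suc 0)"

definition divides :: "('v \<Rightarrow>\<^sub>0 nat) \<Rightarrow> ('v \<Rightarrow>\<^sub>0 nat) \<Rightarrow> bool"  (infix \<open>\<preceq>\<close> 50) where
  "s \<preceq> t \<longleftrightarrow> (\<forall>v. lookup s v \<le> lookup t v)"

definition mono_ideal :: "'v set \<Rightarrow> ('v \<Rightarrow>\<^sub>0 nat) set \<Rightarrow> ('v, 'k::field) mpoly set" where
  "mono_ideal V T = {f \<in> carrier (poly_ring V). \<forall>t\<in>keys f. \<exists>s\<in>T. s \<preceq> t}"

definition proj :: "('a \<Rightarrow> bool) \<Rightarrow> ('a \<Rightarrow>\<^sub>0 'b::zero) \<Rightarrow> ('a \<Rightarrow>\<^sub>0 'b)" where
  "proj P f = Poly_Mapping.mapp (\<lambda>t c. if P t then c else 0) f"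

lemma divides_refl [simp]: "s \<preceq> s"
  by (simp add: divides_def)

lemma divides_trans: "s \<preceq> t \<Longrightarrow> t \<preceq> u \<Longrightarrow> s \<preceq> u"
  unfolding divides_def using order_trans by blast

lemma divides_add [simp]: "s \<preceq> t + s" "s \<preceq> s + t"
  by (auto simp: divides_def lookup_add)

lemma divides_minus_add: "s \<preceq> t \<Longrightarrow> t - s + s = t"
  by (rule poly_mapping_eqI) (simp add: divides_def lookup_add lookup_minus)

lemma keys_divides: "s \<preceq> t \<Longrightarrow> keys s \<subseteq> keys t"
  unfolding divides_def by (auto simp: in_keys_iff) (meson less_le_trans)

lemma keys_nat_add: "keys (s + t :: 'v \<Rightarrow>\<^sub>0 nat) = keys s \<union> keys t"
  by (auto simp: in_keys_iff lookup_add)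

lemma var_divides_iff: "var v \<preceq> t \<longleftrightarrow> v \<in> keys t"
proof -
  have "var v \<preceq> t \<longleftrightarrow> 1 \<le> lookup t v"
    unfolding divides_def by (auto simp: lookup_single when_def dest: spec[of _ v])
  then show ?thesis
    by (auto simp: in_keys_iff)
qed

lemma mdeg_eq_sum: "finite A \<Longrightarrow> keys t \<subseteq> A \<Longrightarrow> mdeg t = (\<Sum>v\<in>A. lookup t v)"
  unfolding mdeg_def by (rule sum.mono_neutral_left) (auto simp: in_keys_iff)

lemma mdeg_add: "mdeg (s + t) = mdeg s + mdeg t"
proof -
  have "mdeg (s + t) = (\<Sum>v\<in>keys s \<union> keys t. lookup (s + t) v)"
    by (rule mdeg_eq_sum) (auto simp: keys_nat_add)
  also have "\<dots> = mdeg s + mdeg t"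
    using mdeg_eq_sum[of "keys s \<union> keys t" s] mdeg_eq_sum[of "keys s \<union> keys t" t]
    by (simp add: lookup_add sum.distrib)
  finally show ?thesis .
qed

lemma mdeg_var [simp]: "mdeg (var v) = 1"
  by (simp add: mdeg_def)

lemma mdeg_eq_1: "mdeg t = 1 \<Longrightarrow> \<exists>v. t = var v"
proof -
  assume t: "mdeg t = 1"
  then obtain v where v: "v \<in> keys t"
    unfolding mdeg_def by fastforce
  then have "t - var v + var v = t"
    by (intro divides_minus_add) (simp add: var_divides_iff)
  then have "mdeg (t - var v) = 0"
    using mdeg_add[of "t - var v" "var v"] t by simp
  then have "t - var v = 0"
    unfolding mdeg_def by (auto simp: in_keys_iff intro: poly_mapping_eqI)
  then show ?thesis
    using \<open>t - var v + var v = t\<close> by auto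
qed

lemma mdeg_mono: "s \<preceq> t \<Longrightarrow> mdeg s \<le> mdeg t"
  by (metis divides_minus_add mdeg_add le_add2)

lemma divides_mdeg_eq: "s \<preceq> t \<Longrightarrow> mdeg s = mdeg t \<Longrightarrow> s = t"
proof -
  assume st: "s \<preceq> t" "mdeg s = mdeg t"
  have "mdeg (t - s) = 0"
    using divides_minus_add[OF st(1)] mdeg_add[of "t - s" s] st(2) by simp
  then have "t - s = 0"
    unfolding mdeg_def by (auto simp: in_keys_iff intro: poly_mapping_eqI)
  then show ?thesis
    using divides_minus_add[OF st(1)] by simp
qed

section \<open>Restriction of polynomials to sets of monomials\<close>

lemma lookup_proj: "lookup (proj P f) t = (if P t then lookup f t else 0)"
  by (simp add: proj_def lookup_mapp when_def in_keys_iff)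

lemma keys_proj: "keys (proj P f) = {t \<in> keys f. P t}"
  by (auto simp: in_keys_iff lookup_proj split: if_splits)

lemma proj_add: "proj P (f + g :: _ \<Rightarrow>\<^sub>0 'b::monoid_add) = proj P f + proj P g"
  by (rule poly_mapping_eqI) (simp add: lookup_proj lookup_add)

lemma proj_sum: "proj P (\<Sum>i\<in>A. f i :: _ \<Rightarrow>\<^sub>0 'b::comm_monoid_add) = (\<Sum>i\<in>A. proj P (f i))"
  by (rule poly_mapping_eqI) (simp add: lookup_proj lookup_sum)

lemma proj_id: "(\<And>t. t \<in> keys f \<Longrightarrow> P t) \<Longrightarrow> proj P f = f"
  by (rule poly_mapping_eqI) (auto simp: lookup_proj in_keys_iff)

lemma proj_zero: "(\<And>t. t \<in> keys f \<Longrightarrow> \<not> P t) \<Longrightarrow> proj P f = 0"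
  by (rule poly_mapping_eqI) (auto simp: lookup_proj in_keys_iff)

lemma proj_split: "f = proj P f + proj (\<lambda>t. \<not> P t) (f :: _ \<Rightarrow>\<^sub>0 'b::monoid_add)"
  by (rule poly_mapping_eqI) (simp add: lookup_proj lookup_add)

text \<open>Multiplication by a form of degree \<open>q\<close> shifts degrees by exactly
  \<open>q\<close>, so it commutes with taking degree components. With this, arbitrary coefficients
  in a relation between homogeneous vectors can be replaced by their linear parts.\<close>

lemma proj_degree_mult:
  fixes f g :: "('v, 'k::field) mpoly"
  assumes g: "\<And>t. t \<in> keys g \<Longrightarrow> mdeg t = q"
  shows "proj (\<lambda>t. mdeg t = d + q) (f * g) = proj (\<lambda>t. mdeg t = d) f * g"
proof -
  let ?f1 = "proj (\<lambda>t. mdeg t = d) f" and ?f2 = "proj (\<lambda>t. mdeg t \<noteq> d) f"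
  let ?P = "proj (\<lambda>t. mdeg t = d + q) :: ('v, 'k) mpoly \<Rightarrow> _"
  have "?P (f * g) = ?P ((?f1 + ?f2) * g)"
    using proj_split[of f "\<lambda>t. mdeg t = d"] by simp
  also have "\<dots> = ?P (?f1 * g) + ?P (?f2 * g)"
    by (simp only: distrib_right proj_add)
  also have "?P (?f1 * g) = ?f1 * g"
    using keys_mult[of ?f1 g] g by (intro proj_id) (auto simp: keys_proj mdeg_add)
  also have "?P (?f2 * g) = 0"
    using keys_mult[of ?f2 g] g by (intro proj_zero) (fastforce simp: keys_proj mdeg_add)
  finally show ?thesis by simp
qed

lemma sum_singles: "(\<Sum>t\<in>keys f. single t (lookup f t)) = f"
  by (rule poly_mapping_eqI)
    (auto simp: lookup_sum lookup_single when_def in_keys_iff sum.delta)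

text \<open>The case distinction is essential because subtraction of exponents is truncated:
  \<open>t - s\<close> is a quotient only if \<open>s\<close> divides \<open>t\<close>.\<close>

lemma lookup_single_mult:
  fixes f :: "('v, 'k::field) mpoly"
  shows "lookup (single s c * f) t = (if s \<preceq> t then c * lookup f (t - s) else 0)"
proof -
  have eq: "s + a = t \<longleftrightarrow> s \<preceq> t \<and> a = t - s" for a
    by (metis add.commute add_diff_cancel_right' divides_add(2) divides_minus_add)
  have "single s c * f = (\<Sum>a\<in>keys f. single (s + a) (c * lookup f a))"
    by (subst (1) sum_singles[of f, symmetric]) (simp add: sum_distrib_left mult_single)
  then have "lookup (single s c * f) t = (\<Sum>a\<in>keys f. if s + a = t then c * lookup f a else 0)"
    by (simp add: lookup_sum lookup_single when_def)
  also have "\<dots> = (if s \<preceq> t then c * lookup f (t - s) else 0)"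
    by (auto simp: eq sum.delta in_keys_iff)
  finally show ?thesis .
qed

section \<open>Monomial ideals of \<open>K[V]\<close>, described by supports\<close>

lemma carrier_poly_ring: "f \<in> carrier (poly_ring V) \<longleftrightarrow> (\<forall>t\<in>keys f. keys t \<subseteq> V)"
  by (simp add: poly_ring_def)

lemma poly_ring_simps [simp]:
  "x \<otimes>\<^bsub>poly_ring V\<^esub> y = x * y" "x \<oplus>\<^bsub>poly_ring V\<^esub> y = x + y"
  "\<one>\<^bsub>poly_ring V\<^esub> = 1" "\<zero>\<^bsub>poly_ring V\<^esub> = 0"
  by (simp_all add: poly_ring_def)

lemma carrier_closed:
  fixes f g :: "('v, 'k::field) mpoly"
  shows "0 \<in> carrier (poly_ring V :: ('v, 'k) mpoly ring)"
    and "1 \<in> carrier (poly_ring V :: ('v, 'k) mpoly ring)"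
    and "f \<in> carrier (poly_ring V) \<Longrightarrow> g \<in> carrier (poly_ring V) \<Longrightarrow> f + g \<in> carrier (poly_ring V)"
    and "f \<in> carrier (poly_ring V) \<Longrightarrow> g \<in> carrier (poly_ring V) \<Longrightarrow> f * g \<in> carrier (poly_ring V)"
    and "f \<in> carrier (poly_ring V) \<Longrightarrow> - f \<in> carrier (poly_ring V)"
    and "f \<in> carrier (poly_ring V) \<Longrightarrow> g \<in> carrier (poly_ring V) \<Longrightarrow> f - g \<in> carrier (poly_ring V)"
proof -
  interpret cring "poly_ring V :: ('v, 'k) mpoly ring" by (rule poly_ring_cring)
  show "0 \<in> carrier (poly_ring V :: ('v, 'k) mpoly ring)" using zero_closed by simp
  show "1 \<in> carrier (poly_ring V :: ('v, 'k) mpoly ring)" using one_closed by simp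
  show *: "f \<in> carrier (poly_ring V) \<Longrightarrow> g \<in> carrier (poly_ring V) \<Longrightarrow> f + g \<in> carrier (poly_ring V)"
    for f g :: "('v, 'k) mpoly" using a_closed[of f g] by simp
  show "f \<in> carrier (poly_ring V) \<Longrightarrow> g \<in> carrier (poly_ring V) \<Longrightarrow> f * g \<in> carrier (poly_ring V)"
    using m_closed[of f g] by simp
  show **: "f \<in> carrier (poly_ring V) \<Longrightarrow> - f \<in> carrier (poly_ring V)" for f :: "('v, 'k) mpoly"
    by (simp add: carrier_poly_ring)
  show "f \<in> carrier (poly_ring V) \<Longrightarrow> g \<in> carrier (poly_ring V) \<Longrightarrow> f - g \<in> carrier (poly_ring V)"
    using *[of f "- g"] ** by simp
qed

lemma carrier_sum:
  "(\<And>i. i \<in> A \<Longrightarrow> f i \<in> carrier (poly_ring V)) \<Longrightarrow> sum f A \<in> carrier (poly_ring V)"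
  by (induction A rule: infinite_finite_induct) (simp_all add: carrier_closed)

lemma carrier_single: "keys t \<subseteq> V \<Longrightarrow> single t c \<in> carrier (poly_ring V)"
  by (simp add: carrier_poly_ring)

lemma mono_ideal_ideal: "ideal (mono_ideal V T) (poly_ring V :: ('v, 'k::field) mpoly ring)"
proof -
  let ?R = "poly_ring V :: ('v, 'k) mpoly ring"
  interpret cring ?R by (rule poly_ring_cring)
  have mult: "x * a \<in> mono_ideal V T" if "a \<in> mono_ideal V T" "x \<in> carrier ?R"
    for a x :: "('v, 'k) mpoly"
    using that keys_mult[of x a] carrier_closed(4)[of x V a]
    unfolding mono_ideal_def by (fastforce intro: divides_trans)
  have neg: "\<ominus>\<^bsub>?R\<^esub> a = - a" if "a \<in> carrier ?R" for a
    by (rule minus_equality) (use that in \<open>simp_all add: carrier_closed\<close>)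
  have "subgroup (mono_ideal V T) (add_monoid ?R)"
  proof
    show "mono_ideal V T \<subseteq> carrier (add_monoid ?R)"
      by (auto simp: mono_ideal_def)
    show "x \<otimes>\<^bsub>add_monoid ?R\<^esub> y \<in> mono_ideal V T" if "x \<in> mono_ideal V T" "y \<in> mono_ideal V T" for x y
      using that Poly_Mapping.keys_add[of x y] carrier_closed(3)[of x V y]
      unfolding mono_ideal_def by auto
    show "\<one>\<^bsub>add_monoid ?R\<^esub> \<in> mono_ideal V T"
      by (simp add: mono_ideal_def carrier_closed)
    show "inv\<^bsub>add_monoid ?R\<^esub> x \<in> mono_ideal V T" if "x \<in> mono_ideal V T" for x
      using that neg[of x] unfolding a_inv_def[symmetric]
      by (simp add: mono_ideal_def carrier_closed)
  qed
  then show ?thesis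
    by (intro idealI ring_axioms) (use mult in \<open>auto simp: mult.commute\<close>)
qed

lemma ideal_singlesI:
  fixes f :: "('v, 'k::field) mpoly"
  assumes "ideal I (poly_ring V)" "\<And>t. t \<in> keys f \<Longrightarrow> single t (lookup f t) \<in> I"
  shows "f \<in> I"
proof -
  interpret I: ideal I "poly_ring V" by fact
  have "sum g A \<in> I" if "\<And>x. x \<in> A \<Longrightarrow> g x \<in> I" for g and A :: "('v \<Rightarrow>\<^sub>0 nat) set"
    using that
  proof (induction A rule: infinite_finite_induct)
    case (insert x F)
    then show ?case
      using additive_subgroup.a_closed[OF I.is_additive_subgroup, of "g x" "sum g F"] by simp
  qed (use additive_subgroup.zero_closed[OF I.is_additive_subgroup] in simp_all)
  then have "(\<Sum>t\<in>keys f. single t (lookup f t)) \<in> I"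
    using assms(2) by simp
  then show ?thesis
    by (simp only: sum_singles)
qed

text \<open>Each term of a member of \<open>mono_ideal V T\<close> is a multiple of a generator.
  This trades the abstract generated ideal for a condition on supports, so that the later ideal
  computations run on exponents.\<close>

lemma Idl_pp:
  assumes T: "\<And>t. t \<in> T \<Longrightarrow> keys t \<subseteq> V"
  shows "Idl\<^bsub>poly_ring V\<^esub> (pp ` T) = (mono_ideal V T :: ('v, 'k::field) mpoly set)"
proof -
  let ?R = "poly_ring V :: ('v, 'k) mpoly ring"
  interpret cring ?R by (rule poly_ring_cring)
  have sub: "pp ` T \<subseteq> carrier ?R"
    using T by (auto intro: carrier_single)
  interpret I: ideal "Idl\<^bsub>?R\<^esub> (pp ` T)" ?R
    by (rule genideal_ideal[OF sub])
  show ?thesis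
  proof
    show "Idl\<^bsub>?R\<^esub> (pp ` T) \<subseteq> mono_ideal V T"
      by (rule genideal_minimal[OF mono_ideal_ideal])
        (use sub in \<open>auto simp: mono_ideal_def intro: divides_refl\<close>)
    show "mono_ideal V T \<subseteq> Idl\<^bsub>?R\<^esub> (pp ` T)"
    proof
      fix f :: "('v, 'k) mpoly" assume f: "f \<in> mono_ideal V T"
      show "f \<in> Idl\<^bsub>?R\<^esub> (pp ` T)"
      proof (rule ideal_singlesI[OF I.is_ideal])
        fix t assume t: "t \<in> keys f"
        obtain s where s: "s \<in> T" "s \<preceq> t"
          using f t by (auto simp: mono_ideal_def)
        have "keys t \<subseteq> V" using f t by (auto simp: mono_ideal_def carrier_poly_ring)
        then have "keys (t - s) \<subseteq> V"
          using keys_divides[of "t - s" t] divides_minus_add[OF s(2)] divides_add(2)[of "t - s" s] by simp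
        then have "single (t - s) (lookup f t) * pp s \<in> Idl\<^bsub>?R\<^esub> (pp ` T)"
          using I.I_l_closed[of "pp s" "single (t - s) (lookup f t)"] genideal_self[OF sub] s
          by (auto intro: carrier_single)
        then show "single t (lookup f t) \<in> Idl\<^bsub>?R\<^esub> (pp ` T)"
          by (simp add: mult_single divides_minus_add[OF s(2)])
      qed
    qed
  qed
qed

text \<open>The terms divisible by an element of \<open>T\<close> form \<open>b\<close>. The
  remaining ones must be multiples of \<open>s\<close>, and dividing them by \<open>s\<close> gives
  \<open>a\<close>.\<close>

lemma mono_ideal_insertE:
  fixes f :: "('v, 'k::field) mpoly"
  assumes "f \<in> mono_ideal V (insert s T)"
  obtains a b where "a \<in> carrier (poly_ring V)" "b \<in> mono_ideal V T" "f = a * pp s + b"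
proof -
  let ?P = "\<lambda>t. \<exists>u\<in>T. u \<preceq> t"
  define b where "b = proj ?P f"
  define r where "r = proj (\<lambda>t. \<not> ?P t) f"
  define a where "a = (\<Sum>t\<in>keys r. single (t - s) (lookup r t))"
  have f: "f = r + b"
    unfolding r_def b_def using proj_split[of f ?P] by (simp add: add.commute)
  have b: "b \<in> mono_ideal V T"
    using assms by (auto simp: b_def mono_ideal_def keys_proj carrier_poly_ring)
  have r: "s \<preceq> t" "keys t \<subseteq> V" if "t \<in> keys r" for t
    using that assms unfolding r_def
    by (auto simp: keys_proj mono_ideal_def carrier_poly_ring)
  have "a * pp s = (\<Sum>t\<in>keys r. single t (lookup r t))"
    unfolding a_def sum_distrib_right
    by (rule sum.cong) (simp_all add: mult_single divides_minus_add r)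
  then have "a * pp s = r"
    by (simp add: sum_singles)
  moreover have "a \<in> carrier (poly_ring V)"
    unfolding a_def
  proof (intro carrier_sum carrier_single)
    fix t assume t: "t \<in> keys r"
    have "keys t = keys (t - s) \<union> keys s"
      using divides_minus_add[OF r(1)[OF t]] keys_nat_add by metis
    then show "keys (t - s) \<subseteq> V" using r(2)[OF t] by auto
  qed
  ultimately show thesis using that b f by simp
qed

lemma pvar_eq: "pvar v = pp (var v)"
  by (simp add: pvar_def)

lemma Idl_pvar:
  assumes "W \<subseteq> V"
  shows "Idl\<^bsub>poly_ring V\<^esub> (pvar ` W)
    = {f \<in> carrier (poly_ring V :: ('v, 'k::field) mpoly ring). \<forall>t\<in>keys f. keys t \<inter> W \<noteq> {}}"
proof -
  have "pvar ` W = (pp ` (var ` W) :: ('v, 'k) mpoly set)"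
    by (simp add: pvar_eq image_image)
  moreover have "Idl\<^bsub>poly_ring V\<^esub> (pp ` (var ` W) :: ('v, 'k) mpoly set) = mono_ideal V (var ` W)"
    using assms by (intro Idl_pp) auto
  ultimately show ?thesis
    by (auto simp: mono_ideal_def var_divides_iff)
qed

text \<open>Recovers divisibility between generators from an equality of ideals; this is what shows
  that a proper subset of an antichain generates a smaller ideal.\<close>

lemma mono_ideal_eqD:
  assumes "mono_ideal V S = (mono_ideal V T :: ('v, 'k::field) mpoly set)"
    and "s \<in> S" "keys s \<subseteq> V"
  shows "\<exists>t\<in>T. t \<preceq> s"
proof -
  have "pp s \<in> (mono_ideal V S :: ('v, 'k) mpoly set)"
    using assms(2,3) by (auto simp: mono_ideal_def intro: carrier_single divides_refl)
  then show ?thesis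
    unfolding assms(1) by (auto simp: mono_ideal_def)
qed

section \<open>Linear quotients for modules and linear resolutions\<close>

text \<open>Elements of free modules are functions that vanish from the rank on, so that all ranks share one type.\<close>

definition lcomb :: "(nat \<Rightarrow> 'a::semiring_0) \<Rightarrow> (nat \<Rightarrow> 'a) list \<Rightarrow> nat \<Rightarrow> 'a" where
  "lcomb f cs = (\<lambda>l. \<Sum>j<length cs. f j * (cs ! j) l)"

definition lspan :: "'v set \<Rightarrow> (nat \<Rightarrow> ('v, 'k::field) mpoly) list \<Rightarrow> (nat \<Rightarrow> ('v, 'k) mpoly) set" where
  "lspan V cs = {lcomb f cs | f. \<forall>j. f j \<in> carrier (poly_ring V)}"

definition syz :: "'v set \<Rightarrow> (nat \<Rightarrow> ('v, 'k::field) mpoly) list \<Rightarrow> (nat \<Rightarrow> ('v, 'k) mpoly) set" where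
  "syz V cs = {f. (\<forall>j. f j \<in> carrier (poly_ring V)) \<and> (\<forall>j\<ge>length cs. f j = 0) \<and> lcomb f cs = (\<lambda>l. 0)}"

text \<open>For \<open>W\<close> inside \<open>V\<close> this is the prime ideal generated by the
  variables in \<open>W\<close>, given by supports.\<close>

definition var_ideal :: "'v set \<Rightarrow> 'v set \<Rightarrow> ('v, 'k::field) mpoly set" where
  "var_ideal V W = {f \<in> carrier (poly_ring V). \<forall>t\<in>keys f. keys t \<inter> W \<noteq> {}}"

text \<open>Linear quotients for submodules of free modules: the span so far has a colon ideal with
  respect to the next vector that is generated by variables. Ideals alone would not do, since the
  syzygies must satisfy the same notion again.\<close>

inductive module_lq :: "'v set \<Rightarrow> (nat \<Rightarrow> ('v, 'k::field) mpoly) list \<Rightarrow> bool" for V where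
  Nil: "module_lq V []"
| snoc: "module_lq V cs \<Longrightarrow> W \<subseteq> V \<Longrightarrow> finite W \<Longrightarrow>
    (\<And>f. f \<in> carrier (poly_ring V) \<Longrightarrow> (\<lambda>l. f * c l) \<in> lspan V cs \<longleftrightarrow> f \<in> var_ideal V W) \<Longrightarrow>
    module_lq V (cs @ [c])"

definition homog_vec :: "'v set \<Rightarrow> nat \<Rightarrow> (nat \<Rightarrow> ('v, 'k::field) mpoly) \<Rightarrow> bool" where
  "homog_vec V q c \<longleftrightarrow> (\<forall>l. c l \<in> carrier (poly_ring V) \<and> (\<forall>t\<in>keys (c l). mdeg t = q))"

lemma lcomb_cong:
  "(\<And>j. j < length cs \<Longrightarrow> f j = g j) \<Longrightarrow> lcomb f cs = lcomb g cs"
  by (simp add: lcomb_def)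

lemma lcomb_snoc: "lcomb f (cs @ [c]) l = lcomb f cs l + f (length cs) * c l"
  by (simp add: lcomb_def nth_append)

lemma lcomb_add: "lcomb (\<lambda>j. f j + g j) cs l = lcomb f cs l + lcomb g cs l"
  by (simp add: lcomb_def distrib_right sum.distrib)

lemma lcomb_smult: "lcomb (\<lambda>j. a * f j) cs l = a * lcomb f cs l"
  by (simp add: lcomb_def sum_distrib_left mult.assoc)

lemma lcomb_uminus: "lcomb (\<lambda>j. - f j) cs l = - lcomb f cs l" for f :: "nat \<Rightarrow> 'a::ring"
  by (simp add: lcomb_def sum_negf)

lemma lspan_Nil [simp]: "lspan V [] = {\<lambda>l. 0}"
  by (auto simp: lspan_def lcomb_def intro!: exI[of _ "\<lambda>j. 0"] carrier_closed)

lemma lspan_snoc: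
  "x \<in> lspan V (cs @ [c]) \<longleftrightarrow> (\<exists>y\<in>lspan V cs. \<exists>a\<in>carrier (poly_ring V). x = (\<lambda>l. y l + a * c l))"
proof
  assume "x \<in> lspan V (cs @ [c])"
  then obtain f where f: "\<forall>j. f j \<in> carrier (poly_ring V)" "x = lcomb f (cs @ [c])"
    by (auto simp: lspan_def)
  then have "x = (\<lambda>l. lcomb f cs l + f (length cs) * c l)"
    by (auto simp: lcomb_snoc)
  then show "\<exists>y\<in>lspan V cs. \<exists>a\<in>carrier (poly_ring V). x = (\<lambda>l. y l + a * c l)"
    using f(1) by (auto simp: lspan_def)
next
  assume "\<exists>y\<in>lspan V cs. \<exists>a\<in>carrier (poly_ring V). x = (\<lambda>l. y l + a * c l)"
  then obtain f a where f: "\<forall>j. f j \<in> carrier (poly_ring V)" "a \<in> carrier (poly_ring V)"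
    "x = (\<lambda>l. lcomb f cs l + a * c l)"
    by (auto simp: lspan_def)
  have "lcomb (f(length cs := a)) cs = lcomb f cs"
    by (rule lcomb_cong) simp
  then have "x = lcomb (f(length cs := a)) (cs @ [c])"
    using f(3) by (auto simp: lcomb_snoc)
  then show "x \<in> lspan V (cs @ [c])"
    using f(1,2) unfolding lspan_def by (auto intro!: exI[of _ "f(length cs := a)"])
qed

lemma var_ideal_mult:
  "a \<in> carrier (poly_ring V) \<Longrightarrow> f \<in> var_ideal V W \<Longrightarrow> a * f \<in> var_ideal V W"
  using keys_mult[of a f] unfolding var_ideal_def
  by (fastforce simp: keys_nat_add intro: carrier_closed)

lemma var_ideal_add: "f \<in> var_ideal V W \<Longrightarrow> g \<in> var_ideal V W \<Longrightarrow> f + g \<in> var_ideal V W"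
  using Poly_Mapping.keys_add[of f g] unfolding var_ideal_def by (auto intro: carrier_closed)

text \<open>A variable outside \<open>W\<close> is a nonzerodivisor modulo the prime ideal of
  \<open>W\<close>. The colon ideals of the new syzygies are computed from this.\<close>

lemma var_ideal_var_mult_iff:
  fixes f :: "('v, 'k::field) mpoly"
  assumes "w \<in> V" "w \<notin> W" "f \<in> carrier (poly_ring V)"
  shows "pp (var w) * f \<in> var_ideal V W \<longleftrightarrow> f \<in> var_ideal V W"
proof
  assume *: "pp (var w) * f \<in> var_ideal V W"
  have "keys t \<inter> W \<noteq> {}" if "t \<in> keys f" for t
  proof -
    have "var w + t \<in> keys (pp (var w) * f)"
      using that by (simp add: in_keys_iff lookup_single_mult)
    then have "keys (var w + t) \<inter> W \<noteq> {}"
      using * by (auto simp: var_ideal_def)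
    then show ?thesis
      using assms(2) by (auto simp: keys_nat_add)
  qed
  then show "f \<in> var_ideal V W"
    using assms(3) by (simp add: var_ideal_def)
qed (use assms in \<open>auto intro!: var_ideal_mult carrier_single\<close>)

lemma var_ideal_eq: "var_ideal V W = mono_ideal V (var ` W)"
  by (auto simp: var_ideal_def mono_ideal_def var_divides_iff)

lemma var_ideal_insertE:
  assumes "f \<in> var_ideal V (insert w W)"
  obtains a b where "a \<in> carrier (poly_ring V)" "b \<in> var_ideal V W" "f = a * pp (var w) + b"
  using assms unfolding var_ideal_eq image_insert by (rule mono_ideal_insertE)

lemma syz_closed:
  assumes "f \<in> syz V cs" "g \<in> syz V cs" "a \<in> carrier (poly_ring V)"
  shows "(\<lambda>j. f j + a * g j) \<in> syz V cs"
  using assms unfolding syz_def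
  by (auto intro!: ext carrier_closed simp: lcomb_add lcomb_smult)

text \<open>
  If \<open>c\<^sub>1, \<dots>, c\<^sub>n\<close> has linear quotients, with colon ideals generated by \<open>W\<^sub>1, \<dots>, W\<^sub>n\<close>, then its syzygies
  are generated by the vectors \<open>w e\<^sub>i - \<Sum>j<i. h\<^sub>j e\<^sub>j\<close> with \<open>w \<in> W\<^sub>i\<close> and linear forms \<open>h\<^sub>j\<close>, and in the
  obvious order these have linear quotients again.
\<close>

lemma linear_syzygies:
  fixes cs :: "(nat \<Rightarrow> ('v, 'k::field) mpoly) list"
  assumes "module_lq V cs" "\<forall>c\<in>set cs. homog_vec V q c"
  shows "\<exists>ds. module_lq V ds \<and> (\<forall>d\<in>set ds. homog_vec V 1 d \<and> (\<forall>l\<ge>length cs. d l = 0)) \<and>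
    lspan V ds = syz V cs"
  using assms
proof (induction rule: module_lq.induct)
  case Nil
  have "syz V ([] :: (nat \<Rightarrow> ('v, 'k) mpoly) list) = {\<lambda>l. 0}"
    using carrier_closed(1) by (auto simp: syz_def lcomb_def)
  then show ?case by (intro exI[of _ "[]"]) (simp add: module_lq.Nil)
next
  case (snoc cs W c)
  let ?S = "carrier (poly_ring V :: ('v, 'k) mpoly ring)"
  let ?n = "length cs"
  obtain ds where ds: "module_lq V ds" "\<forall>d\<in>set ds. homog_vec V 1 d \<and> (\<forall>l\<ge>?n. d l = 0)"
    "lspan V ds = syz V cs"
    using snoc.IH snoc.prems by auto
  have c: "homog_vec V q c" and cs: "\<And>d. d \<in> set cs \<Longrightarrow> homog_vec V q d"
    using snoc.prems by auto
  have "\<exists>g. g \<in> syz V (cs @ [c]) \<and> homog_vec V 1 g \<and> (\<forall>l\<ge>Suc ?n. g l = 0) \<and> g ?n = pp (var w)"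
    if w: "w \<in> W" for w
  proof -
    have "pp (var w) \<in> var_ideal V W"
      using w snoc.hyps(2) by (auto simp: var_ideal_def intro!: carrier_single)
    then have "(\<lambda>l. pp (var w) * c l) \<in> lspan V cs"
      using snoc.hyps(4)[of "pp (var w)"] w by (auto simp: var_ideal_def)
    then obtain f where f: "\<And>j. f j \<in> ?S" "(\<lambda>l. pp (var w) * c l) = lcomb f cs"
      by (auto simp: lspan_def)
    \<comment> \<open>The coefficients \<open>f j\<close> need not be homogeneous. Since
      \<open>c\<close> and all members of \<open>cs\<close> have degree \<open>q\<close>, comparing
      components of degree \<open>1 + q\<close> shows that the linear parts already give the
      relation.\<close>
    define h where "h = (\<lambda>j. proj (\<lambda>t. mdeg t = 1) (f j))"
    have h: "h j \<in> ?S" "\<And>t. t \<in> keys (h j) \<Longrightarrow> mdeg t = 1" for j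
      using f(1)[of j] by (auto simp: h_def keys_proj carrier_poly_ring)
    have hc: "lcomb h cs l = pp (var w) * c l" for l
    proof -
      have "pp (var w) * c l = proj (\<lambda>t. mdeg t = 1) (pp (var w)) * c l"
        by (subst proj_id) auto
      also have "\<dots> = proj (\<lambda>t. mdeg t = 1 + q) (pp (var w) * c l)"
        using c by (subst proj_degree_mult) (auto simp: homog_vec_def)
      also have "\<dots> = proj (\<lambda>t. mdeg t = 1 + q) (\<Sum>j<?n. f j * (cs ! j) l)"
        using fun_cong[OF f(2), of l] by (simp add: lcomb_def)
      also have "\<dots> = (\<Sum>j<?n. h j * (cs ! j) l)"
        unfolding proj_sum h_def
        by (intro sum.cong refl proj_degree_mult) (use cs nth_mem in \<open>fastforce simp: homog_vec_def\<close>)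
      finally show ?thesis by (simp add: lcomb_def)
    qed
    define g where "g = (\<lambda>j. if j < ?n then - h j else if j = ?n then pp (var w) else 0)"
    have "lcomb g cs = lcomb (\<lambda>j. - h j) cs"
      by (rule lcomb_cong) (simp add: g_def)
    then have "lcomb g (cs @ [c]) = (\<lambda>l. 0)"
      by (auto simp: lcomb_snoc lcomb_uminus hc g_def)
    moreover have gS: "g j \<in> ?S" for j
      using h w snoc.hyps(2) by (auto simp: g_def intro!: carrier_closed carrier_single)
    ultimately have "g \<in> syz V (cs @ [c])"
      by (auto simp: syz_def g_def)
    moreover have "homog_vec V 1 g"
      using gS h by (auto simp: homog_vec_def g_def)
    ultimately show ?thesis
      by (auto simp: g_def)
  qed
  then obtain g where g: "\<And>w. w \<in> W \<Longrightarrow> g w \<in> syz V (cs @ [c])"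
    "\<And>w. w \<in> W \<Longrightarrow> homog_vec V 1 (g w) \<and> (\<forall>l\<ge>Suc ?n. g w l = 0)"
    "\<And>w. w \<in> W \<Longrightarrow> g w ?n = pp (var w)"
    by metis
  \<comment> \<open>The syzygies of the variables in \<open>ws\<close> are added one by one; the
    span then consists of the syzygies whose last coordinate lies in the ideal of \<open>ws\<close>.
    For empty \<open>ws\<close> this coordinate is 0, which leaves the syzygies of
    \<open>cs\<close>.\<close>
  have key: "module_lq V (ds @ map g ws) \<and>
    lspan V (ds @ map g ws) = {x \<in> syz V (cs @ [c]). x ?n \<in> var_ideal V (set ws)}"
    if "distinct ws" "set ws \<subseteq> W" for ws
    using that
  proof (induction ws rule: rev_induct)
    case Nil
    have "x \<in> syz V cs \<longleftrightarrow> x \<in> syz V (cs @ [c]) \<and> x ?n \<in> var_ideal V {}" for x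
    proof -
      have "x ?n \<in> var_ideal V {} \<longleftrightarrow> x ?n = 0"
        by (auto simp: var_ideal_def carrier_poly_ring simp flip: keys_eq_empty)
      moreover have "lcomb x (cs @ [c]) = lcomb x cs" if "x ?n = 0"
        using that by (auto simp: lcomb_snoc)
      moreover have "(\<forall>j\<ge>?n. x j = 0) \<longleftrightarrow> x ?n = 0 \<and> (\<forall>j\<ge>Suc ?n. x j = 0)"
        by (metis Suc_leD Suc_leI le_neq_implies_less order_refl)
      ultimately show ?thesis
        unfolding syz_def by auto
    qed
    then show ?case using ds by auto
  next
    case (snoc w ws)
    then have w: "w \<in> W" "w \<notin> set ws" and wV: "w \<in> V" and IH: "module_lq V (ds @ map g ws)"
      "lspan V (ds @ map g ws) = {x \<in> syz V (cs @ [c]). x ?n \<in> var_ideal V (set ws)}"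
      using \<open>W \<subseteq> V\<close> by auto
    have zero: "(\<lambda>l. 0) \<in> syz V (cs @ [c])"
      by (auto simp: syz_def lcomb_def carrier_closed)
    have smult: "(\<lambda>l. f * g w l) \<in> syz V (cs @ [c])" if "f \<in> ?S" for f
      using syz_closed[OF zero g(1)[OF w(1)] that] by simp
    \<comment> \<open>A multiple of \<open>g w\<close> is a syzygy anyway, so only its last
      coordinate \<open>f * pp (var w)\<close> decides, and \<open>w\<close> is not among
      \<open>ws\<close>.\<close>
    have quot: "(\<lambda>l. f * g w l) \<in> lspan V (ds @ map g ws) \<longleftrightarrow> f \<in> var_ideal V (set ws)"
      if "f \<in> ?S" for f
      using smult[OF that] var_ideal_var_mult_iff[OF wV w(2) that]
      by (simp add: IH(2) g(3)[OF w(1)] mult.commute)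
    have "module_lq V ((ds @ map g ws) @ [g w])"
      using quot snoc.prems \<open>W \<subseteq> V\<close> by (intro module_lq.snoc[OF IH(1)]) auto
    moreover have "x \<in> lspan V ((ds @ map g ws) @ [g w]) \<longleftrightarrow>
      x \<in> syz V (cs @ [c]) \<and> x ?n \<in> var_ideal V (insert w (set ws))" for x
    proof
      assume "x \<in> lspan V ((ds @ map g ws) @ [g w])"
      then obtain y a where y: "y \<in> lspan V (ds @ map g ws)" "a \<in> ?S" "x = (\<lambda>l. y l + a * g w l)"
        by (auto simp: lspan_snoc simp del: append_assoc)
      have "x \<in> syz V (cs @ [c])"
        using y g(1)[OF w(1)] syz_closed unfolding IH(2) by auto
      moreover have "a * pp (var w) \<in> var_ideal V (insert w (set ws))"
        using y(2) wV by (intro var_ideal_mult) (auto simp: var_ideal_def intro!: carrier_single)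
      moreover have "y ?n \<in> var_ideal V (insert w (set ws))"
        using y(1) unfolding IH(2) by (auto simp: var_ideal_def)
      ultimately show "x \<in> syz V (cs @ [c]) \<and> x ?n \<in> var_ideal V (insert w (set ws))"
        using y(3) g(3)[OF w(1)] var_ideal_add by auto
    next
      assume x: "x \<in> syz V (cs @ [c]) \<and> x ?n \<in> var_ideal V (insert w (set ws))"
      then obtain a b where ab: "a \<in> ?S" "b \<in> var_ideal V (set ws)" "x ?n = a * pp (var w) + b"
        by (auto elim: var_ideal_insertE)
      define y where "y = (\<lambda>l. x l + (- a) * g w l)"
      have "y \<in> syz V (cs @ [c])"
        unfolding y_def using x g(1)[OF w(1)] ab(1) by (intro syz_closed carrier_closed) auto
      moreover have "y ?n = b"
        by (simp add: y_def ab(3) g(3)[OF w(1)])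
      ultimately have "y \<in> lspan V (ds @ map g ws)"
        using ab(2) by (simp add: IH(2))
      moreover have "x = (\<lambda>l. y l + a * g w l)"
        by (auto simp: y_def)
      ultimately show "x \<in> lspan V ((ds @ map g ws) @ [g w])"
        unfolding lspan_snoc using ab(1) by blast
    qed
    ultimately show ?case by auto
  qed
  obtain ws where ws: "set ws = W" "distinct ws"
    using finite_distinct_list[OF \<open>finite W\<close>] by blast
  \<comment> \<open>In a syzygy the last coordinate multiplies \<open>c\<close> into the span of
    \<open>cs\<close>, so it belongs to the colon ideal.\<close>
  have "x ?n \<in> var_ideal V W" if x: "x \<in> syz V (cs @ [c])" for x
  proof -
    have xS: "x j \<in> ?S" for j using x by (auto simp: syz_def)
    have "lcomb x cs l + x ?n * c l = 0" for l
      using x by (simp add: syz_def fun_eq_iff lcomb_snoc)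
    then have "x ?n * c l = lcomb (\<lambda>j. - x j) cs l" for l
      by (metis add_eq_0_iff lcomb_uminus)
    then have "(\<lambda>l. x ?n * c l) \<in> lspan V cs"
      using xS carrier_closed(5) unfolding lspan_def by (auto intro!: exI[of _ "\<lambda>j. - x j"])
    then show ?thesis
      using snoc.hyps(4)[OF xS] by simp
  qed
  then have "lspan V (ds @ map g ws) = syz V (cs @ [c])"
    using key[OF ws(2)] ws(1) by auto
  then show ?case
    using key[OF ws(2)] ws(1) ds(2) g(2) by (intro exI[of _ "ds @ map g ws"]) auto
qed

section \<open>Resolutions assembled from iterated lists of syzygies\<close>

lemma free_mod_vec_iff:
  "x \<in> free_mod V n \<longleftrightarrow>
    (\<exists>f. (\<forall>j. f j \<in> carrier (poly_ring V)) \<and> (\<forall>j\<ge>n. f j = 0) \<and> x = vec n f)"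
proof
  assume x: "x \<in> free_mod V n"
  define f where "f = (\<lambda>j. if j < n then x $ j else 0)"
  have "\<forall>j. f j \<in> carrier (poly_ring V)" "\<forall>j\<ge>n. f j = 0" "x = vec n f"
    using x by (auto simp: f_def free_mod_def carrier_closed)
  then show "\<exists>f. (\<forall>j. f j \<in> carrier (poly_ring V)) \<and> (\<forall>j\<ge>n. f j = 0) \<and> x = vec n f"
    by blast
qed (auto simp: free_mod_def)

lemma mat_mult_vec_lcomb:
  fixes cs :: "(nat \<Rightarrow> ('v, 'k::field) mpoly) list"
  shows "mat n (length cs) (\<lambda>(l, k). (cs ! k) l) *\<^sub>v vec (length cs) f = vec n (lcomb f cs)"
  by (rule eq_vecI) (auto simp: scalar_prod_def lcomb_def atLeast0LessThan mult.commute intro!: sum.cong)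

lemma row_scalar_prod_lcomb:
  fixes cs :: "(nat \<Rightarrow> ('v, 'k::field) mpoly) list"
  shows "vec (length cs) (\<lambda>j. (cs ! j) 0) \<bullet> vec (length cs) f = lcomb f cs 0"
  by (auto simp: scalar_prod_def lcomb_def atLeast0LessThan mult.commute intro!: sum.cong)

lemma image_free_mod:
  fixes cs :: "(nat \<Rightarrow> ('v, 'k::field) mpoly) list"
  shows "(\<lambda>x. mat n (length cs) (\<lambda>(l, k). (cs ! k) l) *\<^sub>v x) ` free_mod V (length cs)
    = vec n ` lspan V cs" (is "?M ` _ = _")
proof
  show "?M ` free_mod V (length cs) \<subseteq> vec n ` lspan V cs"
    unfolding lspan_def by (auto simp: free_mod_vec_iff mat_mult_vec_lcomb intro!: imageI) blast
  show "vec n ` lspan V cs \<subseteq> ?M ` free_mod V (length cs)"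
  proof
    fix y assume "y \<in> vec n ` lspan V cs"
    then obtain f where f: "\<forall>j. f j \<in> carrier (poly_ring V)" "y = vec n (lcomb f cs)"
      by (auto simp: lspan_def)
    then have "vec (length cs) f \<in> free_mod V (length cs)"
      by (auto simp: free_mod_def)
    then show "y \<in> ?M ` free_mod V (length cs)"
      using f(2) mat_mult_vec_lcomb[of n cs f] by (auto intro: rev_image_eqI)
  qed
qed

text \<open>As the vectors vanish from \<open>n\<close> on, truncating a combination to
  \<open>vec n\<close> loses nothing, and the matrix kernel is the syzygy module.\<close>

lemma kernel_free_mod:
  fixes cs :: "(nat \<Rightarrow> ('v, 'k::field) mpoly) list"
  assumes "\<forall>c\<in>set cs. \<forall>l\<ge>n. c l = 0"
  shows "{x \<in> free_mod V (length cs). mat n (length cs) (\<lambda>(l, k). (cs ! k) l) *\<^sub>v x = 0\<^sub>v n}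
    = vec (length cs) ` syz V cs"
proof -
  have "vec n (lcomb f cs) = 0\<^sub>v n \<longleftrightarrow> lcomb f cs = (\<lambda>l. 0)" for f
  proof
    assume z: "vec n (lcomb f cs) = 0\<^sub>v n"
    show "lcomb f cs = (\<lambda>l. 0)"
    proof
      fix l
      show "lcomb f cs l = 0"
      proof (cases "l < n")
        case True
        then show ?thesis using arg_cong[OF z, of "\<lambda>v. v $ l"] by simp
      next
        case False
        then show ?thesis
          unfolding lcomb_def using assms by (auto simp: all_set_conv_all_nth intro!: sum.neutral)
      qed
    qed
  qed (auto intro: eq_vecI)
  then show ?thesis
    by (auto simp: free_mod_vec_iff syz_def mat_mult_vec_lcomb)
qed

lemma var_ideal_eq_Idl: "W \<subseteq> V \<Longrightarrow> Idl\<^bsub>poly_ring V\<^esub> (pvar ` W) = var_ideal V W"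
  by (simp add: var_ideal_def Idl_pvar)

text \<open>Each list spans the syzygies of the preceding one, so the matrices with these columns
  form an exact complex. From the second list on all entries are linear forms or 0, which yields
  both the shifts \<open>q + i\<close> and minimality.\<close>

lemma module_lq_imp_linear_resolution:
  fixes cs :: "(nat \<Rightarrow> ('v, 'k::field) mpoly) list"
  assumes lq: "module_lq V cs" and homog: "\<forall>c\<in>set cs. homog_vec V q c \<and> (\<forall>l\<ge>1. c l = 0)"
    and I: "I = (\<lambda>x. x 0) ` lspan V cs"
  shows "has_linear_resolution V I"
proof -
  let ?deg = "\<lambda>i::nat. if i = 0 then q else 1"
  let ?P = "\<lambda>i x. module_lq V x \<and> (\<forall>c\<in>set x. homog_vec V (?deg i) c) \<and> (i = 0 \<longrightarrow> x = cs)"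
  let ?Q = "\<lambda>x y. (\<forall>d\<in>set y. \<forall>l\<ge>length x. d l = 0) \<and> lspan V y = syz V x"
  \<comment> \<open>The next list must again have linear quotients, not merely generate the
    syzygies; otherwise the choice could not be continued.\<close>
  have "\<exists>CS. \<forall>i. ?P i (CS i) \<and> ?Q (CS i) (CS (Suc i))"
  proof (rule dependent_nat_choice)
    show "\<exists>x. ?P 0 x"
      using lq homog by auto
  next
    fix x i assume "?P i x"
    then show "\<exists>y. ?P (Suc i) y \<and> ?Q x y"
      using linear_syzygies[of V x "?deg i"] by auto
  qed
  then obtain CS where CS_all: "\<forall>i. ?P i (CS i) \<and> ?Q (CS i) (CS (Suc i))" ..
  have CS: "\<And>i c. c \<in> set (CS i) \<Longrightarrow> homog_vec V (?deg i) c" "CS 0 = cs"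
    "\<And>i d. d \<in> set (CS (Suc i)) \<Longrightarrow> \<forall>l\<ge>length (CS i). d l = 0"
    "\<And>i. lspan V (CS (Suc i)) = syz V (CS i)"
    using CS_all by simp_all
  define r where "r = (\<lambda>i. length (CS i))"
  define a where "a = (\<lambda>(i::nat) (j::nat). int q + int i)"
  define g where "g = vec (r 0) (\<lambda>j. (CS 0 ! j) 0)"
  define D where "D = (\<lambda>i. mat (r i) (r (Suc i)) (\<lambda>(l, k). (CS (Suc i) ! k) l))"
  have entry: "homog_vec V (?deg i) (CS i ! k)" if "k < r i" for i k
    using that CS(1) by (simp add: r_def)
  have g_free: "g \<in> free_mod V (r 0)" and g_hom: "\<forall>j<r 0. homogeneous (a 0 j) (g $ j)"
    using entry[of _ 0] by (auto simp: g_def free_mod_def homog_vec_def homogeneous_def a_def)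
  have D: "D i $$ (j, k) \<in> carrier (poly_ring V)" "homogeneous (a (Suc i) k - a i j) (D i $$ (j, k))"
    "D i $$ (j, k) \<in> Idl\<^bsub>poly_ring V\<^esub> (pvar ` V)"
    if jk: "j < r i" "k < r (Suc i)" for i j k
  proof -
    have e: "D i $$ (j, k) = (CS (Suc i) ! k) j"
      using jk by (simp add: D_def)
    have h: "homog_vec V 1 (CS (Suc i) ! k)"
      using entry[OF jk(2)] by simp
    show *: "D i $$ (j, k) \<in> carrier (poly_ring V)"
      using h unfolding e homog_vec_def by blast
    show "homogeneous (a (Suc i) k - a i j) (D i $$ (j, k))"
      using h unfolding e homog_vec_def homogeneous_def by (auto simp: a_def)
    have "keys t \<inter> V \<noteq> {}" if "t \<in> keys (D i $$ (j, k))" for t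
    proof -
      have "keys t \<subseteq> V" "mdeg t = 1"
        using that * h unfolding e homog_vec_def by (auto simp: carrier_poly_ring)
      then show ?thesis
        using mdeg_eq_1[of t] by auto
    qed
    then show "D i $$ (j, k) \<in> Idl\<^bsub>poly_ring V\<^esub> (pvar ` V)"
      using * by (simp add: var_ideal_eq_Idl var_ideal_def)
  qed
  have mat: "D i \<in> carrier_mat (r i) (r (Suc i))" for i
    by (simp add: D_def)
  have g_vec: "g \<bullet> vec (r 0) f = lcomb f cs 0" for f
    using row_scalar_prod_lcomb[of "CS 0" f] by (simp add: g_def r_def CS(2))
  have im_g: "(\<lambda>x. g \<bullet> x) ` free_mod V (r 0) = I"
  proof
    show "(\<lambda>x. g \<bullet> x) ` free_mod V (r 0) \<subseteq> I"
    proof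
      fix y assume "y \<in> (\<lambda>x. g \<bullet> x) ` free_mod V (r 0)"
      then obtain f where f: "\<forall>j. f j \<in> carrier (poly_ring V)" "y = lcomb f cs 0"
        by (auto simp: free_mod_vec_iff g_vec)
      then have "lcomb f cs \<in> lspan V cs"
        by (auto simp: lspan_def)
      then show "y \<in> I"
        unfolding I f(2) by blast
    qed
    show "I \<subseteq> (\<lambda>x. g \<bullet> x) ` free_mod V (r 0)"
    proof
      fix y assume "y \<in> I"
      then obtain f where f: "\<forall>j. f j \<in> carrier (poly_ring V)" "y = lcomb f cs 0"
        by (auto simp: I lspan_def)
      then have "vec (r 0) f \<in> free_mod V (r 0)"
        by (auto simp: free_mod_def)
      then show "y \<in> (\<lambda>x. g \<bullet> x) ` free_mod V (r 0)"
        using f(2) g_vec[of f] by force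
    qed
  qed
  have "lcomb f cs = (\<lambda>l. 0) \<longleftrightarrow> lcomb f cs 0 = 0" for f
  proof
    assume *: "lcomb f cs 0 = 0"
    have "lcomb f cs l = 0" if "l \<ge> 1" for l
      unfolding lcomb_def using homog that by (auto simp: all_set_conv_all_nth intro!: sum.neutral)
    then show "lcomb f cs = (\<lambda>l. 0)"
      using * by (metis less_one not_le)
  qed simp
  moreover have r0: "length cs = r 0"
    by (simp add: r_def CS(2))
  ultimately have ker_g: "{x \<in> free_mod V (r 0). g \<bullet> x = 0} = vec (r 0) ` syz V (CS 0)"
    using CS(2) by (auto simp: free_mod_vec_iff g_vec syz_def r0)
  have im_D: "(\<lambda>x. D i *\<^sub>v x) ` free_mod V (r (Suc i)) = vec (r i) ` syz V (CS i)" for i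
    using image_free_mod[of "r i" "CS (Suc i)" V] by (simp add: D_def r_def CS(4))
  have ker_D: "{x \<in> free_mod V (r (Suc i)). D i *\<^sub>v x = 0\<^sub>v (r i)} = vec (r (Suc i)) ` syz V (CS (Suc i))"
    for i
    using kernel_free_mod[of "CS (Suc i)" "r i" V] CS(3) by (simp add: D_def r_def)
  have "minimal_graded_free_resolution V I r a g D"
    unfolding minimal_graded_free_resolution_def graded_free_resolution_def
    using g_free g_hom mat D im_g ker_g im_D ker_D by simp
  then show ?thesis
    unfolding has_linear_resolution_def
    by (intro exI[of _ "int q"] exI[of _ r] exI[of _ a] exI[of _ g] exI[of _ D]) (simp add: a_def)
qed

section \<open>Linear quotients of monomial ideals\<close>

text \<open>The exponent form of linear quotients. For generators \<open>u_i\<close>,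
  \<open>u_j\<close>, the first condition says that \<open>z\<close> divides
  \<open>u_j / gcd(u_i, u_j)\<close>, the second that \<open>z\<close> lies in the colon ideal of
  the earlier generators by \<open>u_i\<close>.\<close>

definition mono_lq :: "('v \<Rightarrow>\<^sub>0 nat) list \<Rightarrow> bool" where
  "mono_lq ts \<longleftrightarrow> (\<forall>i<length ts. \<forall>j<i. \<exists>z. \<exists>l<i.
     lookup (ts ! i) z < lookup (ts ! j) z \<and> ts ! l \<preceq> ts ! i + var z)"

text \<open>Elements with equal \<open>key\<close> may be listed in either order, hence the
  non-strict premise \<open>key v \<le> key u\<close>. The strict inequality for \<open>w\<close>
  guarantees that \<open>w\<close> precedes \<open>u\<close>.\<close>

lemma mono_lq_sort:
  fixes key :: "('v \<Rightarrow>\<^sub>0 nat) \<Rightarrow> 'b::linorder"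
  assumes "finite A"
    and step: "\<And>u v. u \<in> A \<Longrightarrow> v \<in> A \<Longrightarrow> v \<noteq> u \<Longrightarrow> key v \<le> key u \<Longrightarrow>
      \<exists>z. \<exists>w\<in>A. lookup u z < lookup v z \<and> key w < key u \<and> w \<preceq> u + var z"
  shows "\<exists>ts. distinct ts \<and> set ts = A \<and> mono_lq ts"
proof -
  obtain xs where xs: "set xs = A" "distinct xs"
    using finite_distinct_list[OF assms(1)] by blast
  define ts where "ts = sort_key key xs"
  have ts: "set ts = A" "distinct ts" "sorted (map key ts)"
    using xs by (simp_all add: ts_def)
  have mono: "key (ts ! i) \<le> key (ts ! j)" if "i \<le> j" "j < length ts" for i j
    using sorted_nth_mono[OF ts(3), of i j] that by simp
  have "\<exists>z. \<exists>l<i. lookup (ts ! i) z < lookup (ts ! j) z \<and> ts ! l \<preceq> ts ! i + var z"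
    if ij: "i < length ts" "j < i" for i j
  proof -
    have "ts ! j \<noteq> ts ! i"
      using ts(2) ij by (simp add: nth_eq_iff_index_eq)
    then obtain z w where w: "w \<in> A" "lookup (ts ! i) z < lookup (ts ! j) z"
      "key w < key (ts ! i)" "w \<preceq> ts ! i + var z"
      using step[of "ts ! i" "ts ! j"] ij mono[of j i] ts(1) nth_mem[of i ts] nth_mem[of j ts] by auto
    then obtain l where "l < length ts" "w = ts ! l"
      using ts(1) by (metis in_set_conv_nth)
    then show ?thesis
      using w mono[of i l] by (metis leD not_le_imp_less)
  qed
  then show ?thesis
    using ts unfolding mono_lq_def by blast
qed

section \<open>Colon ideals of monomial ideals and the criterion on exponents\<close>

lemma keys_pp_mult: "keys (pp u * f) = (+) u ` keys (f :: ('v, 'k::field) mpoly)"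
proof -
  have "t \<in> (+) u ` keys f \<longleftrightarrow> u \<preceq> t \<and> t - u \<in> keys f" for t
  proof
    assume "u \<preceq> t \<and> t - u \<in> keys f"
    then show "t \<in> (+) u ` keys f"
      using divides_minus_add[of u t] by (intro image_eqI[of _ _ "t - u"]) (simp_all add: add.commute)
  qed (auto simp: add_diff_cancel_left')
  then show ?thesis
    by (auto simp: in_keys_iff lookup_single_mult split: if_splits)
qed

lemma pp_mult_mono_ideal_iff:
  fixes f :: "('v, 'k::field) mpoly"
  assumes "keys u \<subseteq> V" "f \<in> carrier (poly_ring V)"
  shows "f * pp u \<in> mono_ideal V T \<longleftrightarrow> (\<forall>t\<in>keys f. \<exists>s\<in>T. s \<preceq> t + u)"
proof -
  have "f * pp u \<in> carrier (poly_ring V)"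
    using assms by (intro carrier_closed carrier_single)
  then show ?thesis
    unfolding mult.commute[of f] by (simp add: mono_ideal_def keys_pp_mult add.commute)
qed

text \<open>It suffices to multiply by the generator \<open>pp u\<close>, which only translates the
  support of \<open>f\<close>. The colon condition thus becomes a condition on single
  monomials.\<close>

lemma colon_mono_ideal:
  fixes T :: "('v \<Rightarrow>\<^sub>0 nat) set"
  assumes u: "keys u \<subseteq> V"
  shows "colon_ideal V (mono_ideal V T) (Idl\<^bsub>poly_ring V\<^esub> {pp u})
    = {f \<in> carrier (poly_ring V :: ('v, 'k::field) mpoly ring). \<forall>t\<in>keys f. \<exists>s\<in>T. s \<preceq> t + u}"
proof -
  have Idl: "Idl\<^bsub>poly_ring V\<^esub> {pp u} = (mono_ideal V {u} :: ('v, 'k) mpoly set)"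
    using Idl_pp[of "{u}" V] u by simp
  have self: "pp u \<in> (mono_ideal V {u} :: ('v, 'k) mpoly set)"
    using u by (auto simp: mono_ideal_def intro: carrier_single)
  have mult: "f * g \<in> mono_ideal V T"
    if "f \<in> carrier (poly_ring V)" "\<forall>t\<in>keys f. \<exists>s\<in>T. s \<preceq> t + u" "g \<in> mono_ideal V {u}"
    for f g :: "('v, 'k) mpoly"
  proof -
    have "\<exists>s\<in>T. s \<preceq> t" if t: "t \<in> keys (f * g)" for t
    proof -
      obtain a b where ab: "a \<in> keys f" "b \<in> keys g" "t = a + b"
        using keys_mult[of f g] t by blast
      then obtain s where "s \<in> T" "s \<preceq> a + u" "u \<preceq> b"
        using that \<open>\<forall>t\<in>keys f. \<exists>s\<in>T. s \<preceq> t + u\<close> \<open>g \<in> mono_ideal V {u}\<close>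
        unfolding mono_ideal_def by auto
      then show ?thesis
        using ab(3) by (auto simp: divides_def lookup_add intro!: bexI[of _ s]
            intro: order_trans[OF _ add_left_mono])
    qed
    then show ?thesis
      using that by (auto simp: mono_ideal_def intro: carrier_closed)
  qed
  have "(\<forall>g\<in>mono_ideal V {u}. f * g \<in> mono_ideal V T) \<longleftrightarrow> (\<forall>t\<in>keys f. \<exists>s\<in>T. s \<preceq> t + u)"
    if f: "f \<in> carrier (poly_ring V)" for f :: "('v, 'k) mpoly"
    using mult[OF f] self pp_mult_mono_ideal_iff[OF u f, of T] by blast
  then show ?thesis
    unfolding colon_ideal_def Idl by blast
qed

text \<open>Every monomial of the colon ideal is divisible by some
  \<open>u_j / gcd(u_i, u_j)\<close> with \<open>j < i\<close>, and \<open>mono_lq\<close> finds in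
  that quotient a variable of the colon ideal.\<close>

lemma mono_lq_colon:
  fixes f :: "('v, 'k::field) mpoly"
  assumes "mono_lq ts" "i < length ts" "f \<in> carrier (poly_ring V)"
  shows "(\<forall>t\<in>keys f. \<exists>s\<in>set (take i ts). s \<preceq> t + ts ! i)
    \<longleftrightarrow> f \<in> var_ideal V {z \<in> V. \<exists>l<i. ts ! l \<preceq> ts ! i + var z}" (is "_ \<longleftrightarrow> f \<in> var_ideal V ?W")
proof -
  have take: "s \<in> set (take i ts) \<longleftrightarrow> (\<exists>l<i. s = ts ! l)" for s
    using assms(2) by (auto simp: in_set_conv_nth)
  have "(\<exists>s\<in>set (take i ts). s \<preceq> t + ts ! i) \<longleftrightarrow> keys t \<inter> ?W \<noteq> {}" if "keys t \<subseteq> V" for t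
  proof
    assume "\<exists>s\<in>set (take i ts). s \<preceq> t + ts ! i"
    then obtain j where j: "j < i" "ts ! j \<preceq> t + ts ! i"
      by (auto simp: take)
    then obtain z l where z: "l < i" "lookup (ts ! i) z < lookup (ts ! j) z" "ts ! l \<preceq> ts ! i + var z"
      using assms(1,2) unfolding mono_lq_def by blast
    have "lookup (ts ! j) z \<le> lookup t z + lookup (ts ! i) z"
      using j(2) by (auto simp: divides_def lookup_add)
    then have "z \<in> keys t"
      using z(2) by (auto simp: in_keys_iff)
    then show "keys t \<inter> ?W \<noteq> {}"
      using z \<open>keys t \<subseteq> V\<close> by auto
  next
    assume "keys t \<inter> ?W \<noteq> {}"
    then obtain z l where z: "z \<in> keys t" "l < i" "ts ! l \<preceq> ts ! i + var z"
      by auto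
    have "ts ! i + var z \<preceq> t + ts ! i"
      using z(1) by (auto simp: divides_def lookup_add lookup_single when_def in_keys_iff)
    then have "ts ! l \<preceq> t + ts ! i"
      using z(3) divides_trans by blast
    then show "\<exists>s\<in>set (take i ts). s \<preceq> t + ts ! i"
      using z(2) take by blast
  qed
  then show ?thesis
    using assms(3) by (auto simp: var_ideal_def carrier_poly_ring)
qed

lemma pp_eq_iff: "(pp s :: ('v, 'k::field) mpoly) = pp t \<longleftrightarrow> s = t"
proof
  assume "(pp s :: ('v, 'k) mpoly) = pp t"
  then have "keys (pp s :: ('v, 'k) mpoly) = keys (pp t :: ('v, 'k) mpoly)"
    by simp
  then show "s = t" by simp
qed simp

text \<open>A generator is redundant exactly if another one divides it, so minimality means that the
  exponents form an antichain.\<close>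

lemma minimal_monomial_generators_pp:
  assumes T: "\<And>t. t \<in> T \<Longrightarrow> keys t \<subseteq> V"
  shows "minimal_monomial_generators V I (pp ` T :: ('v, 'k::field) mpoly set) \<longleftrightarrow>
    I = mono_ideal V T \<and> (\<forall>s\<in>T. \<forall>t\<in>T. s \<preceq> t \<longrightarrow> s = t)"
proof -
  have sub: "B' \<subset> pp ` T \<longleftrightarrow> (\<exists>T'. T' \<subset> T \<and> B' = pp ` T')" for B' :: "('v, 'k) mpoly set"
    by (auto simp: psubset_eq subset_image_iff inj_image_eq_iff inj_def pp_eq_iff)
  have idl: "Idl\<^bsub>poly_ring V\<^esub> (pp ` T') = (mono_ideal V T' :: ('v, 'k) mpoly set)" if "T' \<subseteq> T" for T'
    using T that by (intro Idl_pp) auto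
  have anti: "(\<forall>T'. T' \<subset> T \<longrightarrow> mono_ideal V T' \<noteq> (mono_ideal V T :: ('v, 'k) mpoly set)) \<longleftrightarrow>
    (\<forall>s\<in>T. \<forall>t\<in>T. s \<preceq> t \<longrightarrow> s = t)"
  proof (intro iffI allI impI ballI)
    fix s t assume st: "\<forall>T'. T' \<subset> T \<longrightarrow> mono_ideal V T' \<noteq> (mono_ideal V T :: ('v, 'k) mpoly set)"
      "s \<in> T" "t \<in> T" "s \<preceq> t"
    show "s = t"
    proof (rule ccontr)
      assume "s \<noteq> t"
      then have "mono_ideal V (T - {t}) = (mono_ideal V T :: ('v, 'k) mpoly set)"
        using st(2-4) unfolding mono_ideal_def by (blast intro: divides_trans)
      then show False
        using st(1,3) by blast
    qed
  next
    fix T' assume *: "\<forall>s\<in>T. \<forall>t\<in>T. s \<preceq> t \<longrightarrow> s = t" "T' \<subset> T"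
    show "mono_ideal V T' \<noteq> (mono_ideal V T :: ('v, 'k) mpoly set)"
    proof
      assume eq: "mono_ideal V T' = (mono_ideal V T :: ('v, 'k) mpoly set)"
      obtain t where t: "t \<in> T" "t \<notin> T'" using *(2) by blast
      then show False
        using mono_ideal_eqD[OF eq[symmetric] t(1) T[OF t(1)]] * by blast
    qed
  qed
  have min: "(\<forall>B'. B' \<subset> pp ` T \<longrightarrow> Idl\<^bsub>poly_ring V\<^esub> B' \<noteq> I) \<longleftrightarrow>
    (\<forall>T'. T' \<subset> T \<longrightarrow> mono_ideal V T' \<noteq> I)"
  proof
    assume *: "\<forall>B'. B' \<subset> pp ` T \<longrightarrow> Idl\<^bsub>poly_ring V\<^esub> B' \<noteq> I"
    show "\<forall>T'. T' \<subset> T \<longrightarrow> mono_ideal V T' \<noteq> I"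
    proof (intro allI impI)
      fix T' assume T': "T' \<subset> T"
      then have "pp ` T' \<subset> (pp ` T :: ('v, 'k) mpoly set)"
        unfolding sub by auto
      then show "mono_ideal V T' \<noteq> I"
        using *[rule_format, of "pp ` T'"] idl[of T'] T' by (simp add: psubset_imp_subset)
    qed
  next
    assume *: "\<forall>T'. T' \<subset> T \<longrightarrow> mono_ideal V T' \<noteq> I"
    show "\<forall>B'. B' \<subset> pp ` T \<longrightarrow> Idl\<^bsub>poly_ring V\<^esub> B' \<noteq> I"
    proof (intro allI impI)
      fix B' :: "('v, 'k) mpoly set" assume "B' \<subset> pp ` T"
      then obtain T' where T': "T' \<subset> T" "B' = pp ` T'"
        unfolding sub by auto
      then show "Idl\<^bsub>poly_ring V\<^esub> B' \<noteq> I"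
        using *[rule_format, of T'] idl[of T'] by (simp add: psubset_imp_subset)
    qed
  qed
  have mon: "pp ` T \<subseteq> (monomials V :: ('v, 'k) mpoly set)"
    using T by (auto simp: monomials_def)
  show ?thesis
  proof (cases "I = mono_ideal V T")
    case True
    show ?thesis
      unfolding minimal_monomial_generators_def min idl[OF order_refl] using mon anti True by simp
  next
    case False
    then show ?thesis
      unfolding minimal_monomial_generators_def min idl[OF order_refl] by simp
  qed
qed

lemma has_linear_quotients_iff:
  "has_linear_quotients V (I :: ('v, 'k::field) mpoly set) \<longleftrightarrow>
    (\<exists>ts. distinct ts \<and> (\<forall>t\<in>set ts. keys t \<subseteq> V) \<and> (\<forall>s\<in>set ts. \<forall>t\<in>set ts. s \<preceq> t \<longrightarrow> s = t) \<and>
      mono_lq ts \<and> I = mono_ideal V (set ts))"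
proof
  assume "has_linear_quotients V I"
  then obtain us where us: "distinct us" "minimal_monomial_generators V I (set us)"
    "\<And>i. 1 \<le> i \<Longrightarrow> i < length us \<Longrightarrow> \<exists>W \<subseteq> V.
      colon_ideal V (Idl\<^bsub>poly_ring V\<^esub> (set (take i us))) (Idl\<^bsub>poly_ring V\<^esub> {us ! i})
            = Idl\<^bsub>poly_ring V\<^esub> (pvar ` W)"
    unfolding has_linear_quotients_def by blast
  have "\<forall>u\<in>set us. \<exists>t. keys t \<subseteq> V \<and> u = pp t"
    using us(2) by (auto simp: minimal_monomial_generators_def monomials_def)
  then obtain g where g: "\<And>u. u \<in> set us \<Longrightarrow> keys (g u) \<subseteq> V \<and> u = pp (g u)"
    by metis
  define ts where "ts = map g us"
  have us_eq: "us = map pp ts"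
    using g by (simp add: ts_def map_idI)
  have V: "\<forall>t\<in>set ts. keys t \<subseteq> V"
    using g by (simp add: ts_def)
  have dist: "distinct ts"
    using us(1) unfolding us_eq by (simp add: distinct_map)
  have min: "I = mono_ideal V (set ts)" "\<forall>s\<in>set ts. \<forall>t\<in>set ts. s \<preceq> t \<longrightarrow> s = t"
    using us(2) V minimal_monomial_generators_pp[of "set ts" V I] unfolding us_eq by auto
  have "mono_lq ts"
    unfolding mono_lq_def
  proof (intro allI impI)
    fix i j assume ij: "i < length ts" "j < i"
    have u: "keys (ts ! i) \<subseteq> V" "keys (ts ! j) \<subseteq> V"
      using V ij nth_mem[of i ts] nth_mem[of j ts] by (metis less_trans)+
    have "Idl\<^bsub>poly_ring V\<^esub> (pp ` set (take i ts)) = (mono_ideal V (set (take i ts)) :: ('v, 'k) mpoly set)"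
      using V by (intro Idl_pp) (meson in_set_takeD)
    then obtain W where W: "W \<subseteq> V"
      "{f \<in> carrier (poly_ring V :: ('v, 'k) mpoly ring). \<forall>t\<in>keys f. \<exists>s\<in>set (take i ts). s \<preceq> t + ts ! i}
        = var_ideal V W"
      using us(3)[of i] ij colon_mono_ideal[OF u(1), of "set (take i ts)", where 'k='k]
      by (auto simp: us_eq take_map var_ideal_eq_Idl)
    \<comment> \<open>Truncated subtraction makes \<open>?d\<close> the exponent of
      \<open>u_j / gcd(u_i, u_j)\<close>. It lies in the colon ideal, so a variable of
      \<open>W\<close> divides it.\<close>
    let ?d = "ts ! j - ts ! i"
    have "ts ! j \<preceq> ?d + ts ! i"
      by (auto simp: divides_def lookup_add lookup_minus)
    moreover have "ts ! j \<in> set (take i ts)"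
      using ij by (auto simp: in_set_conv_nth)
    moreover have "keys ?d \<subseteq> V"
      using u(2) by (auto simp: in_keys_iff lookup_minus)
    ultimately have "pp ?d \<in> (var_ideal V W :: ('v, 'k) mpoly set)"
      unfolding W(2)[symmetric] by (auto intro!: carrier_single)
    then obtain z where z: "z \<in> W" "z \<in> keys ?d"
      by (auto simp: var_ideal_def)
    have "pp (var z) \<in> (var_ideal V W :: ('v, 'k) mpoly set)"
      using z(1) W(1) by (auto simp: var_ideal_def intro!: carrier_single)
    then obtain s where "s \<in> set (take i ts)" "s \<preceq> var z + ts ! i"
      unfolding W(2)[symmetric] by auto
    then obtain l where "l < i" "ts ! l \<preceq> ts ! i + var z"
      by (auto simp: in_set_conv_nth add.commute)
    moreover have "lookup (ts ! i) z < lookup (ts ! j) z"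
      using z(2) by (auto simp: in_keys_iff lookup_minus)
    ultimately show "\<exists>z. \<exists>l<i. lookup (ts ! i) z < lookup (ts ! j) z \<and> ts ! l \<preceq> ts ! i + var z"
      by blast
  qed
  then show "\<exists>ts. distinct ts \<and> (\<forall>t\<in>set ts. keys t \<subseteq> V) \<and>
      (\<forall>s\<in>set ts. \<forall>t\<in>set ts. s \<preceq> t \<longrightarrow> s = t) \<and> mono_lq ts \<and> I = mono_ideal V (set ts)"
    using dist V min by (intro exI[of _ ts]) simp
next
  assume "\<exists>ts. distinct ts \<and> (\<forall>t\<in>set ts. keys t \<subseteq> V) \<and>
      (\<forall>s\<in>set ts. \<forall>t\<in>set ts. s \<preceq> t \<longrightarrow> s = t) \<and> mono_lq ts \<and> I = mono_ideal V (set ts)"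
  then obtain ts where ts: "distinct ts" "\<And>t. t \<in> set ts \<Longrightarrow> keys t \<subseteq> V"
    "\<forall>s\<in>set ts. \<forall>t\<in>set ts. s \<preceq> t \<longrightarrow> s = t" "mono_lq ts" "I = mono_ideal V (set ts)"
    by blast
  let ?us = "map pp ts :: ('v, 'k) mpoly list"
  have "distinct ?us"
    using ts(1) by (simp add: distinct_map inj_on_def pp_eq_iff)
  moreover have "minimal_monomial_generators V I (set ?us)"
    using minimal_monomial_generators_pp[of "set ts" V I] ts by simp
  moreover have "\<exists>W \<subseteq> V. colon_ideal V (Idl\<^bsub>poly_ring V\<^esub> (set (take i ?us))) (Idl\<^bsub>poly_ring V\<^esub> {?us ! i})
            = Idl\<^bsub>poly_ring V\<^esub> (pvar ` W)" if i: "i < length ?us" for i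
  proof -
    let ?W = "{z \<in> V. \<exists>l<i. ts ! l \<preceq> ts ! i + var z}"
    have "Idl\<^bsub>poly_ring V\<^esub> (pp ` set (take i ts)) = (mono_ideal V (set (take i ts)) :: ('v, 'k) mpoly set)"
      using ts(2) by (intro Idl_pp) (meson in_set_takeD)
    moreover have "{f \<in> carrier (poly_ring V :: ('v, 'k) mpoly ring).
        \<forall>t\<in>keys f. \<exists>s\<in>set (take i ts). s \<preceq> t + ts ! i} = var_ideal V ?W"
      using mono_lq_colon[OF ts(4), of i _ V, where 'k='k] i by (auto simp: var_ideal_def)
    ultimately show ?thesis
      using i ts(2)[of "ts ! i"] colon_mono_ideal[of "ts ! i" V "set (take i ts)", where 'k='k]
      by (intro exI[of _ ?W]) (auto simp: take_map var_ideal_eq_Idl)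
  qed
  ultimately show "has_linear_quotients V I"
    unfolding has_linear_quotients_def by (intro exI[of _ ?us]) simp
qed

section \<open>Degree components of an ideal with linear quotients\<close>

lemma finite_bounded_exponents:
  assumes "finite V"
  shows "finite {t :: 'v \<Rightarrow>\<^sub>0 nat. keys t \<subseteq> V \<and> (\<forall>v. lookup t v \<le> l)}" (is "finite ?A")
proof -
  have "lookup ` ?A \<subseteq> {f. \<forall>v. (v \<in> V \<longrightarrow> f v \<in> {..l}) \<and> (v \<notin> V \<longrightarrow> f v = 0)}"
    by (auto simp: in_keys_iff)
  then have "finite (lookup ` ?A)"
    using finite_set_of_finite_funs[OF assms finite_atMost[of l], of 0] finite_subset by blast
  moreover have "inj_on lookup ?A"
    by (auto intro: inj_onI poly_mapping_eqI)
  ultimately show ?thesis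
    using finite_imageD by blast
qed

lemma lookup_le_mdeg: "lookup t v \<le> mdeg t"
proof (cases "v \<in> keys t")
  case True
  then show ?thesis
    unfolding mdeg_def by (intro member_le_sum) auto
qed (simp add: in_keys_iff)

lemma lookup_var: "lookup (var v) x = (if v = x then 1 else 0)"
  by (simp add: lookup_single when_def)

definition swap :: "('v \<Rightarrow>\<^sub>0 nat) \<Rightarrow> 'v \<Rightarrow> 'v \<Rightarrow> ('v \<Rightarrow>\<^sub>0 nat)" where
  "swap t x y = t + var x - var y"

lemma lookup_swap:
  "lookup (swap t x y) v = lookup t v + (if v = x then 1 else 0) - (if v = y then 1 else 0)"
  by (simp add: swap_def lookup_add lookup_minus lookup_var)

lemma swap_divides: "swap t x y \<preceq> t + var x"
  by (simp add: divides_def swap_def lookup_minus)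

lemma keys_swap: "keys (swap t x y) \<subseteq> insert x (keys t)"
  by (auto simp: in_keys_iff lookup_swap split: if_splits)

lemma mdeg_swap:
  assumes "x = y \<or> y \<in> keys t"
  shows "mdeg (swap t x y) = mdeg t"
proof -
  have "swap t x y + var y = t + var x"
    unfolding swap_def
    by (rule divides_minus_add) (use assms in \<open>auto simp: var_divides_iff keys_nat_add\<close>)
  then have "mdeg (swap t x y) + 1 = mdeg t + 1"
    using mdeg_add[of "swap t x y" "var y"] mdeg_add[of t "var x"] by simp
  then show ?thesis by simp
qed

text \<open>
  Every monomial \<open>w\<close> in the ideal is assigned to the first generator dividing it.  Within one such class
  the cofactors are ordered by a weight, which makes swaps towards variables of smaller index decrease.
\<close>

lemma mono_lq_component:
  assumes V: "finite V" and lq: "mono_lq ts" and dist: "distinct ts"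
    and anti: "\<forall>s\<in>set ts. \<forall>t\<in>set ts. s \<preceq> t \<longrightarrow> s = t"
  shows "\<exists>ws. distinct ws \<and> set ws = {t. keys t \<subseteq> V \<and> mdeg t = d \<and> (\<exists>s\<in>set ts. s \<preceq> t)} \<and> mono_lq ws"
proof -
  let ?A = "{t. keys t \<subseteq> V \<and> mdeg t = d \<and> (\<exists>s\<in>set ts. s \<preceq> t)}"
  obtain idx :: "'a \<Rightarrow> nat" where idx: "inj_on idx V"
    using finite_imp_inj_to_nat_seg[OF V] by blast
  define wt where "wt = (\<lambda>w. \<Sum>v\<in>V. lookup w v * idx v)"
  define fst_gen where "fst_gen = (\<lambda>w. LEAST i. i < length ts \<and> ts ! i \<preceq> w)"
  have gen: "fst_gen w < length ts \<and> ts ! fst_gen w \<preceq> w" if "w \<in> ?A" for w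
  proof -
    have "\<exists>i. i < length ts \<and> ts ! i \<preceq> w"
      using that by (auto simp: in_set_conv_nth)
    then show ?thesis
      unfolding fst_gen_def by (rule LeastI_ex)
  qed
  have gen_le: "fst_gen w \<le> i" if "i < length ts" "ts ! i \<preceq> w" for i w
    unfolding fst_gen_def using that by (intro Least_le) simp
  have fin: "finite ?A"
    by (rule finite_subset[OF _ finite_bounded_exponents[OF V, of d]]) (auto simp: lookup_le_mdeg)
  have "\<exists>z. \<exists>w'\<in>?A. lookup u z < lookup v z \<and> (fst_gen w', wt w') < (fst_gen u, wt u) \<and> w' \<preceq> u + var z"
    if u: "u \<in> ?A" and v: "v \<in> ?A" "v \<noteq> u" and key: "(fst_gen v, wt v) \<le> (fst_gen u, wt u)" for u v
  proof -
    define i where "i = fst_gen u"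
    define j where "j = fst_gen v"
    have i: "i < length ts" "ts ! i \<preceq> u" and j: "j < length ts" "ts ! j \<preceq> v"
      using gen[OF u] gen[OF v(1)] by (auto simp: i_def j_def)
    have swapA: "swap u x y \<in> ?A" if "x \<in> V" "y \<in> keys u" "l < length ts" "ts ! l \<preceq> swap u x y" for x y l
      using that u keys_swap[of u x y] mdeg_swap[of x y u] by auto
    have "j < i \<or> j = i \<and> wt v \<le> wt u"
      using key by (auto simp: i_def j_def)
    then consider "j < i" | "j = i" "wt v \<le> wt u"
      by blast
    then show ?thesis
    proof cases
      case 1
      then obtain z l where z: "l < i" "lookup (ts ! i) z < lookup (ts ! j) z" "ts ! l \<preceq> ts ! i + var z"
        using lq i(1) unfolding mono_lq_def by blast
      \<comment> \<open>Otherwise \<open>ts ! i\<close> times \<open>z\<close> divides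
        \<open>u\<close>, and with it the earlier generator \<open>ts ! l\<close>, although
        \<open>i\<close> is the first index of a generator dividing \<open>u\<close>.\<close>
      have uz: "lookup u z = lookup (ts ! i) z"
      proof (rule ccontr)
        assume "lookup u z \<noteq> lookup (ts ! i) z"
        then have "ts ! i + var z \<preceq> u"
          using i(2) unfolding divides_def
          by (auto simp: lookup_add lookup_var) (metis Suc_leI le_neq_implies_less)
        then have "ts ! l \<preceq> u"
          using z(3) divides_trans by blast
        then show False
          using gen_le[of l u] z(1) i(1) by (simp add: i_def)
      qed
      have vz: "lookup (ts ! j) z \<le> lookup v z"
        using j(2) by (simp add: divides_def)
      have "z \<in> keys v"
        using z(2) vz by (auto simp: in_keys_iff)
      then have zV: "z \<in> V" using v(1) by auto
      have ui: "lookup (ts ! i) y \<le> lookup u y" for y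
        using i(2) by (simp add: divides_def)
      have li: "lookup (ts ! l) y \<le> lookup (ts ! i) y + (if z = y then 1 else 0)" for y
        using z(3) by (simp add: divides_def lookup_add lookup_var)
      \<comment> \<open>Raising \<open>z\<close> keeps the degree only if another variable can be
        given up. If \<open>ts ! l\<close> used up all of \<open>u\<close> away from
        \<open>z\<close>, it would agree there with \<open>ts ! i\<close>, and the two generators
        would be comparable.\<close>
      have "\<exists>y. y \<noteq> z \<and> lookup (ts ! l) y < lookup u y"
      proof (rule ccontr)
        assume "\<nexists>y. y \<noteq> z \<and> lookup (ts ! l) y < lookup u y"
        then have le: "lookup u y \<le> lookup (ts ! l) y" if "y \<noteq> z" for y
          using that by (metis not_le)
        have eq: "lookup (ts ! l) y = lookup (ts ! i) y" if "y \<noteq> z" for y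
          using le[OF that] li[of y] ui[of y] that by simp
        have "ts ! l \<preceq> ts ! i \<or> ts ! i \<preceq> ts ! l"
        proof (cases "lookup (ts ! l) z \<le> lookup (ts ! i) z")
          case True
          then have "ts ! l \<preceq> ts ! i"
            unfolding divides_def using eq by (metis order_refl)
          then show ?thesis ..
        next
          case False
          then have "ts ! i \<preceq> ts ! l"
            unfolding divides_def using eq by (metis linear order_refl)
          then show ?thesis ..
        qed
        moreover have "ts ! l \<in> set ts" "ts ! i \<in> set ts"
          using z(1) i(1) by simp_all
        ultimately have "ts ! l = ts ! i"
          using anti[rule_format, of "ts ! l" "ts ! i"] anti[rule_format, of "ts ! i" "ts ! l"] by auto
        then show False
          using dist z(1) i(1) by (simp add: nth_eq_iff_index_eq)
      qed
      then obtain y where y: "y \<noteq> z" "lookup (ts ! l) y < lookup u y" by blast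
      have yu: "y \<in> keys u" using y(2) by (auto simp: in_keys_iff)
      have lw: "ts ! l \<preceq> swap u z y"
        unfolding divides_def
      proof
        fix x show "lookup (ts ! l) x \<le> lookup (swap u z y) x"
          using li[of x] ui[of x] y by (auto simp: lookup_swap split: if_splits)
      qed
      have "fst_gen (swap u z y) < fst_gen u"
        using gen_le[OF _ lw] z(1) i by (simp add: i_def)
      then show ?thesis
        using swapA[OF zV yu _ lw] z(1,2) i(1) uz vz
        by (intro exI[of _ z] bexI[of _ "swap u z y"]) (auto simp: swap_divides)
    next
      case 2
      have dsum: "(\<Sum>x\<in>V. lookup u x) = (\<Sum>x\<in>V. lookup v x)"
        using u v mdeg_eq_sum[OF V, of u] mdeg_eq_sum[OF V, of v] by simp
      have "\<exists>x\<in>V. \<exists>y\<in>V. lookup u x < lookup v x \<and> lookup v y < lookup u y \<and> idx x < idx y"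
      proof (rule ccontr)
        assume no: "\<not> (\<exists>x\<in>V. \<exists>y\<in>V. lookup u x < lookup v x \<and> lookup v y < lookup u y \<and> idx x < idx y)"
        have out: "lookup u x = 0 \<and> lookup v x = 0" if "x \<notin> V" for x
          using u v that by (auto simp: in_keys_iff)
        have "\<exists>x. lookup v x \<noteq> lookup u x"
          using v(2) poly_mapping_eqI[of v u] by blast
        then obtain x0 where x0: "x0 \<in> V" "lookup v x0 \<noteq> lookup u x0"
          using out by metis
        have ex_lt: "\<exists>x\<in>V. f x < g x" if "(\<Sum>x\<in>V. f x) = (\<Sum>x\<in>V. g x)" "f x0 \<noteq> g x0"
          for f g :: "'a \<Rightarrow> nat"
        proof (rule ccontr)
          assume "\<not> (\<exists>x\<in>V. f x < g x)"
          then have "sum g V < sum f V"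
            using x0(1) that(2) by (intro sum_strict_mono_ex1[OF V]) (auto simp: not_less intro!: bexI[of _ x0])
          then show False using that(1) by simp
        qed
        let ?D = "{y \<in> V. lookup v y < lookup u y}"
        have "?D \<noteq> {}" using ex_lt[of "lookup v" "lookup u"] dsum x0(2) by auto
        \<comment> \<open>\<tau> is the largest index at which \<open>u\<close> exceeds
          \<open>v\<close>. Without the desired pair, all indices at which \<open>v\<close> exceeds
          \<open>u\<close> are larger than \<tau>. The degrees agree, so weights may be measured
          relative to \<tau>, and every difference contributes nonnegatively to
          \<open>wt v - wt u\<close>.\<close>
        define \<tau> where "\<tau> = Max (idx ` ?D)"
        have "\<tau> \<in> idx ` ?D"
          unfolding \<tau>_def using V \<open>?D \<noteq> {}\<close> by (intro Max_in) auto
        then obtain y0 where y0: "y0 \<in> V" "lookup v y0 < lookup u y0" "\<tau> = idx y0" by auto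
        have le: "idx y \<le> \<tau>" if "y \<in> V" "lookup v y < lookup u y" for y
          unfolding \<tau>_def using V that by (intro Max_ge) auto
        have ge: "\<tau> < idx x" if x: "x \<in> V" "lookup u x < lookup v x" for x
        proof -
          have "idx x \<noteq> idx y0" using inj_onD[OF idx, of x y0] x y0 by auto
          moreover have "\<not> idx x < idx y0" using no x y0 by blast
          ultimately show ?thesis using y0(3) by simp
        qed
        let ?f = "\<lambda>x. (int (lookup v x) - int (lookup u x)) * (int (idx x) - int \<tau>)"
        obtain x1 where x1: "x1 \<in> V" "lookup u x1 < lookup v x1"
          using ex_lt[of "lookup u" "lookup v"] dsum x0(2) by auto
        have "0 \<le> ?f x" if "x \<in> V" for x
          using ge[OF that] le[OF that]
          by (cases "lookup u x" "lookup v x" rule: linorder_cases)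
            (auto intro: mult_nonneg_nonneg mult_nonpos_nonpos)
        moreover have "0 < ?f x1"
          using ge[OF x1] x1 by (intro mult_pos_pos) auto
        ultimately have pos: "0 < sum ?f V"
          using x1(1) V by (intro sum_pos2) auto
        have "int (wt v) - int (wt u) = (\<Sum>x\<in>V. (int (lookup v x) - int (lookup u x)) * int (idx x))"
          by (simp add: wt_def left_diff_distrib sum_subtractf)
        also have "\<dots> = sum ?f V + \<tau> * (\<Sum>x\<in>V. int (lookup v x) - int (lookup u x))"
          by (simp add: right_diff_distrib sum_subtractf sum_distrib_left mult.commute)
        also have "(\<Sum>x\<in>V. int (lookup v x) - int (lookup u x)) = 0"
          using dsum by (simp add: sum_subtractf flip: of_nat_sum)
        finally show False
          using pos 2(2) by simp
      qed
      then obtain x y where xy: "x \<in> V" "y \<in> V" "lookup u x < lookup v x" "lookup v y < lookup u y"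
        "idx x < idx y" by blast
      have yu: "y \<in> keys u" using xy(4) by (auto simp: in_keys_iff)
      have lw: "ts ! i \<preceq> swap u x y"
        unfolding divides_def
      proof
        fix z
        have "lookup (ts ! i) z \<le> lookup u z" "lookup (ts ! i) z \<le> lookup v z"
          using i(2) j(2) 2(1) by (auto simp: divides_def)
        then show "lookup (ts ! i) z \<le> lookup (swap u x y) z"
          using xy by (auto simp: lookup_swap)
      qed
      have "swap u x y + var y = u + var x"
        unfolding swap_def using yu by (intro divides_minus_add) (auto simp: var_divides_iff keys_nat_add)
      moreover have "wt (a + var b) = wt a + idx b" if "b \<in> V" for a b
      proof -
        have "(\<Sum>v\<in>V. lookup (var b) v * idx v) = (\<Sum>v\<in>V. if b = v then idx v else 0)"
          by (rule sum.cong) (simp_all add: lookup_var)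
        then show ?thesis
          using V that by (simp add: wt_def lookup_add distrib_right sum.distrib)
      qed
      ultimately have "wt (swap u x y) + idx y = wt u + idx x"
        using xy(1,2) by metis
      then have "wt (swap u x y) < wt u"
        using xy(5) by simp
      moreover have "fst_gen (swap u x y) \<le> fst_gen u"
        using gen_le[OF i(1) lw] by (simp add: i_def)
      ultimately show ?thesis
        using swapA[OF xy(1) yu i(1) lw] xy(3)
        by (intro exI[of _ x] bexI[of _ "swap u x y"]) (auto simp: swap_divides)
    qed
  qed
  then show ?thesis
    by (intro mono_lq_sort[OF fin, where key = "\<lambda>w. (fst_gen w, wt w)"]) blast
qed

section \<open>Componentwise linearity from linear quotients\<close>

definition pp_vec :: "('v \<Rightarrow>\<^sub>0 nat) \<Rightarrow> nat \<Rightarrow> ('v, 'k::field) mpoly" where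
  "pp_vec t = (\<lambda>l. if l = 0 then pp t else 0)"

lemma mono_ideal_add:
  "f \<in> mono_ideal V T \<Longrightarrow> g \<in> mono_ideal V T \<Longrightarrow> f + g \<in> mono_ideal V T"
  using Poly_Mapping.keys_add[of f g] unfolding mono_ideal_def by (auto intro: carrier_closed)

lemma lspan_pp_vec:
  assumes "\<And>t. t \<in> set ts \<Longrightarrow> keys t \<subseteq> V"
  shows "x \<in> lspan V (map pp_vec ts) \<longleftrightarrow>
    x 0 \<in> (mono_ideal V (set ts) :: ('v, 'k::field) mpoly set) \<and> (\<forall>l\<ge>1. x l = 0)"
  using assms
proof (induction ts arbitrary: x rule: rev_induct)
  case Nil
  have "x 0 \<in> mono_ideal V {} \<longleftrightarrow> x 0 = 0"
    by (auto simp: mono_ideal_def carrier_poly_ring simp flip: keys_eq_empty)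
  moreover have "x = (\<lambda>l. 0) \<longleftrightarrow> x 0 = 0 \<and> (\<forall>l\<ge>1. x l = 0)"
    by (metis less_one not_le)
  ultimately show ?case by simp
next
  case (snoc t ts)
  let ?I = "mono_ideal V (set ts) :: ('v, 'k) mpoly set"
  let ?J = "mono_ideal V (set (ts @ [t])) :: ('v, 'k) mpoly set"
  have t: "keys t \<subseteq> V" and IH: "\<And>x. x \<in> lspan V (map pp_vec ts) \<longleftrightarrow> x 0 \<in> ?I \<and> (\<forall>l\<ge>1. x l = 0)"
    using snoc by auto
  show ?case
  proof
    assume "x \<in> lspan V (map pp_vec (ts @ [t]))"
    then obtain y a where y: "y 0 \<in> ?I" "\<forall>l\<ge>1. y l = 0" "a \<in> carrier (poly_ring V)"
      "x = (\<lambda>l. y l + a * pp_vec t l)"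
      by (auto simp: lspan_snoc IH)
    have "a * pp t \<in> ?J"
      using pp_mult_mono_ideal_iff[OF t y(3), of "set (ts @ [t])"] by auto
    moreover have "y 0 \<in> ?J"
      using y(1) by (auto simp: mono_ideal_def)
    ultimately show "x 0 \<in> ?J \<and> (\<forall>l\<ge>1. x l = 0)"
      using y(2,4) mono_ideal_add[of "y 0" V "set (ts @ [t])" "a * pp t"] by (simp add: pp_vec_def)
  next
    assume x: "x 0 \<in> ?J \<and> (\<forall>l\<ge>1. x l = 0)"
    then have "x 0 \<in> mono_ideal V (insert t (set ts))" by simp
    then obtain a b where ab: "a \<in> carrier (poly_ring V)" "b \<in> ?I" "x 0 = a * pp t + b"
      by (rule mono_ideal_insertE)
    have "(\<lambda>l. if l = 0 then b else 0) \<in> lspan V (map pp_vec ts)"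
      using ab(2) by (simp add: IH)
    moreover have "x = (\<lambda>l. (if l = 0 then b else 0) + a * pp_vec t l)"
      using x ab(3) by (auto simp: pp_vec_def fun_eq_iff)
    ultimately show "x \<in> lspan V (map pp_vec (ts @ [t]))"
      using ab(1) by (auto simp: lspan_snoc)
  qed
qed

lemma mono_lq_imp_module_lq:
  assumes "finite V" "mono_lq ts" "\<And>t. t \<in> set ts \<Longrightarrow> keys t \<subseteq> V"
  shows "module_lq V (map pp_vec ts :: (nat \<Rightarrow> ('v, 'k::field) mpoly) list)"
  using assms(2,3)
proof (induction ts rule: rev_induct)
  case Nil
  show ?case by (simp add: module_lq.Nil)
next
  case (snoc t ts)
  have "mono_lq ts"
    unfolding mono_lq_def
  proof (intro allI impI)
    fix i j assume ij: "i < length ts" "j < i"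
    then obtain z l where "l < i" "lookup ((ts @ [t]) ! i) z < lookup ((ts @ [t]) ! j) z"
      "(ts @ [t]) ! l \<preceq> (ts @ [t]) ! i + var z"
      using snoc.prems(1) unfolding mono_lq_def by (metis length_append_singleton less_SucI)
    then show "\<exists>z. \<exists>l<i. lookup (ts ! i) z < lookup (ts ! j) z \<and> ts ! l \<preceq> ts ! i + var z"
      using ij by (auto simp: nth_append)
  qed
  then have IH: "module_lq V (map pp_vec ts :: (nat \<Rightarrow> ('v, 'k) mpoly) list)"
    using snoc by auto
  let ?W = "{z \<in> V. \<exists>l<length ts. (ts @ [t]) ! l \<preceq> (ts @ [t]) ! length ts + var z}"
  have "(\<lambda>l. f * pp_vec t l) \<in> lspan V (map pp_vec ts) \<longleftrightarrow> f \<in> var_ideal V ?W"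
    if f: "f \<in> carrier (poly_ring V)" for f :: "('v, 'k) mpoly"
  proof -
    have "(\<lambda>l. f * pp_vec t l) \<in> lspan V (map pp_vec ts) \<longleftrightarrow> f * pp t \<in> mono_ideal V (set ts)"
      using lspan_pp_vec[of ts V "\<lambda>l. f * pp_vec t l"] snoc.prems(2) by (auto simp: pp_vec_def)
    also have "\<dots> \<longleftrightarrow> f \<in> var_ideal V ?W"
      using pp_mult_mono_ideal_iff[OF _ f, of t "set ts"] snoc.prems(2)
        mono_lq_colon[OF snoc.prems(1) _ f, of "length ts"] by simp
    finally show ?thesis .
  qed
  then show ?case
    using module_lq.snoc[OF IH, of ?W "pp_vec t"] assms(1) by simp
qed

text \<open>All terms of a form in a monomial ideal lie in the ideal. Hence the ideal of a degree
  component is again monomial, and the criterion on exponents applies to it.\<close>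

lemma Idl_component:
  fixes T :: "('v \<Rightarrow>\<^sub>0 nat) set"
  shows "Idl\<^bsub>poly_ring V\<^esub> {f \<in> mono_ideal V T. homogeneous (int d) f}
    = (mono_ideal V {t. keys t \<subseteq> V \<and> mdeg t = d \<and> (\<exists>s\<in>T. s \<preceq> t)} :: ('v, 'k::field) mpoly set)"
    (is "Idl\<^bsub>_\<^esub> ?F = mono_ideal V ?A")
proof
  interpret cring "poly_ring V :: ('v, 'k) mpoly ring" by (rule poly_ring_cring)
  have F: "?F \<subseteq> carrier (poly_ring V :: ('v, 'k) mpoly ring)"
    by (auto simp: mono_ideal_def)
  have "f \<in> mono_ideal V ?A" if f: "f \<in> ?F" for f :: "('v, 'k) mpoly"
  proof -
    have "t \<in> ?A" if "t \<in> keys f" for t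
      using f that by (auto simp: mono_ideal_def homogeneous_def carrier_poly_ring)
    moreover have "f \<in> carrier (poly_ring V)"
      using f by (simp add: mono_ideal_def)
    ultimately show ?thesis
      unfolding mono_ideal_def using divides_refl by blast
  qed
  then show "Idl\<^bsub>poly_ring V\<^esub> ?F \<subseteq> (mono_ideal V ?A :: ('v, 'k) mpoly set)"
    by (intro genideal_minimal[OF mono_ideal_ideal] subsetI)
  have "pp ` ?A \<subseteq> (?F :: ('v, 'k) mpoly set)"
    by (auto simp: mono_ideal_def homogeneous_def intro: carrier_single)
  then have "Idl\<^bsub>poly_ring V\<^esub> (pp ` ?A) \<subseteq> Idl\<^bsub>poly_ring V\<^esub> (?F :: ('v, 'k) mpoly set)"
    using F by (meson genideal_ideal genideal_minimal genideal_self order_trans)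
  moreover have "Idl\<^bsub>poly_ring V\<^esub> (pp ` ?A) = (mono_ideal V ?A :: ('v, 'k) mpoly set)"
    by (rule Idl_pp) simp
  ultimately show "mono_ideal V ?A \<subseteq> Idl\<^bsub>poly_ring V\<^esub> (?F :: ('v, 'k) mpoly set)"
    by simp
qed

text \<open>The ideal itself may have generators of several degrees, whereas the syzygy construction
  requires a single degree \<open>q\<close>. Therefore it is applied to each degree component, whose
  monomials inherit linear quotients.\<close>

theorem has_linear_quotients_imp_componentwise_linear:
  fixes I :: "('v, 'k::field) mpoly set"
  assumes V: "finite V" and "has_linear_quotients V I"
  shows "componentwise_linear V I"
proof -
  obtain ts where ts: "distinct ts" "\<And>t. t \<in> set ts \<Longrightarrow> keys t \<subseteq> V"
    "\<forall>s\<in>set ts. \<forall>t\<in>set ts. s \<preceq> t \<longrightarrow> s = t" "mono_lq ts" "I = mono_ideal V (set ts)"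
    using assms(2) unfolding has_linear_quotients_iff by blast
  have "homogeneous_ideal V I"
    unfolding homogeneous_ideal_def
  proof (intro exI[of _ "pp ` set ts"] conjI ballI)
    show "pp ` set ts \<subseteq> carrier (poly_ring V)"
      using ts(2) by (auto intro: carrier_single)
    show "\<exists>d. homogeneous d f" if "f \<in> pp ` set ts" for f :: "('v, 'k) mpoly"
      using that by (auto simp: homogeneous_def)
    show "I = Idl\<^bsub>poly_ring V\<^esub> (pp ` set ts)"
      using ts(2,5) by (simp add: Idl_pp)
  qed
  moreover have "has_linear_resolution V (Idl\<^bsub>poly_ring V\<^esub> {f \<in> I. homogeneous (int d) f})" for d
  proof -
    let ?A = "{t. keys t \<subseteq> V \<and> mdeg t = d \<and> (\<exists>s\<in>set ts. s \<preceq> t)}"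
    let ?F = "{f \<in> I. homogeneous (int d) f}"
    obtain ws where ws: "set ws = ?A" "mono_lq ws"
      using mono_lq_component[OF V ts(4,1,3), of d] by blast
    have wsV: "\<And>t. t \<in> set ws \<Longrightarrow> keys t \<subseteq> V"
      using ws(1) by auto
    have "Idl\<^bsub>poly_ring V\<^esub> ?F = (mono_ideal V ?A :: ('v, 'k) mpoly set)"
      unfolding ts(5) by (rule Idl_component)
    also have "(mono_ideal V ?A :: ('v, 'k) mpoly set) = (\<lambda>x. x 0) ` lspan V (map pp_vec ws)"
    proof -
      have span: "x \<in> lspan V (map pp_vec ws) \<longleftrightarrow>
          x 0 \<in> (mono_ideal V ?A :: ('v, 'k) mpoly set) \<and> (\<forall>l\<ge>1. x l = 0)" for x
        unfolding ws(1)[symmetric] by (rule lspan_pp_vec) (rule wsV)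
      show ?thesis
      proof
        show "(mono_ideal V ?A :: ('v, 'k) mpoly set) \<subseteq> (\<lambda>x. x 0) ` lspan V (map pp_vec ws)"
        proof
          fix f :: "('v, 'k) mpoly" assume "f \<in> mono_ideal V ?A"
          then have "(\<lambda>l. if l = 0 then f else 0) \<in> lspan V (map pp_vec ws)"
            unfolding span by simp
          then show "f \<in> (\<lambda>x. x 0) ` lspan V (map pp_vec ws)"
            by (rule rev_image_eqI) simp
        qed
      qed (use span in auto)
    qed
    finally have eq: "Idl\<^bsub>poly_ring V\<^esub> ?F = (\<lambda>x. x 0) ` lspan V (map pp_vec ws)" .
    have "\<forall>c\<in>set (map pp_vec ws). homog_vec V d c \<and> (\<forall>l\<ge>1. c l = (0 :: ('v, 'k) mpoly))"
      using ws(1) by (auto simp: homog_vec_def pp_vec_def carrier_single carrier_closed)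
    then show ?thesis
      unfolding eq
      by (intro module_lq_imp_linear_resolution[OF mono_lq_imp_module_lq[OF V ws(2) wsV] _ refl])
  qed
  ultimately show ?thesis
    unfolding componentwise_linear_def by blast
qed

section \<open>Symbolic powers of cover ideals\<close>

definition covers :: "'v set \<Rightarrow> 'v set set \<Rightarrow> nat \<Rightarrow> ('v \<Rightarrow>\<^sub>0 nat) set" where
  "covers V E k = {t. keys t \<subseteq> V \<and> (\<forall>u v. {u, v} \<in> E \<longrightarrow> k \<le> lookup t u + lookup t v)}"

lemma covers_mono: "s \<in> covers V E k \<Longrightarrow> s \<preceq> t \<Longrightarrow> keys t \<subseteq> V \<Longrightarrow> t \<in> covers V E k"
  unfolding covers_def divides_def by (auto) (meson add_mono order_trans)

text \<open>Multiples of covers are covers, so \<open>covers\<close> contains all monomials of the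
  ideal, not only generators.\<close>

lemma mono_ideal_covers:
  "f \<in> mono_ideal V (covers V E k) \<longleftrightarrow> f \<in> carrier (poly_ring V) \<and> keys f \<subseteq> covers V E k"
proof -
  have "(\<exists>s\<in>covers V E k. s \<preceq> t) \<longleftrightarrow> t \<in> covers V E k" if "keys t \<subseteq> V" for t
    using that covers_mono divides_refl by blast
  then show ?thesis
    unfolding mono_ideal_def carrier_poly_ring by auto
qed

text \<open>The \<open>k\<close>-th power of the ideal of an edge consists of the polynomials all of
  whose terms have joint degree at least \<open>k\<close> in the two end vertices.\<close>

lemma edge_ideal_power:
  assumes uv: "u \<in> V" "v \<in> V" "u \<noteq> v"
  shows "(Idl\<^bsub>poly_ring V\<^esub> (pvar ` {u, v})) [^]\<^bsub>ideals_set (poly_ring V)\<^esub> k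
    = (mono_ideal V (covers V {{u, v}} k) :: ('v, 'k::field) mpoly set)"
proof -
  let ?R = "poly_ring V :: ('v, 'k) mpoly ring"
  let ?I = "Idl\<^bsub>?R\<^esub> (pvar ` {u, v})"
  let ?P = "\<lambda>k. mono_ideal V (covers V {{u, v}} k) :: ('v, 'k) mpoly set"
  interpret cring ?R by (rule poly_ring_cring)
  interpret M: comm_monoid "ideals_set ?R" by (rule ideals_set_is_comm_monoid)
  have pvar: "pvar ` {u, v} \<subseteq> carrier ?R"
    using uv by (auto simp: pvar_eq intro!: carrier_single)
  have I: "ideal ?I ?R"
    by (rule genideal_ideal[OF pvar])
  have P: "t \<in> covers V {{u, v}} k \<longleftrightarrow> keys t \<subseteq> V \<and> k \<le> lookup t u + lookup t v" for t k
    by (auto simp: covers_def doubleton_eq_iff)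
  have I1: "f \<in> ?I \<longleftrightarrow> f \<in> ?P 1" for f
    using Idl_pvar[of "{u, v}" V, where 'k='k] uv unfolding mono_ideal_covers
    by (auto simp: P carrier_poly_ring in_keys_iff Suc_le_eq)
  have step: "ideal_prod ?R (?P k) ?I = ?P (Suc k)" for k
  proof
    show "ideal_prod ?R (?P k) ?I \<subseteq> ?P (Suc k)"
    proof
      fix f assume "f \<in> ideal_prod ?R (?P k) ?I"
      then show "f \<in> ?P (Suc k)"
      proof (induction rule: ideal_prod.induct)
        case (prod i j)
        have ij: "i \<in> carrier ?R" "j \<in> carrier ?R" "keys i \<subseteq> covers V {{u, v}} k" "keys j \<subseteq> covers V {{u, v}} 1"
          using prod I1 by (auto simp: mono_ideal_covers)
        have "t \<in> covers V {{u, v}} (Suc k)" if "t \<in> keys (i * j)" for t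
        proof -
          obtain a b where "t = a + b" "a \<in> keys i" "b \<in> keys j"
            using keys_mult[of i j] \<open>t \<in> keys (i * j)\<close> by blast
          then show ?thesis
            using ij by (fastforce simp: P lookup_add keys_nat_add)
        qed
        then show ?case
          using carrier_closed(4)[OF ij(1,2)] by (auto simp: mono_ideal_covers)
      next
        case (sum s1 s2)
        then show ?case
          by (simp add: mono_ideal_add)
      qed
    qed
    show "?P (Suc k) \<subseteq> ideal_prod ?R (?P k) ?I"
    proof
      fix f assume f: "f \<in> ?P (Suc k)"
      show "f \<in> ideal_prod ?R (?P k) ?I"
      proof (rule ideal_singlesI[OF ideal_prod_is_ideal[OF mono_ideal_ideal I]])
        fix t assume t: "t \<in> keys f"
        have tc: "keys t \<subseteq> V" "Suc k \<le> lookup t u + lookup t v"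
          using f t P[of t "Suc k"] by (auto simp: mono_ideal_covers)
        \<comment> \<open>The joint degree is positive, so one end vertex can be split off as the
          factor from the edge ideal.\<close>
        then have "var u \<preceq> t \<or> var v \<preceq> t"
          by (cases "lookup t u = 0") (auto simp: var_divides_iff in_keys_iff)
        then obtain w where w: "w \<in> {u, v}" "var w \<preceq> t"
          by blast
        have t_eq: "t - var w + var w = t"
          using w(2) by (rule divides_minus_add)
        have "keys (t - var w) \<subseteq> V"
          using tc(1) by (auto simp: in_keys_iff lookup_minus)
        moreover have "k \<le> lookup (t - var w) u + lookup (t - var w) v"
          using tc(2) w(1) uv(3) by (auto simp: lookup_minus lookup_var)
        ultimately have "single (t - var w) (lookup f t) \<in> ?P k"
          by (auto simp: mono_ideal_covers P carrier_poly_ring)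
        moreover have "pp (var w) \<in> ?I"
          using genideal_self[OF pvar] w(1) by (auto simp: pvar_eq)
        ultimately have "single (t - var w) (lookup f t) * pp (var w) \<in> ideal_prod ?R (?P k) ?I"
          using ideal_prod.prod[of _ "?P k" _ ?I ?R] by simp
        then show "single t (lookup f t) \<in> ideal_prod ?R (?P k) ?I"
          by (simp add: mult_single t_eq)
      qed
    qed
  qed
  show ?thesis
  proof (induction k)
    case 0
    have "?P 0 = carrier ?R"
      by (auto simp: mono_ideal_covers P carrier_poly_ring)
    then show ?case
      by (simp add: M.nat_pow_0) (simp add: ideals_set_def)
  next
    case (Suc k)
    have "?I [^]\<^bsub>ideals_set ?R\<^esub> Suc k = ideal_prod ?R (?I [^]\<^bsub>ideals_set ?R\<^esub> k) ?I"
      by (simp add: M.nat_pow_Suc) (simp add: ideals_set_def)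
    then show ?case
      using Suc step by simp
  qed
qed

lemma cover_ideal_symbolic_power_eq:
  assumes E: "\<And>e. e \<in> E \<Longrightarrow> \<exists>u v. e = {u, v} \<and> u \<in> V \<and> v \<in> V \<and> u \<noteq> v"
  shows "cover_ideal_symbolic_power V E k = (mono_ideal V (covers V E k) :: ('v, 'k::field) mpoly set)"
proof -
  have pow: "(Idl\<^bsub>poly_ring V\<^esub> (pvar ` e)) [^]\<^bsub>ideals_set (poly_ring V)\<^esub> k
    = (mono_ideal V (covers V {e} k) :: ('v, 'k) mpoly set)" if e: "e \<in> E" for e
  proof -
    obtain u v where "e = {u, v}" "u \<in> V" "v \<in> V" "u \<noteq> v"
      using E[OF e] by blast
    then show ?thesis
      using edge_ideal_power[of u V v k, where 'k='k] by simp
  qed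
  have cov: "t \<in> covers V E k \<longleftrightarrow> keys t \<subseteq> V \<and> (\<forall>e\<in>E. t \<in> covers V {e} k)" for t
    by (auto simp: covers_def)
  have "f \<in> cover_ideal_symbolic_power V E k \<longleftrightarrow> f \<in> mono_ideal V (covers V E k)"
    for f :: "('v, 'k) mpoly"
    unfolding cover_ideal_symbolic_power_def
    by (simp add: pow mono_ideal_covers) (auto simp: cov subset_iff carrier_poly_ring)
  then show ?thesis by blast
qed

section \<open>An obstruction to linear resolutions\<close>

text \<open>
  The first syzygies detect connectedness: if the generators dividing \<open>L\<close> split into two classes such
  that no proper divisor of \<open>L\<close> of degree \<open>d + 1\<close> is divisible by generators of both, then the relation
  \<open>(L / u) u = (L / v) v\<close> between generators of different classes is no combination of linear ones.
  To see this, replace every monomial outside the class \<open>C\<close> by \<open>0\<close> in the generators \<open>g\<close>, and compare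
  coefficients at \<open>L\<close>.
\<close>

lemma not_linear_resolution:
  fixes A :: "('v \<Rightarrow>\<^sub>0 nat) set"
  assumes A: "\<And>t. t \<in> A \<Longrightarrow> mdeg t = d" "\<And>t. t \<in> A \<Longrightarrow> keys t \<subseteq> V"
    and u: "u \<in> A" "u \<in> C" "u \<preceq> L" and v: "v \<in> A" "v \<notin> C" "v \<preceq> L" and L: "keys L \<subseteq> V"
    and split: "\<And>M. M \<preceq> L \<Longrightarrow> mdeg M = Suc d \<Longrightarrow>
      (\<forall>t\<in>A. t \<preceq> M \<longrightarrow> t \<in> C) \<or> (\<forall>t\<in>A. t \<preceq> M \<longrightarrow> t \<notin> C)"
  shows "\<not> has_linear_resolution V (mono_ideal V A :: ('v, 'k::field) mpoly set)"
proof
  let ?I = "mono_ideal V A :: ('v, 'k) mpoly set"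
  assume "has_linear_resolution V ?I"
  then obtain d0 r a g and D :: "nat \<Rightarrow> ('v, 'k) mpoly mat" where
    res: "graded_free_resolution V ?I r a g D" and a: "\<And>i j. j < r i \<Longrightarrow> a i j = d0 + int i"
    unfolding has_linear_resolution_def minimal_graded_free_resolution_def by blast
  note res' = res[unfolded graded_free_resolution_def]
  have g: "g \<in> free_mod V (r 0)" and g_all: "\<forall>j<r 0. homogeneous (a 0 j) (g $ j)"
    and D_all: "\<forall>i. D i \<in> carrier_mat (r i) (r (Suc i)) \<and>
        (\<forall>j<r i. \<forall>k<r (Suc i). D i $$ (j, k) \<in> carrier (poly_ring V) \<and>
           homogeneous (a (Suc i) k - a i j) (D i $$ (j, k)))"
    and im: "(\<lambda>x. g \<bullet> x) ` free_mod V (r 0) = ?I"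
    and ker: "{x \<in> free_mod V (r 0). g \<bullet> x = 0} = (\<lambda>x. D 0 *\<^sub>v x) ` free_mod V (r 1)"
    using res'[THEN conjunct1] res'[THEN conjunct2, THEN conjunct1]
      res'[THEN conjunct2, THEN conjunct2, THEN conjunct1]
      res'[THEN conjunct2, THEN conjunct2, THEN conjunct2, THEN conjunct1]
      res'[THEN conjunct2, THEN conjunct2, THEN conjunct2, THEN conjunct2, THEN conjunct1]
    by - assumption+
  have g_hom: "homogeneous (a 0 j) (g $ j)" if "j < r 0" for j
    using g_all that by simp
  have D_mat: "D 0 \<in> carrier_mat (r 0) (r 1)"
    using spec[OF D_all, of 0] by simp
  have D_hom: "homogeneous (a 1 k - a 0 j) (D 0 $$ (j, k))" if "j < r 0" "k < r 1" for j k
    using spec[OF D_all, of 0] that by simp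
  let ?S = "carrier (poly_ring V) :: ('v, 'k) mpoly set"
  define R where "R = {0..<r 0}"
  define G where "G = (\<lambda>x :: ('v, 'k) mpoly vec. \<Sum>j\<in>R. g $ j * x $ j)"
  define GC where "GC = (\<lambda>x :: ('v, 'k) mpoly vec. \<Sum>j\<in>R. proj (\<lambda>t. t \<in> C) (g $ j) * x $ j)"
  have gG: "g \<bullet> x = G x" if "x \<in> free_mod V (r 0)" for x
  proof -
    have "dim_vec x = r 0"
      using that by (simp add: free_mod_def)
    then show ?thesis
      unfolding scalar_prod_def G_def R_def by simp
  qed
  have unit: "unit_vec n j \<in> free_mod V n" if "j < n" for n j
    using that by (auto simp: free_mod_def carrier_closed)
  have gI: "g $ j \<in> ?I" if "j < r 0" for j
    using im unit[OF that] scalar_prod_right_unit[OF that, of g] by (metis imageI)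
  have key_ge: "d \<le> mdeg t \<and> int (mdeg t) = d0" if "j < r 0" "t \<in> keys (g $ j)" for j t
    using gI[OF that(1)] g_hom[OF that(1)] a[of j 0] that A(1) mdeg_mono[of _ t]
    by (fastforce simp: mono_ideal_def homogeneous_def)
  have ppI: "pp t \<in> ?I" if "t \<in> A" for t
    using that A(2) by (auto simp: mono_ideal_def intro!: carrier_single divides_refl)
  \<comment> \<open>The generators \<open>g $ j\<close> of the resolution are arbitrary polynomials,
    so the monomials \<open>u\<close> and \<open>v\<close> have to be written through coefficient
    vectors.\<close>
  obtain \<alpha> where \<alpha>: "\<alpha> \<in> free_mod V (r 0)" "pp u = G \<alpha>"
    using ppI[OF u(1)] im gG by (metis imageE)
  obtain \<beta> where \<beta>: "\<beta> \<in> free_mod V (r 0)" "pp v = G \<beta>"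
    using ppI[OF v(1)] im gG by (metis imageE)
  \<comment> \<open>A linear resolution fixes some generating degree \<open>d0\<close>. No generator
    has degree below \<open>d\<close>, and one of them contributes to the degree \<open>d\<close>
    monomial \<open>u\<close>.\<close>
  have d0: "d0 = int d"
  proof -
    have "u \<in> keys (G \<alpha>)"
      by (simp flip: \<alpha>(2))
    then have "u \<in> (\<Union>j\<in>R. keys (g $ j * \<alpha> $ j))"
      unfolding G_def using keys_sum[of "\<lambda>j. g $ j * \<alpha> $ j" R] by (rule rev_subsetD)
    then obtain j where j: "j < r 0" "u \<in> keys (g $ j * \<alpha> $ j)"
      by (auto simp: R_def)
    then obtain s t where "u = s + t" "s \<in> keys (g $ j)"
      using keys_mult[of "g $ j" "\<alpha> $ j"] by blast
    then show ?thesis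
      using key_ge[OF j(1), of s] A(1)[OF u(1)] mdeg_add[of s t] by simp
  qed
  have gA: "t \<in> A" if j: "j < r 0" and t: "t \<in> keys (g $ j)" for j t
  proof -
    obtain s where "s \<in> A" "s \<preceq> t"
      using gI[OF j] t by (auto simp: mono_ideal_def)
    then show ?thesis
      using divides_mdeg_eq[of s t] A(1) key_ge[OF j t] d0 by simp
  qed
  have lookup_GC: "lookup (GC x) M = lookup (G x) M"
    if "\<And>t. t \<in> A \<Longrightarrow> t \<preceq> M \<Longrightarrow> t \<in> C" for x M
  proof -
    have "lookup (proj (\<lambda>t. t \<notin> C) (g $ j) * x $ j) M = 0" if "j < r 0" for j
    proof (rule ccontr)
      assume "lookup (proj (\<lambda>t. t \<notin> C) (g $ j) * x $ j) M \<noteq> 0"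
      then have "M \<in> keys (proj (\<lambda>t. t \<notin> C) (g $ j) * x $ j)"
        by (simp add: in_keys_iff)
      then obtain s t where "M = s + t" "s \<in> keys (proj (\<lambda>t. t \<notin> C) (g $ j))"
        using keys_mult[of "proj (\<lambda>t. t \<notin> C) (g $ j)" "x $ j"] by blast
      then show False
        using \<open>\<And>t. t \<in> A \<Longrightarrow> t \<preceq> M \<Longrightarrow> t \<in> C\<close> gA[OF \<open>j < r 0\<close>] by (auto simp: keys_proj)
    qed
    moreover have "g $ j * x $ j = proj (\<lambda>t. t \<in> C) (g $ j) * x $ j + proj (\<lambda>t. t \<notin> C) (g $ j) * x $ j" for j
      using proj_split[of "g $ j" "\<lambda>t. t \<in> C"] by (metis distrib_right)
    ultimately show ?thesis
      unfolding G_def GC_def lookup_sum R_def by (intro sum.cong) (auto simp: lookup_add)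
  qed
  have lookup_GC_zero: "lookup (GC x) M = 0"
    if "\<And>t. t \<in> A \<Longrightarrow> t \<preceq> M \<Longrightarrow> t \<notin> C" for x M
  proof -
    have "lookup (proj (\<lambda>t. t \<in> C) (g $ j) * x $ j) M = 0" if "j < r 0" for j
    proof (rule ccontr)
      assume "lookup (proj (\<lambda>t. t \<in> C) (g $ j) * x $ j) M \<noteq> 0"
      then have "M \<in> keys (proj (\<lambda>t. t \<in> C) (g $ j) * x $ j)"
        by (simp add: in_keys_iff)
      then obtain s t where "M = s + t" "s \<in> keys (proj (\<lambda>t. t \<in> C) (g $ j))"
        using keys_mult[of "proj (\<lambda>t. t \<in> C) (g $ j)" "x $ j"] by blast
      then show False
        using \<open>\<And>t. t \<in> A \<Longrightarrow> t \<preceq> M \<Longrightarrow> t \<notin> C\<close> gA[OF \<open>j < r 0\<close>] by (auto simp: keys_proj)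
    qed
    then show ?thesis
      unfolding GC_def lookup_sum R_def by (intro sum.neutral) auto
  qed
  have same: "t = w" if "t \<in> A" "w \<in> A" "t \<preceq> w" for t w
    using divides_mdeg_eq[OF that(3)] A(1) that by simp
  have vanish: "lookup (GC x) L = 0" if x: "x \<in> free_mod V (r 0)" "g \<bullet> x = 0" for x
  proof -
    obtain h where h: "h \<in> free_mod V (r 1)" "x = D 0 *\<^sub>v h"
      using x ker by blast
    have col: "D 0 *\<^sub>v unit_vec (r 1) k \<in> free_mod V (r 0)" "G (D 0 *\<^sub>v unit_vec (r 1) k) = 0"
      if "k < r 1" for k
    proof -
      have *: "D 0 *\<^sub>v unit_vec (r 1) k \<in> {x \<in> free_mod V (r 0). g \<bullet> x = 0}"
        unfolding ker using unit[OF that] by (rule imageI)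
      then show "D 0 *\<^sub>v unit_vec (r 1) k \<in> free_mod V (r 0)"
        by simp
      then show "G (D 0 *\<^sub>v unit_vec (r 1) k) = 0"
        using * gG[of "D 0 *\<^sub>v unit_vec (r 1) k"] by simp
    qed
    have col_eq: "(D 0 *\<^sub>v unit_vec (r 1) k) $ j = D 0 $$ (j, k)" if "k < r 1" "j < r 0" for j k
      using that D_mat by simp
    let ?q = "\<lambda>k. GC (D 0 *\<^sub>v unit_vec (r 1) k)"
    \<comment> \<open>Entries of \<open>D 0\<close> are linear, so \<open>?q k\<close> lives in
      degree \<open>d + 1\<close>. There the generators below \<open>M\<close> belong to one class,
      and the coefficient of \<open>GC\<close> is either that of \<open>G\<close>, which vanishes on
      a relation, or 0.\<close>
    have q: "lookup (?q k) M = 0" if k: "k < r 1" and M: "M \<preceq> L" for k M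
    proof (cases "mdeg M = Suc d")
      case True
      then show ?thesis
        using split[OF M] lookup_GC[of M "D 0 *\<^sub>v unit_vec (r 1) k"] lookup_GC_zero[of M] col(2)[OF k]
        by auto
    next
      case False
      have "M \<notin> keys (proj (\<lambda>t. t \<in> C) (g $ j) * D 0 $$ (j, k))" if j: "j < r 0" for j
      proof
        assume "M \<in> keys (proj (\<lambda>t. t \<in> C) (g $ j) * D 0 $$ (j, k))"
        then obtain s t where "M = s + t" "s \<in> keys (proj (\<lambda>t. t \<in> C) (g $ j))"
          "t \<in> keys (D 0 $$ (j, k))"
          using keys_mult[of "proj (\<lambda>t. t \<in> C) (g $ j)" "D 0 $$ (j, k)"] by blast
        then show False
          using False A(1)[OF gA[OF j]] D_hom[OF j k] a[OF j] a[of k 1] k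
          by (auto simp: mdeg_add homogeneous_def keys_proj)
      qed
      then have "lookup (proj (\<lambda>t. t \<in> C) (g $ j) * D 0 $$ (j, k)) M = 0" if "j < r 0" for j
        using that by (simp add: in_keys_iff)
      then show ?thesis
        unfolding GC_def lookup_sum R_def using col_eq[OF k] by (intro sum.neutral) auto
    qed
    have "x $ j = (\<Sum>k\<in>{0..<r 1}. D 0 $$ (j, k) * h $ k)" if "j < r 0" for j
      using that D_mat h by (auto simp: scalar_prod_def free_mod_def)
    then have "GC x = (\<Sum>j\<in>R. \<Sum>k\<in>{0..<r 1}. proj (\<lambda>t. t \<in> C) (g $ j) * (D 0 $$ (j, k) * h $ k))"
      unfolding GC_def R_def by (intro sum.cong) (auto simp: sum_distrib_left)
    also have "\<dots> = (\<Sum>k\<in>{0..<r 1}. \<Sum>j\<in>R. proj (\<lambda>t. t \<in> C) (g $ j) * (D 0 $$ (j, k) * h $ k))"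
      by (rule sum.swap)
    also have "\<dots> = (\<Sum>k\<in>{0..<r 1}. ?q k * h $ k)"
      unfolding GC_def sum_distrib_right R_def using col_eq by (intro sum.cong) (auto simp: mult.assoc)
    finally have x_eq: "GC x = (\<Sum>k\<in>{0..<r 1}. ?q k * h $ k)" .
    have "lookup (?q k * h $ k) L = 0" if "k < r 1" for k
    proof (rule ccontr)
      assume "lookup (?q k * h $ k) L \<noteq> 0"
      then have "L \<in> keys (?q k * h $ k)"
        by (simp add: in_keys_iff)
      then obtain s t where "L = s + t" "s \<in> keys (?q k)"
        using keys_mult[of "?q k" "h $ k"] by blast
      then show False
        using q[OF that, of s] by (simp add: in_keys_iff)
    qed
    then show ?thesis
      unfolding x_eq lookup_sum by (intro sum.neutral) auto
  qed
  let ?pu = "pp (L - u) :: ('v, 'k) mpoly" and ?pv = "pp (L - v) :: ('v, 'k) mpoly"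
  \<comment> \<open>The relation between \<open>u\<close> and \<open>v\<close>. Its image under
    \<open>GC\<close> has coefficient 1 at \<open>L\<close>, because \<open>u\<close> survives the
    restriction to \<open>C\<close> and \<open>v\<close> does not.\<close>
  define x where "x = vec (r 0) (\<lambda>j. ?pu * \<alpha> $ j - ?pv * \<beta> $ j)"
  have sub: "keys (L - t) \<subseteq> V" for t
    using L by (auto simp: in_keys_iff lookup_minus)
  have "?pu * \<alpha> $ j - ?pv * \<beta> $ j \<in> ?S" if "j < r 0" for j
    using \<alpha>(1) \<beta>(1) that by (intro carrier_closed carrier_single sub) (auto simp: free_mod_def)
  then have x: "x \<in> free_mod V (r 0)"
    by (simp add: x_def free_mod_def)
  have "G x = ?pu * G \<alpha> - ?pv * G \<beta>"
    unfolding G_def R_def by (simp add: x_def algebra_simps sum_subtractf sum_distrib_left)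
  also have "\<dots> = 0"
    unfolding \<alpha>(2)[symmetric] \<beta>(2)[symmetric]
    by (simp add: mult_single divides_minus_add u(3) v(3))
  finally have "lookup (GC x) L = 0"
    using vanish[OF x] gG[OF x] by simp
  moreover have "GC x = ?pu * GC \<alpha> - ?pv * GC \<beta>"
    unfolding GC_def R_def by (simp add: x_def algebra_simps sum_subtractf sum_distrib_left)
  moreover have "L - u \<preceq> L" "L - (L - u) = u" "L - v \<preceq> L" "L - (L - v) = v"
    using u(3) v(3) by (auto simp: divides_def lookup_minus intro!: poly_mapping_eqI)
  moreover have "lookup (GC \<alpha>) u = 1"
  proof -
    have "t \<in> C" if "t \<in> A" "t \<preceq> u" for t
      using same[OF that(1) u(1) that(2)] u(2) by simp
    then have "lookup (GC \<alpha>) u = lookup (G \<alpha>) u"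
      by (rule lookup_GC)
    then show ?thesis
      by (simp flip: \<alpha>(2))
  qed
  moreover have "lookup (GC \<beta>) v = 0"
  proof (rule lookup_GC_zero)
    show "t \<notin> C" if "t \<in> A" "t \<preceq> v" for t
      using same[OF that(1) v(1) that(2)] v(2) by simp
  qed
  ultimately show False
    by (simp add: lookup_minus lookup_single_mult)
qed

section \<open>Clique graphs\<close>

lemma clique_edge_iff:
  "{u, v} \<in> n_clique_edges p n m \<longleftrightarrow>
    u \<noteq> v \<and> (\<exists>i\<in>{1..n}. u \<in> clique_block p m i \<and> v \<in> clique_block p m i)"
  by (auto simp: n_clique_edges_def complete_edges_def doubleton_eq_iff)

lemma clique_vertices [simp]:
  "X j \<in> n_clique_vertices p n m \<longleftrightarrow> j \<in> {1..p}"
  "Y i j \<in> n_clique_vertices p n m \<longleftrightarrow> i \<in> {1..n} \<and> j \<in> {1..m i}"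
  unfolding n_clique_vertices_def by blast+

lemma clique_blocks [simp]:
  "X j \<in> clique_block p m i \<longleftrightarrow> j \<in> {1..p}"
  "Y i' j \<in> clique_block p m i \<longleftrightarrow> i' = i \<and> j \<in> {1..m i}"
  by (auto simp: clique_block_def)

lemma finite_clique_vertices: "finite (n_clique_vertices p n m)"
  by (simp add: n_clique_vertices_def)

lemma clique_edges:
  "e \<in> n_clique_edges p n m \<Longrightarrow>
    \<exists>u v. e = {u, v} \<and> u \<in> n_clique_vertices p n m \<and> v \<in> n_clique_vertices p n m \<and> u \<noteq> v"
  unfolding n_clique_edges_def complete_edges_def n_clique_vertices_def clique_block_def by blast

lemma covers_cliqueI:
  assumes "keys t \<subseteq> n_clique_vertices p n m"
    and "\<And>j j'. j \<in> {1..p} \<Longrightarrow> j' \<in> {1..p} \<Longrightarrow> j \<noteq> j' \<Longrightarrow> k \<le> lookup t (X j) + lookup t (X j')"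
    and "\<And>i j j'. i \<in> {1..n} \<Longrightarrow> j \<in> {1..p} \<Longrightarrow> j' \<in> {1..m i} \<Longrightarrow> k \<le> lookup t (X j) + lookup t (Y i j')"
    and "\<And>i j j'. i \<in> {1..n} \<Longrightarrow> j \<in> {1..m i} \<Longrightarrow> j' \<in> {1..m i} \<Longrightarrow> j \<noteq> j' \<Longrightarrow>
      k \<le> lookup t (Y i j) + lookup t (Y i j')"
  shows "t \<in> covers (n_clique_vertices p n m) (n_clique_edges p n m) k"
proof -
  have "k \<le> lookup t u + lookup t v" if e: "{u, v} \<in> n_clique_edges p n m" for u v
  proof -
    obtain i where i: "i \<in> {1..n}" "u \<in> clique_block p m i" "v \<in> clique_block p m i" "u \<noteq> v"
      using e[unfolded clique_edge_iff] by blast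
    show ?thesis
    proof (cases u)
      case (X j)
      show ?thesis
      proof (cases v)
        fix j' assume "v = X j'"
        then show ?thesis using assms(2)[of j j'] X i by auto
      next
        fix i' j' assume "v = Y i' j'"
        then show ?thesis using assms(3)[of i j j'] X i by auto
      qed
    next
      case (Y i' j)
      show ?thesis
      proof (cases v)
        fix j' assume "v = X j'"
        then show ?thesis using assms(3)[of i j' j] Y i by (auto simp: add.commute)
      next
        fix i'' j' assume "v = Y i'' j'"
        then show ?thesis using assms(4)[of i j j'] Y i by auto
      qed
    qed
  qed
  then show ?thesis using assms(1) by (simp add: covers_def)
qed

lemma exponents_exist:
  assumes "finite V"
  obtains t :: "'v \<Rightarrow>\<^sub>0 nat" where "\<And>v. lookup t v = (if v \<in> V then f v else 0)"
proof -
  have "finite {v. (if v \<in> V then f v else 0) \<noteq> 0}"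
    by (rule finite_subset[OF _ assms]) (auto split: if_splits)
  then show thesis
    using that[of "Abs_poly_mapping (\<lambda>v. if v \<in> V then f v else 0)"] by simp
qed

text \<open>
  The witness for two blocks with a single private vertex: below \<open>L\<close>, the covers of degree two less are
  \<open>L / (x x')\<close> with two shared vertices and \<open>L / (y y')\<close> with two private vertices of different blocks.
\<close>

lemma clique_not_componentwise_linear:
  fixes p n k :: nat and m :: "nat \<Rightarrow> nat"
  defines "V \<equiv> n_clique_vertices p n m" and "E \<equiv> n_clique_edges p n m"
  assumes p: "1 < p" and k: "2 \<le> k" and m: "\<And>i. i \<in> {1..n} \<Longrightarrow> 1 \<le> m i"
    and b: "b1 \<in> {1..n}" "b2 \<in> {1..n}" "b1 \<noteq> b2" "m b1 = 1" "m b2 = 1"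
  shows "\<not> componentwise_linear V (mono_ideal V (covers V E k) :: (clique_vertex, 'k::field) mpoly set)"
proof -
  have VX: "X j \<in> V \<longleftrightarrow> j \<in> {1..p}" and VY: "Y i j \<in> V \<longleftrightarrow> i \<in> {1..n} \<and> j \<in> {1..m i}" for i j
    by (simp_all add: V_def)
  \<comment> \<open>Under \<open>L\<close> an edge from a shared vertex to \<open>Y i 1\<close> has
    sum \<open>k + 1\<close>, and an edge from \<open>Y i 1\<close> to another private vertex has
    sum \<open>k\<close>. So \<open>Y i 1\<close> and a shared vertex cannot both lose a unit, and
    no private vertex of a larger block can lose one.\<close>
  obtain L :: "clique_vertex \<Rightarrow>\<^sub>0 nat" where
    L: "\<And>v. lookup L v = (if v \<in> V then case v of X j \<Rightarrow> k | Y i j \<Rightarrow> if j = 1 then 1 else k - 1 else 0)"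
    using exponents_exist[of V "\<lambda>v. case v of X j \<Rightarrow> k | Y i j \<Rightarrow> if j = 1 then 1 else k - 1"]
      finite_clique_vertices[of p n m] unfolding V_def by blast
  have LX: "j \<in> {1..p} \<Longrightarrow> lookup L (X j) = k" for j
    by (simp add: L VX)
  have LY: "i \<in> {1..n} \<Longrightarrow> j \<in> {1..m i} \<Longrightarrow> lookup L (Y i j) = (if j = 1 then 1 else k - 1)" for i j
    by (simp add: L VY)
  have LV: "keys L \<subseteq> V"
    by (auto simp: in_keys_iff L split: if_splits)
  define u where "u = L - var (X 1) - var (X 2)"
  define v where "v = L - var (Y b1 1) - var (Y b2 1)"
  have uX: "lookup u (X j) = lookup L (X j) - (if j = 1 \<or> j = 2 then 1 else 0)"
    and uY: "lookup u (Y i j) = lookup L (Y i j)" for i j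
    by (simp_all add: u_def lookup_minus lookup_var)
  have vX: "lookup v (X j) = lookup L (X j)"
    and vY: "lookup v (Y i j) = lookup L (Y i j) - (if (i = b1 \<or> i = b2) \<and> j = 1 then 1 else 0)" for i j
    using b(3) by (auto simp: v_def lookup_minus lookup_var)
  have uL: "u + var (X 2) + var (X 1) = L"
    unfolding u_def using p k LX[of 1] LX[of 2]
    by (subst divides_minus_add) (auto simp: var_divides_iff in_keys_iff lookup_minus lookup_var divides_minus_add)
  have vL: "v + var (Y b2 1) + var (Y b1 1) = L"
    unfolding v_def using b LY[of b1 1] LY[of b2 1]
    by (subst divides_minus_add) (auto simp: var_divides_iff in_keys_iff lookup_minus lookup_var divides_minus_add)
  define d where "d = mdeg u"
  have degL: "mdeg L = Suc (Suc d)"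
    by (simp flip: uL add: mdeg_add d_def)
  have degv: "mdeg v = d"
    using degL by (simp flip: vL add: mdeg_add)
  let ?A = "{t. keys t \<subseteq> V \<and> mdeg t = d \<and> (\<exists>s\<in>covers V E k. s \<preceq> t)}"
  \<comment> \<open>Below \<open>L\<close> this class records that a unit has been taken from some
    shared vertex.\<close>
  let ?C = "{t. \<exists>j\<in>{1..p}. lookup t (X j) < k}"
  have A: "t \<in> ?A \<longleftrightarrow> t \<in> covers V E k \<and> mdeg t = d" for t
    using covers_mono[of _ V E k t] divides_refl[of t] by (auto simp: covers_def)
  have "u \<in> covers V E k"
    unfolding V_def E_def
  proof (rule covers_cliqueI)
    show "keys u \<subseteq> n_clique_vertices p n m"
      using LV by (auto simp: V_def u_def in_keys_iff lookup_minus)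
  qed (use k in \<open>auto simp: uX uY LX LY\<close>)
  then have uA: "u \<in> ?A"
    unfolding A by (simp add: d_def)
  have "v \<in> covers V E k"
    unfolding V_def E_def
  proof (rule covers_cliqueI)
    show "keys v \<subseteq> n_clique_vertices p n m"
      using LV by (auto simp: V_def v_def in_keys_iff lookup_minus)
    fix i j j' assume "i \<in> {1..n}" "j \<in> {1..m i}" "j' \<in> {1..m i}" "j \<noteq> j'"
    moreover from this have "i \<noteq> b1" "i \<noteq> b2"
      using b by auto
    ultimately show "k \<le> lookup v (Y i j) + lookup v (Y i j')"
      using k by (auto simp: vY LY)
  qed (auto simp: vX LX)
  then have vA: "v \<in> ?A"
    unfolding A by (simp add: degv)
  have below: "\<exists>z. N = M + var z" if le: "M \<preceq> N" and deg: "mdeg N = Suc (mdeg M)" for M N :: "clique_vertex \<Rightarrow>\<^sub>0 nat"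
  proof -
    have "N = M + (N - M)"
      using divides_minus_add[OF le] by (simp add: add.commute)
    moreover from this have "mdeg N = mdeg M + mdeg (N - M)"
      using mdeg_add by metis
    then obtain z where "N - M = var z"
      using mdeg_eq_1[of "N - M"] deg by force
    ultimately show ?thesis by metis
  qed
  have split: "(\<forall>t\<in>?A. t \<preceq> M \<longrightarrow> t \<in> ?C) \<or> (\<forall>t\<in>?A. t \<preceq> M \<longrightarrow> t \<notin> ?C)"
    if M: "M \<preceq> L" "mdeg M = Suc d" for M
  proof -
    obtain z where z: "L = M + var z"
      using below[OF M(1)] M(2) degL by auto
    have "z \<in> keys L"
      by (simp add: z keys_nat_add)
    then have zV: "z \<in> V" using LV by blast
    show ?thesis
    proof (cases z)
      case (X j)
      then have "lookup M (X j) < k" "j \<in> {1..p}"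
        using arg_cong[OF z, of "\<lambda>t. lookup t (X j)"] zV VX LX[of j]
        by (auto simp: lookup_add lookup_var)
      then have "t \<in> ?C" if "t \<preceq> M" for t
        using that unfolding divides_def by (auto intro!: bexI[of _ j] intro: le_less_trans)
      then show ?thesis by blast
    next
      case (Y i j)
      then have ij: "i \<in> {1..n}" "j \<in> {1..m i}"
        using zV VY by auto
      have "t \<notin> ?C" if t: "t \<in> ?A" "t \<preceq> M" for t
      proof
        assume "t \<in> ?C"
        then obtain j' where j': "j' \<in> {1..p}" "lookup t (X j') < k" by blast
        obtain z' where z': "M = t + var z'"
          using below[OF t(2)] t(1) M(2) by auto
        have L': "lookup L w = lookup t w + lookup (var z') w + lookup (var z) w" for w
          by (simp add: z z' lookup_add)
        \<comment> \<open>One of the two missing units was taken at \<open>z = Y i j\<close>, so the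
          other was taken at the shared vertex. Then the edge from \<open>Y i j\<close> to
          \<open>X j'\<close> (if \<open>j = 1\<close>) or to \<open>Y i 1\<close> has sum
          \<open>k - 1\<close>.\<close>
        have "z' = X j'" and tX: "lookup t (X j') = k - 1"
          using L'[of "X j'"] j' LX[of j'] Y by (auto simp: lookup_var split: if_splits)
        then have tY: "lookup t (Y i' h) = lookup L (Y i' h) - lookup (var z) (Y i' h)" for i' h
          using L'[of "Y i' h"] by (simp add: lookup_var)
        have cov: "k \<le> lookup t x + lookup t y"
          if "x \<in> clique_block p m i" "y \<in> clique_block p m i" "x \<noteq> y" for x y
        proof -
          have "{x, y} \<in> E"
            unfolding E_def clique_edge_iff using ij(1) that by blast
          moreover have "t \<in> covers V E k"
            using t(1) unfolding A by simp
          ultimately show ?thesis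
            by (simp add: covers_def)
        qed
        show False
        proof (cases "j = 1")
          case True
          then have "lookup t (Y i j) = 0"
            using tY[of i j] ij LY[of i j] Y by (simp add: lookup_var)
          then show False
            using cov[of "X j'" "Y i j"] j' ij by auto
        next
          case False
          then have "lookup t (Y i j) = k - 2" "lookup t (Y i 1) = 1"
            using tY[of i j] tY[of i 1] ij LY[of i j] LY[of i 1] Y by (auto simp: lookup_var)
          then show False
            using cov[of "Y i j" "Y i 1"] False ij k by auto
        qed
      qed
      then show ?thesis by blast
    qed
  qed
  have "\<not> has_linear_resolution V (mono_ideal V ?A :: (clique_vertex, 'k) mpoly set)"
  proof (rule not_linear_resolution[of ?A d V u ?C L v])
    show "u \<in> ?C"
      using p k by (auto simp: uX LX intro!: bexI[of _ 1])
    show "v \<notin> ?C"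
      using LX by (auto simp: vX)
    show "u \<preceq> L" "v \<preceq> L"
      by (auto simp: divides_def u_def v_def lookup_minus)
  qed (use uA vA LV split in blast)+
  then show ?thesis
    unfolding componentwise_linear_def using Idl_component[of V "covers V E k" d, where 'k='k] by metis
qed

section \<open>Weighted energy\<close>

text \<open>Covers are ordered by a convex energy; the linear weights \<open>\<tau>\<close> only break ties.\<close>

definition energy :: "nat \<Rightarrow> ('v \<Rightarrow> nat) \<Rightarrow> ('v \<Rightarrow> nat) \<Rightarrow> 'v set \<Rightarrow> nat" where
  "energy K \<tau> a A = (\<Sum>x\<in>A. K * (a x)\<^sup>2 + \<tau> x * a x)"

lemma energy_term_mono:
  "a \<le> b \<Longrightarrow> K * a\<^sup>2 + t * a \<le> K * b\<^sup>2 + t * (b :: nat)"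
  by (intro add_mono mult_left_mono power_mono) auto

lemma energy_term_strict_mono:
  assumes "a < b" "0 < K"
  shows "K * a\<^sup>2 + t * a < K * b\<^sup>2 + t * (b :: nat)"
proof -
  have "a\<^sup>2 < b\<^sup>2" using assms(1) by (intro power_strict_mono) auto
  then have "K * a\<^sup>2 < K * b\<^sup>2" using assms(2) by simp
  then show ?thesis using assms(1) by (intro add_less_le_mono mult_left_mono) auto
qed

text \<open>With \<open>\<delta> = uc - vc\<close>, moving \<delta> units from the first place to
  the second changes the energy by \<open>\<delta> * (2 * K * (uz - vc) + tz - tc)\<close>. A bound
  \<open>K\<close> on the single weights therefore lets the quadratic part dominate unless
  \<open>uz = vc\<close>.\<close>

lemma energy_pair:
  fixes uc vc uz vz tc tz K :: nat
  assumes "vc < uc" "uc + uz \<le> vc + vz" "vc < uz \<or> vc = uz \<and> tc < tz" "tc < K" "tz < K"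
  shows "(K * uc\<^sup>2 + tc * uc) + (K * uz\<^sup>2 + tz * uz) < (K * vc\<^sup>2 + tc * vc) + (K * vz\<^sup>2 + tz * vz)"
proof -
  define \<delta> where "\<delta> = uc - vc"
  have \<delta>: "uc = vc + \<delta>" "0 < \<delta>" "uz + \<delta> \<le> vz"
    using assms(1,2) by (auto simp: \<delta>_def)
  have pos: "0 < 2 * int K * (int uz - int vc) + int tz - int tc"
    using assms(3)
  proof
    assume "vc < uz"
    then have "2 * int K * 1 \<le> 2 * int K * (int uz - int vc)"
      by (intro mult_left_mono) auto
    moreover have "int tc < int K" "0 \<le> int tz"
      using assms(4) by simp_all
    ultimately show ?thesis by linarith
  qed simp
  have "int ((K * vc\<^sup>2 + tc * vc) + (K * (uz + \<delta>)\<^sup>2 + tz * (uz + \<delta>)))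
      - int ((K * uc\<^sup>2 + tc * uc) + (K * uz\<^sup>2 + tz * uz))
    = int \<delta> * (2 * int K * (int uz - int vc) + int tz - int tc)"
    unfolding \<delta>(1) by (simp add: power2_eq_square algebra_simps)
  also have "0 < \<dots>"
    using pos \<delta>(2) by simp
  finally have "(K * uc\<^sup>2 + tc * uc) + (K * uz\<^sup>2 + tz * uz)
    < (K * vc\<^sup>2 + tc * vc) + (K * (uz + \<delta>)\<^sup>2 + tz * (uz + \<delta>))"
    by linarith
  also have "\<dots> \<le> (K * vc\<^sup>2 + tc * vc) + (K * vz\<^sup>2 + tz * vz)"
    using energy_term_mono[OF \<delta>(3)] by simp
  finally show ?thesis .
qed

text \<open>Passing from \<open>u\<close> to \<open>v\<close>, only \<open>c\<close> loses, and the
  rise at \<open>z\<close> makes up for it. What is left at \<open>c\<close> is at most the old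
  value at \<open>z\<close>, so the two values are spread apart and convexity raises the
  energy.\<close>

lemma energy_less_pair:
  assumes A: "finite A" "c \<in> A" "z \<in> A" "c \<noteq> z" and \<tau>: "\<And>x. x \<in> A \<Longrightarrow> \<tau> x < K"
    and le: "\<And>x. x \<in> A \<Longrightarrow> x \<noteq> c \<Longrightarrow> x \<noteq> z \<Longrightarrow> u x \<le> v x"
    and pair: "v c < u c" "u c + u z \<le> v c + v z" "v c < u z \<or> v c = u z \<and> \<tau> c < \<tau> z"
  shows "energy K \<tau> u A < energy K \<tau> v A"
proof -
  have split: "energy K \<tau> a A = (K * (a c)\<^sup>2 + \<tau> c * a c) + (K * (a z)\<^sup>2 + \<tau> z * a z) + energy K \<tau> a (A - {c, z})"
    for a
  proof -
    have "energy K \<tau> a A = energy K \<tau> a (A - {c, z}) + energy K \<tau> a {c, z}"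
      unfolding energy_def using A by (intro sum.subset_diff) auto
    then show ?thesis using A(4) by (simp add: energy_def)
  qed
  have "energy K \<tau> u (A - {c, z}) \<le> energy K \<tau> v (A - {c, z})"
    unfolding energy_def using le by (intro sum_mono energy_term_mono) auto
  then show ?thesis
    unfolding split[of u] split[of v]
    using energy_pair[OF pair \<tau>[OF A(2)] \<tau>[OF A(3)]] by linarith
qed

lemma energy_mono:
  "(\<And>x. x \<in> A \<Longrightarrow> u x \<le> v x) \<Longrightarrow> energy K \<tau> u A \<le> energy K \<tau> v A"
  unfolding energy_def by (intro sum_mono energy_term_mono) auto

lemma energy_mono_cases:
  assumes "finite A" "0 < K" "\<And>x. x \<in> A \<Longrightarrow> u x \<le> v x"
  shows "(\<forall>x\<in>A. v x = u x) \<or> energy K \<tau> u A < energy K \<tau> v A"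
proof (cases "\<forall>x\<in>A. v x = u x")
  case False
  then obtain x where x: "x \<in> A" "u x < v x"
    using assms(3) by (metis le_neq_implies_less)
  have "energy K \<tau> u A < energy K \<tau> v A"
    unfolding energy_def
    using assms x by (intro sum_strict_mono_ex1 bexI[of _ x]) (auto intro: energy_term_mono energy_term_strict_mono)
  then show ?thesis ..
qed simp

lemma energy_swap:
  assumes "finite A" "z \<in> A" "c \<in> A" "z \<noteq> c" "\<And>x. x \<in> A \<Longrightarrow> \<tau> x < K"
    and "Suc (u z) < u c \<or> Suc (u z) = u c \<and> \<tau> z < \<tau> c"
  shows "energy K \<tau> (u(z := Suc (u z), c := u c - 1)) A < energy K \<tau> u A"
  by (rule energy_less_pair[of A z c]) (use assms in auto)

lemma energy_Union:
  assumes "finite I" "\<And>i. i \<in> I \<Longrightarrow> finite (Q i)" "\<And>i j. i \<in> I \<Longrightarrow> j \<in> I \<Longrightarrow> i \<noteq> j \<Longrightarrow> Q i \<inter> Q j = {}"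
    and part: "\<And>i. i \<in> I \<Longrightarrow> (\<forall>x\<in>Q i. v x = u x) \<or> energy K \<tau> u (Q i) < energy K \<tau> v (Q i)"
  shows "(\<forall>x\<in>(\<Union>i\<in>I. Q i). v x = u x) \<or> energy K \<tau> u (\<Union>i\<in>I. Q i) < energy K \<tau> v (\<Union>i\<in>I. Q i)"
proof (cases "\<forall>x\<in>(\<Union>i\<in>I. Q i). v x = u x")
  case False
  have eq: "energy K \<tau> a (\<Union>i\<in>I. Q i) = (\<Sum>i\<in>I. energy K \<tau> a (Q i))" for a
    unfolding energy_def using assms(1-3) by (intro sum.UNION_disjoint) auto
  obtain i where i: "i \<in> I" "energy K \<tau> u (Q i) < energy K \<tau> v (Q i)"
    using part False by blast
  have "energy K \<tau> u (Q i) \<le> energy K \<tau> v (Q i)" if "i \<in> I" for i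
  proof (cases "\<forall>x\<in>Q i. v x = u x")
    case True
    then show ?thesis by (simp add: energy_def)
  next
    case False
    then show ?thesis using part[OF that] by (meson less_imp_le)
  qed
  then have "energy K \<tau> u (\<Union>i\<in>I. Q i) < energy K \<tau> v (\<Union>i\<in>I. Q i)"
    unfolding eq using assms(1) i by (intro sum_strict_mono_ex1) auto
  then show ?thesis ..
qed simp

text \<open>The local form of the exchange argument in a block: if \<open>v\<close> rises at the low
  vertex \<open>z\<close> but no unit can profitably move there, all other values of
  \<open>u\<close> exceed that of \<open>z\<close> by at most one. This leaves so little room that
  any other cover costs more energy.\<close>

lemma energy_clique:
  assumes Q: "finite Q" "z \<in> Q" "c0 \<in> Q" "c0 \<noteq> z" and \<tau>: "\<And>x. x \<in> Q \<Longrightarrow> \<tau> x < K" "inj_on \<tau> Q"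
    and u: "2 * u z \<le> k" "\<And>c. c \<in> Q \<Longrightarrow> c \<noteq> z \<Longrightarrow> u z + u c = k"
    and v: "\<And>x y. x \<in> Q \<Longrightarrow> y \<in> Q \<Longrightarrow> x \<noteq> y \<Longrightarrow> k \<le> v x + v y"
    and stuck: "\<And>c. c \<in> Q \<Longrightarrow> c \<noteq> z \<Longrightarrow> u z < v z \<Longrightarrow> \<not> (u z + 1 < u c \<or> u z + 1 = u c \<and> \<tau> z < \<tau> c)"
  shows "(\<forall>x\<in>Q. v x = u x) \<or> energy K \<tau> u Q < energy K \<tau> v Q"
proof -
  have K: "0 < K" using \<tau>(1)[OF Q(2)] by simp
  consider "v z < u z" | "v z = u z" | "u z < v z" by linarith
  then show ?thesis
  proof cases
    case 1
    \<comment> \<open>A loss at the low vertex forces all others up; \<open>c0\<close> serves as the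
      vertex that makes up for it.\<close>
    have "u x \<le> v x" if "x \<in> Q" "x \<noteq> z" for x
      using u(2)[OF that] v[OF Q(2) that(1)] that(2) 1 by simp
    then have "energy K \<tau> u Q < energy K \<tau> v Q"
      using Q \<tau>(1) 1 u(1) u(2)[OF Q(3,4)] v[OF Q(2,3)]
      by (intro energy_less_pair[of Q z c0]) auto
    then show ?thesis ..
  next
    case 2
    have "u x \<le> v x" if "x \<in> Q" for x
      using u(2)[OF that] v[OF Q(2) that] 2 by (cases "x = z") auto
    then show ?thesis
      by (intro energy_mono_cases Q K)
  next
    case 3
    show ?thesis
    proof (cases "\<forall>c\<in>Q. c \<noteq> z \<longrightarrow> u c \<le> v c")
      case True
      then have "u x \<le> v x" if "x \<in> Q" for x
        using that 3 by (cases "x = z") auto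
      then show ?thesis
        by (intro energy_mono_cases Q K)
    next
      case False
      then obtain c where c: "c \<in> Q" "c \<noteq> z" "v c < u c" by auto
      \<comment> \<open>Hence \<open>v c \<le> u z\<close>. The remaining vertices must satisfy
        \<open>v x \<ge> k - v c > u z\<close>, so \<open>c\<close> is the only one that
        loses.\<close>
      have near: "u c \<le> u z + 1"
        using stuck[OF c(1,2) 3] by simp
      have "u x \<le> v x" if "x \<in> Q" "x \<noteq> z" "x \<noteq> c" for x
        using u(2)[OF that(1,2)] u(2)[OF c(1,2)] v[OF that(1) c(1) that(3)] c(3) near by simp
      moreover have "v c < u z \<or> v c = u z \<and> \<tau> c < \<tau> z"
      proof (cases "v c = u z")
        case True
        then have "\<not> \<tau> z < \<tau> c"
          using stuck[OF c(1,2) 3] c(3) near by simp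
        moreover have "\<tau> z \<noteq> \<tau> c"
          using inj_onD[OF \<tau>(2) _ c(1) Q(2)] c(2) by metis
        ultimately show ?thesis using True by simp
      next
        case False
        then show ?thesis using c(3) near by simp
      qed
      ultimately have "energy K \<tau> u Q < energy K \<tau> v Q"
        using Q \<tau>(1) c u(2)[OF c(1,2)] v[OF c(1) Q(2) c(2)]
        by (intro energy_less_pair[of Q c z]) (auto simp: add.commute)
      then show ?thesis ..
    qed
  qed
qed

section \<open>Minimal covers of clique graphs\<close>

text \<open>\<open>u\<close> is a minimal cover: by \<open>tight\<close>, no positive value can be
  lowered. Shared vertices weigh less than private ones, so a tied exchange may move a unit from a
  private to a shared vertex; injectivity of \<tau> decides ties inside a block.\<close>

locale clique_cover =
  fixes p n k K :: nat and m :: "nat \<Rightarrow> nat" and \<tau> :: "clique_vertex \<Rightarrow> nat" and u :: "clique_vertex \<Rightarrow> nat"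
  assumes p: "1 < p" and n: "1 \<le> n" and m: "\<And>i. i \<in> {1..n} \<Longrightarrow> 1 \<le> m i" and k: "1 \<le> k"
    and single: "\<And>i j. i \<in> {1..n} \<Longrightarrow> j \<in> {1..n} \<Longrightarrow> m i = 1 \<Longrightarrow> m j = 1 \<Longrightarrow> i = j"
    and \<tau>_lt: "\<And>x. x \<in> n_clique_vertices p n m \<Longrightarrow> \<tau> x < K"
    and \<tau>_XY: "\<And>j i j'. j \<in> {1..p} \<Longrightarrow> i \<in> {1..n} \<Longrightarrow> j' \<in> {1..m i} \<Longrightarrow> \<tau> (X j) < \<tau> (Y i j')"
    and \<tau>_inj: "\<And>i. inj_on \<tau> (Y i ` {1..m i})"
    and cov: "\<And>x y. {x, y} \<in> n_clique_edges p n m \<Longrightarrow> k \<le> u x + u y"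
    and tight: "\<And>x. x \<in> n_clique_vertices p n m \<Longrightarrow> 0 < u x \<Longrightarrow>
      \<exists>y. {x, y} \<in> n_clique_edges p n m \<and> u x + u y = k"
begin

abbreviation "V \<equiv> n_clique_vertices p n m"

abbreviation adj :: "clique_vertex \<Rightarrow> clique_vertex \<Rightarrow> bool" where
  "adj x y \<equiv> {x, y} \<in> n_clique_edges p n m"

abbreviation swapped :: "clique_vertex \<Rightarrow> clique_vertex \<Rightarrow> clique_vertex \<Rightarrow> nat" where
  "swapped z c \<equiv> u(z := Suc (u z), c := u c - 1)"

definition exchange :: "(clique_vertex \<Rightarrow> nat) \<Rightarrow> clique_vertex \<Rightarrow> clique_vertex \<Rightarrow> bool" where
  "exchange v z c \<longleftrightarrow> z \<in> V \<and> c \<in> V \<and> z \<noteq> c \<and> u z < v z \<and> 0 < u c \<and>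
    (\<forall>x y. adj x y \<longrightarrow> k \<le> swapped z c x + swapped z c y) \<and>
    energy K \<tau> (swapped z c) V < energy K \<tau> u V"

lemma adj_XX: "j \<in> {1..p} \<Longrightarrow> j' \<in> {1..p} \<Longrightarrow> j \<noteq> j' \<Longrightarrow> adj (X j) (X j')"
  using n unfolding clique_edge_iff by (auto intro!: bexI[of _ 1])

lemma adj_XY: "j \<in> {1..p} \<Longrightarrow> i \<in> {1..n} \<Longrightarrow> j' \<in> {1..m i} \<Longrightarrow> adj (X j) (Y i j')"
  unfolding clique_edge_iff by (auto intro!: bexI[of _ i])

lemma adj_YY: "i \<in> {1..n} \<Longrightarrow> j \<in> {1..m i} \<Longrightarrow> j' \<in> {1..m i} \<Longrightarrow> j \<noteq> j' \<Longrightarrow> adj (Y i j) (Y i j')"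
  unfolding clique_edge_iff by (auto intro!: bexI[of _ i])

lemma adj_sym: "adj x y \<Longrightarrow> adj y x"
  by (simp add: insert_commute)

lemma adjD: "adj x y \<Longrightarrow> x \<in> V \<and> y \<in> V \<and> x \<noteq> y"
  unfolding clique_edge_iff n_clique_vertices_def clique_block_def by blast

lemma adj_Y_cases:
  assumes "adj (Y i j) y"
  obtains j' where "j' \<in> {1..p}" "y = X j'" | j' where "j' \<in> {1..m i}" "j' \<noteq> j" "y = Y i j'"
  using assms unfolding clique_edge_iff by (cases y) auto

lemma adj_X: "j \<in> {1..p} \<Longrightarrow> y \<in> V \<Longrightarrow> y \<noteq> X j \<Longrightarrow> adj (X j) y"
  by (cases y) (auto intro: adj_XX adj_XY)

lemma finite_V: "finite V"
  by (rule finite_clique_vertices)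

lemma K_pos: "0 < K"
  using \<tau>_lt[of "X 1"] p by (cases K) auto

text \<open>Only edges at \<open>c\<close> can lose their covering property. The edge from
  \<open>c\<close> to \<open>z\<close> is repaired by the raise, and the others have slack.\<close>

lemma exchangeI:
  assumes zc: "z \<in> V" "c \<in> V" "z \<noteq> c" "u z < v z"
    and less: "Suc (u z) < u c \<or> Suc (u z) = u c \<and> \<tau> z < \<tau> c"
    and nbrs: "\<And>y. adj c y \<Longrightarrow> y \<noteq> z \<Longrightarrow> Suc k \<le> u c + u y"
  shows "exchange v z c"
proof -
  have pos: "0 < u c" using less by auto
  have "k \<le> swapped z c x + swapped z c y" if "adj x y" for x y
  proof -
    have ne: "x \<noteq> y" using adjD[OF that] by simp
    have k: "k \<le> u x + u y" using cov[OF that] .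
    consider "x = c" "y = z" | "x = z" "y = c" | "x = c" "y \<noteq> z" | "y = c" "x \<noteq> z" | "x \<noteq> c" "y \<noteq> c"
      by blast
    then show ?thesis
    proof cases
      case 3
      then show ?thesis using nbrs[of y] that ne pos by auto
    next
      case 4
      then show ?thesis using nbrs[of x] adj_sym[OF that] ne pos by auto
    qed (use k zc(3) pos in auto)
  qed
  then show ?thesis
    unfolding exchange_def
    using zc pos energy_swap[OF finite_V zc(1-3) \<tau>_lt less] by simp
qed

text \<open>A shared vertex is adjacent to all others. If its value is below \<open>k/2\<close>,
  every other vertex can be tight only with it, which fixes \<open>u\<close> elsewhere. Then either
  \<open>v\<close> rises there and a unit can be brought in, or \<open>v\<close> is at least
  \<open>u\<close> everywhere else and has more energy.\<close>

lemma exchange_low_shared: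
  assumes v: "\<And>x y. adj x y \<Longrightarrow> k \<le> v x + v y" and ne: "x0 \<in> V" "v x0 \<noteq> u x0"
    and le: "energy K \<tau> v V \<le> energy K \<tau> u V"
    and low: "j \<in> {1..p}" "2 * u (X j) < k"
  shows "\<exists>z c. exchange v z c"
proof -
  \<comment> \<open>A private vertex is taken as source because its value exceeds that of
    \<open>?x\<close>, and if it does so only by one, its weight decides.\<close>
  let ?x = "X j" and ?c = "Y 1 1"
  have c: "?c \<in> V" using n m[of 1] by simp
  have x: "?x \<in> V" using low(1) by simp
  have other: "u ?x + u c = k" if c: "c \<in> V" "c \<noteq> ?x" for c
  proof -
    have ge: "k \<le> u ?x + u c"
      using cov[OF adj_X[OF low(1) c]] .
    then obtain y where y: "adj c y" "u c + u y = k"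
      using tight[OF c(1)] low(2) by auto
    have "y = ?x"
    proof (rule ccontr)
      assume "y \<noteq> ?x"
      then have "k \<le> u ?x + u y"
        using cov[OF adj_X[OF low(1), of y]] adjD[OF y(1)] by simp
      then show False using y(2) ge low(2) by linarith
    qed
    then show ?thesis using y(2) by simp
  qed
  show ?thesis
  proof (cases "u ?x < v ?x")
    case True
    have "exchange v ?x ?c"
    proof (rule exchangeI[where z = ?x and c = ?c and v = v, OF x c _ True])
      show "Suc (u ?x) < u ?c \<or> Suc (u ?x) = u ?c \<and> \<tau> ?x < \<tau> ?c"
        using other[OF c] low \<tau>_XY[OF low(1), of 1 1] n m[of 1] by auto
      show "Suc k \<le> u ?c + u y" if "adj ?c y" "y \<noteq> ?x" for y
        using other[OF c] other[of y] adjD[OF that(1)] that(2) low(2) by simp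
    qed simp
    then show ?thesis by blast
  next
    case False
    have vc: "k \<le> v ?x + v c" if "c \<in> V" "c \<noteq> ?x" for c
      using v[OF adj_X[OF low(1) that]] .
    have ge: "u c \<le> v c" if "c \<in> V" "c \<noteq> ?x" for c
      using vc[OF that] other[OF that] False by linarith
    have "energy K \<tau> u V < energy K \<tau> v V"
    proof (cases "v ?x = u ?x")
      case True
      then have "u y \<le> v y" if "y \<in> V" for y
        using ge[OF that] by (cases "y = ?x") auto
      then show ?thesis
        using energy_mono_cases[OF finite_V K_pos, of u v \<tau>] ne by blast
    next
      case neq: False
      show ?thesis
      proof (rule energy_less_pair[OF finite_V x c _ \<tau>_lt])
        show "u ?x + u ?c \<le> v ?x + v ?c"
          using vc[OF c] other[OF c] by simp
        show "v ?x < u ?c \<or> v ?x = u ?c \<and> \<tau> ?x < \<tau> ?c"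
          using False other[OF c] low(2) by auto
      qed (use ge False neq in auto)
    qed
    then show ?thesis using le by simp
  qed
qed

end

section \<open>Minimal covers whose shared vertices all have value at least
  \<open>k/2\<close>\<close>

locale clique_cover_high = clique_cover +
  assumes high: "\<And>j. j \<in> {1..p} \<Longrightarrow> k \<le> 2 * u (X j)"
begin

definition M :: nat where "M = u (X 1)"

lemma X1: "(1::nat) \<in> {1..p}" "X 1 \<in> V"
  using p by simp_all

text \<open>Shared vertices are twins. Of two with different values the larger exceeds
  \<open>k/2\<close>, so its tight neighbour is private; but that vertex is also adjacent to the
  smaller one, and this edge would have sum below \<open>k\<close>.\<close>

lemma u_X:
  assumes "j \<in> {1..p}"
  shows "u (X j) = M"
proof -
  have le: "u (X j) \<le> u (X j')" if jj: "j \<in> {1..p}" "j' \<in> {1..p}" for j j'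
  proof (rule ccontr)
    assume gt: "\<not> u (X j) \<le> u (X j')"
    then obtain y where y: "adj (X j) y" "u (X j) + u y = k"
      using tight[of "X j"] jj by auto
    have yV: "y \<in> V" using adjD[OF y(1)] by simp
    show False
    proof (cases y)
      case (X j'')
      then show False using high[of j''] high[OF jj(2)] yV gt y(2) by auto
    next
      case (Y i h)
      then have "k \<le> u (X j') + u y"
        using cov[OF adj_X[OF jj(2) yV]] by simp
      then show False using y(2) gt by simp
    qed
  qed
  show ?thesis
    unfolding M_def using le[OF assms X1(1)] le[OF X1(1) assms] by simp
qed

lemma M_high: "k \<le> 2 * M"
  using high[OF X1(1)] by (simp add: M_def)

lemma M_Y: "i \<in> {1..n} \<Longrightarrow> j \<in> {1..m i} \<Longrightarrow> k \<le> M + u (Y i j)"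
  using cov[OF adj_XY[OF X1(1)]] unfolding M_def by blast

text \<open>A tight neighbour of \<open>x\<close> has value at least \<open>k - M\<close>: either it
  is shared and \<open>k \<le> 2 * M\<close>, or it is adjacent to a shared vertex.\<close>

lemma u_le_M:
  assumes "x \<in> V"
  shows "u x \<le> M"
proof (cases "u x")
  case (Suc a)
  then obtain y where y: "adj x y" "u x + u y = k"
    using tight[OF assms] by auto
  have "k \<le> M + u y"
    using adjD[OF y(1)] M_Y u_X M_high by (cases y) auto
  then show ?thesis using y(2) by simp
qed simp

text \<open>If \<open>X 1\<close> is tight only with a shared vertex, then \<open>2 * M = k\<close>,
  and every private vertex has value \<open>M\<close> as well.\<close>

lemma tight_private: "\<exists>i\<in>{1..n}. \<exists>j\<in>{1..m i}. M + u (Y i j) = k"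
proof -
  have "0 < u (X 1)" using k high[OF X1(1)] by simp
  then obtain y where y: "adj (X 1) y" "u (X 1) + u y = k"
    using tight[OF X1(2)] by blast
  show ?thesis
  proof (cases y)
    case (Y i j)
    then have "i \<in> {1..n}" "j \<in> {1..m i}" "M + u (Y i j) = k"
      using y adjD[OF y(1)] unfolding M_def by auto
    then show ?thesis by blast
  next
    case (X j)
    then have M: "2 * M = k"
      using y u_X[of j] adjD[OF y(1)] unfolding M_def by auto
    have Y11: "(1::nat) \<in> {1..n}" "(1::nat) \<in> {1..m 1}" "Y 1 1 \<in> V"
      using n m[of 1] by auto
    have "u (Y 1 1) \<le> M" using u_le_M[OF Y11(3)] .
    moreover have "k \<le> M + u (Y 1 1)" using M_Y[OF Y11(1,2)] .
    ultimately have "M + u (Y 1 1) = k" using M by simp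
    then show ?thesis using Y11 by blast
  qed
qed

text \<open>For \<open>z\<close> of least value, every neighbour of a private vertex of the block
  has value at least the smaller of \<open>u z\<close> and \<open>M\<close>, with
  \<open>M \<ge> k/2\<close>. Tightness then bounds \<open>u z\<close> by \<open>k/2\<close> and all
  other values by \<open>k - u z\<close>.\<close>

lemma block_shape:
  assumes i: "i \<in> {1..n}" "1 < m i"
  shows "\<exists>z\<in>Y i ` {1..m i}. 2 * u z \<le> k \<and> (\<forall>c\<in>Y i ` {1..m i}. c \<noteq> z \<longrightarrow> u z + u c = k)"
proof -
  let ?Q = "Y i ` {1..m i}"
  have QV: "y \<in> V" if "y \<in> ?Q" for y using that i by auto
  define z where "z = arg_min_on u ?Q"
  have ne: "?Q \<noteq> {}" using i by auto
  have z: "z \<in> ?Q" unfolding z_def using ne by (intro arg_min_if_finite) auto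
  have min: "u z \<le> u c" if "c \<in> ?Q" for c
    unfolding z_def using that ne by (intro arg_min_least) auto
  have tight_ge: "min (u z) M \<le> u y \<and> k \<le> 2 * M" if cy: "adj c y" "c \<in> ?Q" for c y
  proof -
    obtain j where "c = Y i j" using cy(2) by blast
    with cy(1) have "y \<in> ?Q \<or> (\<exists>j'\<in>{1..p}. y = X j')"
      by (auto elim: adj_Y_cases)
    then show ?thesis
    proof
      assume "y \<in> ?Q"
      then show ?thesis using min[of y] M_high by simp
    next
      assume "\<exists>j'\<in>{1..p}. y = X j'"
      then show ?thesis using u_X M_high by auto
    qed
  qed
  have low: "2 * u z \<le> k"
  proof (rule ccontr)
    assume big: "\<not> 2 * u z \<le> k"
    then obtain y where "adj z y" "u z + u y = k"
      using tight[OF QV[OF z]] by auto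
    then show False using tight_ge[OF _ z] big by fastforce
  qed
  have "u z + u c = k" if c: "c \<in> ?Q" "c \<noteq> z" for c
  proof -
    have ge: "k \<le> u z + u c"
      using z c i by (auto intro!: cov adj_YY)
    then have "0 < u c" using low k by (cases "u c") auto
    then obtain y where y: "adj c y" "u c + u y = k"
      using tight[OF QV[OF c(1)]] by blast
    show ?thesis using tight_ge[OF y(1) c(1)] y(2) ge low by linarith
  qed
  then show ?thesis using z low by blast
qed

text \<open>Away from \<open>z\<close> all edges at \<open>c\<close> have slack: other private
  vertices have the same value as \<open>c\<close>, and shared ones have
  \<open>M \<ge> k - u z\<close>, while \<open>u c > u z\<close>.\<close>

lemma exchange_block:
  assumes i: "i \<in> {1..n}" and z: "z \<in> Y i ` {1..m i}" and c: "c \<in> Y i ` {1..m i}" "c \<noteq> z"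
    and shape: "\<And>c. c \<in> Y i ` {1..m i} \<Longrightarrow> c \<noteq> z \<Longrightarrow> u z + u c = k"
    and up: "u z < v z" and less: "Suc (u z) < u c \<or> Suc (u z) = u c \<and> \<tau> z < \<tau> c"
  shows "exchange v z c"
proof (rule exchangeI[where z = z and c = c and v = v, OF _ _ _ up less])
  show "z \<in> V" "c \<in> V" "z \<noteq> c" using i z c by auto
  fix y assume y: "adj c y" "y \<noteq> z"
  have zM: "k \<le> M + u z" using M_Y i z by auto
  obtain j where "c = Y i j" using c by blast
  with y(1) have "y \<in> Y i ` {1..m i} \<or> (\<exists>j'\<in>{1..p}. y = X j')"
    by (auto elim: adj_Y_cases)
  then show "Suc k \<le> u c + u y"
  proof
    assume "y \<in> Y i ` {1..m i}"
    then show ?thesis using shape[OF _ y(2)] shape[OF c] less by fastforce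
  next
    assume "\<exists>j'\<in>{1..p}. y = X j'"
    then show ?thesis using u_X zM less by auto
  qed
qed

lemma exchange_high_shared:
  assumes v: "\<And>x y. adj x y \<Longrightarrow> k \<le> v x + v y" and ne: "x0 \<in> V" "v x0 \<noteq> u x0"
    and le: "energy K \<tau> v V \<le> energy K \<tau> u V"
  shows "\<exists>z c. exchange v z c"
proof (rule ccontr)
  assume stuck: "\<nexists>z c. exchange v z c"
  have block: "(\<forall>x\<in>Y i ` {1..m i}. v x = u x) \<or>
      energy K \<tau> u (Y i ` {1..m i}) < energy K \<tau> v (Y i ` {1..m i})"
    if i: "i \<in> {1..n}" "1 < m i" for i
  proof -
    obtain z where z: "z \<in> Y i ` {1..m i}" "2 * u z \<le> k"
      "\<And>c. c \<in> Y i ` {1..m i} \<Longrightarrow> c \<noteq> z \<Longrightarrow> u z + u c = k"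
      using block_shape[OF i] by blast
    have "Y i 1 \<noteq> Y i 2" "Y i 1 \<in> Y i ` {1..m i}" "Y i 2 \<in> Y i ` {1..m i}"
      using i by auto
    then obtain c0 where c0: "c0 \<in> Y i ` {1..m i}" "c0 \<noteq> z"
      by metis
    show ?thesis
    proof (rule energy_clique[where Q = "Y i ` {1..m i}" and z = z and u = u and v = v and \<tau> = \<tau> and k = k, OF _ z(1) c0 _ \<tau>_inj z(2,3)])
      show "\<tau> x < K" if "x \<in> Y i ` {1..m i}" for x
        using that i by (intro \<tau>_lt) auto
      show "k \<le> v x + v y" if "x \<in> Y i ` {1..m i}" "y \<in> Y i ` {1..m i}" "x \<noteq> y" for x y
        using that i by (auto intro!: v adj_YY)
      show "\<not> (u z + 1 < u c \<or> u z + 1 = u c \<and> \<tau> z < \<tau> c)"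
        if "c \<in> Y i ` {1..m i}" "c \<noteq> z" "u z < v z" for c
        using exchange_block[where v = v and z = z, OF i(1) z(1) that(1,2) z(3) that(3)] stuck by auto
    qed auto
  qed
  show False
  proof (cases "\<forall>j\<in>{1..p}. M \<le> v (X j)")
    case vX: True
    \<comment> \<open>Part 0, which is no block number, joins the shared vertices to the private
      vertex of a one-vertex block, its only partners for compensating a loss. The larger blocks are
      compared separately.\<close>
    define Q where "Q = (\<lambda>i. if i = 0 then X ` {1..p} \<union> (\<Union>i\<in>{i\<in>{1..n}. m i = 1}. {Y i 1})
      else if m i = 1 then {} else Y i ` {1..m i})"
    have union: "(\<Union>i\<in>{0..n}. Q i) = V"
    proof
      show "(\<Union>i\<in>{0..n}. Q i) \<subseteq> V"
        using m by (auto simp: Q_def split: if_splits)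
      show "V \<subseteq> (\<Union>i\<in>{0..n}. Q i)"
      proof
        fix x assume x: "x \<in> V"
        show "x \<in> (\<Union>i\<in>{0..n}. Q i)"
        proof (cases x)
          case (X j)
          then show ?thesis using x by (auto simp: Q_def intro!: bexI[of _ 0])
        next
          case (Y i j)
          then show ?thesis
            using x by (cases "m i = 1") (auto simp: Q_def intro!: bexI[of _ "if m i = 1 then 0 else i"])
        qed
      qed
    qed
    have shared: "(\<forall>x\<in>Q 0. v x = u x) \<or> energy K \<tau> u (Q 0) < energy K \<tau> v (Q 0)"
    proof (cases "\<forall>x\<in>Q 0. u x \<le> v x")
      case True
      then show ?thesis
        by (intro energy_mono_cases K_pos) (auto simp: Q_def)
    next
      case False
      \<comment> \<open>In part 0 only the private vertex of the one-vertex block can lose, and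
        there is at most one such block. The edge to \<open>X 1\<close> is tight under
        \<open>u\<close>, so \<open>X 1\<close> makes up for the loss.\<close>
      then obtain i where i: "i \<in> {1..n}" "m i = 1" "v (Y i 1) < u (Y i 1)"
        using vX u_X by (auto simp: Q_def not_le)
      have Q0: "x = Y i 1 \<or> (\<exists>j\<in>{1..p}. x = X j)" if "x \<in> Q 0" for x
        using that single[OF _ i(1) _ i(2)] by (auto simp: Q_def)
      obtain y where y: "adj (Y i 1) y" "u (Y i 1) + u y = k"
        using tight[of "Y i 1"] i by auto
      from y(1) have uy: "u (Y i 1) + M = k"
        using y(2) u_X i(2) by (auto elim!: adj_Y_cases)
      have "energy K \<tau> u (Q 0) < energy K \<tau> v (Q 0)"
      proof (rule energy_less_pair[of _ "Y i 1" "X 1"])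
        show "finite (Q 0)" "Y i 1 \<in> Q 0" "X 1 \<in> Q 0"
          using i X1 by (auto simp: Q_def)
        show "\<tau> x < K" if "x \<in> Q 0" for x
          using that union by (intro \<tau>_lt) auto
        show "u x \<le> v x" if "x \<in> Q 0" "x \<noteq> Y i 1" "x \<noteq> X 1" for x
          using Q0[OF that(1)] that(2) vX u_X by auto
        show "u (Y i 1) + u (X 1) \<le> v (Y i 1) + v (X 1)"
          using v[OF adj_XY[OF X1(1) i(1), of 1]] i(2) uy by (simp add: M_def)
        show "v (Y i 1) < u (X 1) \<or> v (Y i 1) = u (X 1) \<and> \<tau> (Y i 1) < \<tau> (X 1)"
          using i(3) u_le_M[of "Y i 1"] i(1,2) by (simp add: M_def)
      qed (use i in auto)
      then show ?thesis ..
    qed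
    have "(\<forall>x\<in>(\<Union>i\<in>{0..n}. Q i). v x = u x) \<or>
      energy K \<tau> u (\<Union>i\<in>{0..n}. Q i) < energy K \<tau> v (\<Union>i\<in>{0..n}. Q i)"
    proof (rule energy_Union)
      show "(\<forall>x\<in>Q i. v x = u x) \<or> energy K \<tau> u (Q i) < energy K \<tau> v (Q i)" if "i \<in> {0..n}" for i
        using shared block[of i] m[of i] that by (cases "i = 0"; cases "m i = 1") (auto simp: Q_def)
      show "Q i \<inter> Q j = {}" if "i \<in> {0..n}" "j \<in> {0..n}" "i \<noteq> j" for i j
        using that by (auto simp: Q_def split: if_splits)
    qed (auto simp: Q_def)
    then show False
      unfolding union using ne le by auto
  next
    case False
    then obtain j where j: "j \<in> {1..p}" "v (X j) < M" by auto
    have vY: "k < v (Y i h) + M" if "i \<in> {1..n}" "h \<in> {1..m i}" for i h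
      using v[OF adj_XY[OF j(1) that]] j(2) by simp
    \<comment> \<open>Since \<open>v\<close> is below \<open>M\<close> at a shared vertex, it rises
      at each tight private vertex. If \<open>2 * M > k + 1\<close>, this would allow an exchange:
      inside a larger block with a tight vertex, or else between \<open>X 1\<close> and the private
      vertex of the one-vertex block.\<close>
    have "\<exists>i\<in>{1..n}. \<exists>h\<in>{1..m i}. M + u (Y i h) = k \<and> 2 * M \<le> k + 1"
    proof (cases "\<exists>i\<in>{1..n}. 1 < m i \<and> (\<exists>h\<in>{1..m i}. M + u (Y i h) = k)")
      case True
      then obtain i h0 where i: "i \<in> {1..n}" "1 < m i" and h0: "h0 \<in> {1..m i}" "M + u (Y i h0) = k"
        by blast
      obtain z where z: "z \<in> Y i ` {1..m i}" "2 * u z \<le> k"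
        "\<And>c. c \<in> Y i ` {1..m i} \<Longrightarrow> c \<noteq> z \<Longrightarrow> u z + u c = k"
        using block_shape[OF i] by blast
      obtain h where h: "h \<in> {1..m i}" "z = Y i h" using z(1) by blast
      have "u z \<le> u (Y i h0)"
        using z(2) z(3)[of "Y i h0"] h0(1) by (cases "Y i h0 = z") auto
      then have uz: "M + u z = k"
        using M_Y[OF i(1) h(1)] h0(2) h(2) by simp
      have "Y i 1 \<noteq> Y i 2" "Y i 1 \<in> Y i ` {1..m i}" "Y i 2 \<in> Y i ` {1..m i}"
        using i by auto
      then obtain c where c: "c \<in> Y i ` {1..m i}" "c \<noteq> z"
        by metis
      have "\<not> Suc (u z) < u c"
        using exchange_block[where v = v and z = z, OF i(1) z(1) c z(3)] stuck vY[OF i(1) h(1)] h(2) uz by auto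
      then have "2 * M \<le> k + 1"
        using z(3)[OF c] uz by simp
      then show ?thesis using i h uz by blast
    next
      case no: False
      obtain i h where i: "i \<in> {1..n}" "h \<in> {1..m i}" "M + u (Y i h) = k"
        using tight_private by blast
      have mi: "m i = 1"
        using no i m[OF i(1)] by force
      have "2 * M \<le> k + 1"
      proof (rule ccontr)
        assume big: "\<not> 2 * M \<le> k + 1"
        \<comment> \<open>Outside the larger blocks only one private vertex can be tight, so raising
          it frees a unit at \<open>X 1\<close>.\<close>
        have "exchange v (Y i h) (X 1)"
        proof (rule exchangeI)
          show "u (Y i h) < v (Y i h)"
            using vY[OF i(1,2)] i(3) by simp
          show "Suc (u (Y i h)) < u (X 1) \<or> Suc (u (Y i h)) = u (X 1) \<and> \<tau> (Y i h) < \<tau> (X 1)"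
            using big i(3) by (auto simp: M_def)
          fix y assume y: "adj (X 1) y" "y \<noteq> Y i h"
          show "Suc k \<le> u (X 1) + u y"
          proof (cases y)
            case (X j')
            then show ?thesis using u_X[of j'] adjD[OF y(1)] big by (simp add: M_def)
          next
            case (Y i' h')
            then have ih: "i' \<in> {1..n}" "h' \<in> {1..m i'}" using adjD[OF y(1)] by auto
            have "M + u (Y i' h') \<noteq> k"
            proof
              assume eq: "M + u (Y i' h') = k"
              then have "m i' = 1" using no ih m[OF ih(1)] by force
              then show False
                using single[OF ih(1) i(1) _ mi] ih(2) i(2) mi y(2) Y by auto
            qed
            then show ?thesis using M_Y[OF ih] Y by (simp add: M_def)
          qed
        qed (use i X1 in auto)
        then show False using stuck by blast
      qed
      then show ?thesis using i by blast
    qed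
    then obtain i h where i: "i \<in> {1..n}" "h \<in> {1..m i}" "M + u (Y i h) = k" "2 * M \<le> k + 1"
      by blast
    \<comment> \<open>By \<open>2 * M \<le> k + 1\<close>, each \<open>x\<close> other than
      \<open>X j\<close> has \<open>v x \<ge> k - M + 1 \<ge> M \<ge> u x\<close>. So only
      \<open>X j\<close> loses, and \<open>Y i h\<close> makes up for it.\<close>
    have "energy K \<tau> u V < energy K \<tau> v V"
    proof (rule energy_less_pair[of V "X j" "Y i h", OF finite_V _ _ _ \<tau>_lt])
      show "u x \<le> v x" if "x \<in> V" "x \<noteq> X j" for x
        using v[OF adj_X[OF j(1) that]] u_le_M[OF that(1)] j(2) i(4) by linarith
      show "v (X j) < u (X j)" using u_X[OF j(1)] j(2) by simp
      show "u (X j) + u (Y i h) \<le> v (X j) + v (Y i h)"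
        using v[OF adj_XY[OF j(1) i(1,2)]] u_X[OF j(1)] i(3) by simp
      show "v (X j) < u (Y i h) \<or> v (X j) = u (Y i h) \<and> \<tau> (X j) < \<tau> (Y i h)"
        using \<tau>_XY[OF j(1) i(1,2)] j(2) i(3,4) by linarith
    qed (use i j in auto)
    then show False using le by simp
  qed
qed

end

lemma (in clique_cover) exchange_exists:
  assumes "\<And>x y. adj x y \<Longrightarrow> k \<le> v x + v y" "x0 \<in> V" "v x0 \<noteq> u x0"
    and "energy K \<tau> v V \<le> energy K \<tau> u V"
  shows "\<exists>z c. exchange v z c"
proof (cases "\<exists>j\<in>{1..p}. 2 * u (X j) < k")
  case True
  then show ?thesis using exchange_low_shared[OF assms] by blast
next
  case False
  then interpret clique_cover_high p n k K m \<tau> u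
    by unfold_locales (simp add: not_less)
  show ?thesis using exchange_high_shared[OF assms] by blast
qed

section \<open>Linear quotients for the ideals of covers, and the equivalence\<close>

lemma minimal_divisor:
  assumes "t \<in> T"
  shows "\<exists>s\<in>T. s \<preceq> t \<and> (\<forall>r\<in>T. r \<preceq> s \<longrightarrow> r = s)"
proof -
  obtain s where s: "s \<in> T" "s \<preceq> t" "\<And>r. r \<in> T \<Longrightarrow> r \<preceq> t \<Longrightarrow> mdeg s \<le> mdeg r"
    using ex_has_least_nat[of "\<lambda>s. s \<in> T \<and> s \<preceq> t" t mdeg] assms by auto
  have "r = s" if "r \<in> T" "r \<preceq> s" for r
    using s(3)[OF that(1) divides_trans[OF that(2) s(2)]] mdeg_mono[OF that(2)]
    by (intro divides_mdeg_eq that) simp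
  then show ?thesis using s by blast
qed

text \<open>The minimal generators are the covers in which no value can be lowered; this gives a
  tight edge at every positive vertex, and the exchange supplies the step for sorting by
  energy.\<close>

lemma clique_has_linear_quotients:
  fixes p n k :: nat and m :: "nat \<Rightarrow> nat"
  defines "V \<equiv> n_clique_vertices p n m" and "E \<equiv> n_clique_edges p n m"
  assumes p: "1 < p" and n: "1 \<le> n" and m: "\<And>i. i \<in> {1..n} \<Longrightarrow> 1 \<le> m i" and k: "1 \<le> k"
    and single: "\<And>i j. i \<in> {1..n} \<Longrightarrow> j \<in> {1..n} \<Longrightarrow> m i = 1 \<Longrightarrow> m j = 1 \<Longrightarrow> i = j"
  shows "has_linear_quotients V (mono_ideal V (covers V E k) :: (clique_vertex, 'k::field) mpoly set)"
proof -
  let ?T = "covers V E k"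
  define G where "G = {t \<in> ?T. \<forall>s\<in>?T. s \<preceq> t \<longrightarrow> s = t}"
  have V: "finite V" by (simp add: V_def finite_clique_vertices)
  have T: "t \<in> ?T \<longleftrightarrow> keys t \<subseteq> V \<and> (\<forall>x y. {x, y} \<in> E \<longrightarrow> k \<le> lookup t x + lookup t y)" for t
    by (simp add: covers_def)
  have edge: "x \<in> V \<and> y \<in> V \<and> x \<noteq> y" if "{x, y} \<in> E" for x y
    using that unfolding E_def V_def clique_edge_iff n_clique_vertices_def clique_block_def by blast
  have below: "\<exists>s\<in>G. s \<preceq> t" if "t \<in> ?T" for t
    using minimal_divisor[OF that] unfolding G_def by blast
  have ideal: "mono_ideal V ?T = (mono_ideal V G :: (clique_vertex, 'k) mpoly set)"
    unfolding mono_ideal_def using below divides_trans by (auto simp: G_def) blast+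
  have drop: "\<exists>x' y. {x', y} \<in> E \<and> lookup (u - var x) x' + lookup (u - var x) y < k"
    if u: "u \<in> G" "0 < lookup u x" for u x
  proof (rule ccontr)
    assume "\<not> ?thesis"
    moreover have "keys (u - var x) \<subseteq> V"
      using u(1) by (auto simp: G_def T in_keys_iff lookup_minus)
    ultimately have "u - var x \<in> ?T"
      unfolding T by (auto simp: not_less)
    moreover have "u - var x \<preceq> u"
      by (simp add: divides_def lookup_minus)
    ultimately have "u - var x = u"
      using u(1) by (auto simp: G_def)
    then have "lookup (u - var x) x = lookup u x" by simp
    then show False
      using u(2) by (simp add: lookup_minus lookup_var)
  qed
  have tight: "\<exists>y. {x, y} \<in> E \<and> lookup u x + lookup u y = k"
    if u: "u \<in> G" "0 < lookup u x" for u x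
  proof -
    obtain a b where ab: "{a, b} \<in> E" "lookup (u - var x) a + lookup (u - var x) b < k"
      using drop[OF u] by blast
    have "k \<le> lookup u a + lookup u b" "a \<noteq> b"
      using u(1) ab(1) edge by (auto simp: G_def T)
    then have "x = a \<and> lookup u x + lookup u b = k \<or> x = b \<and> lookup u x + lookup u a = k"
      using ab(2) u(2) by (auto simp: lookup_minus lookup_var split: if_splits)
    then show ?thesis
      using ab(1) by (metis insert_commute)
  qed
  have bound: "lookup u x \<le> k" if "u \<in> G" for u x
    using tight[OF that, of x] by (cases "lookup u x") auto
  have fin: "finite G"
    by (rule finite_subset[OF _ finite_bounded_exponents[OF V, of k]]) (use bound in \<open>auto simp: G_def T\<close>)
  \<comment> \<open>Shared weights are at most \<open>p\<close>, private ones are larger. Vertices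
    in different blocks may have equal weights, as ties are decided only within a block or between a
    shared and a private vertex.\<close>
  define \<tau> where "\<tau> = (\<lambda>x. case x of X j \<Rightarrow> j | Y i j \<Rightarrow> p + j)"
  define K where "K = Suc (\<Sum>x\<in>V. \<tau> x)"
  have \<tau>_lt: "\<tau> x < K" if "x \<in> V" for x
    unfolding K_def using member_le_sum[OF that _ V, of \<tau>] by simp
  have "\<exists>z. \<exists>w\<in>G. lookup u z < lookup v z \<and>
      energy K \<tau> (lookup w) V < energy K \<tau> (lookup u) V \<and> w \<preceq> u + var z"
    if u: "u \<in> G" and v: "v \<in> G" "v \<noteq> u"
      and le: "energy K \<tau> (lookup v) V \<le> energy K \<tau> (lookup u) V" for u v
  proof -
    interpret clique_cover p n k K m \<tau> "lookup u"
    proof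
      show "inj_on \<tau> (Y i ` {1..m i})" for i
        by (auto simp: inj_on_def \<tau>_def)
      show "k \<le> lookup u x + lookup u y" if "{x, y} \<in> n_clique_edges p n m" for x y
        using u that[folded E_def] by (auto simp: G_def T)
      show "\<exists>y. {x, y} \<in> n_clique_edges p n m \<and> lookup u x + lookup u y = k" if "0 < lookup u x" for x
        using tight[OF u that] by (simp add: E_def)
      show "\<tau> (X j) < \<tau> (Y i j')" if "j \<in> {1..p}" "j' \<in> {1..m i}" for i j j'
        using that by (simp add: \<tau>_def)
    qed (fact p n m k single \<tau>_lt[unfolded V_def])+
    obtain x0 where x0: "lookup v x0 \<noteq> lookup u x0"
      using v(2) poly_mapping_eqI[of v u] by blast
    have "keys u \<union> keys v \<subseteq> V"
      using u v(1) by (auto simp: G_def T)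
    moreover have "x0 \<in> keys u \<union> keys v"
      using x0 by (cases "lookup u x0 = 0") (simp_all add: in_keys_iff)
    ultimately have "x0 \<in> V" by blast
    moreover have "k \<le> lookup v x + lookup v y" if "{x, y} \<in> n_clique_edges p n m" for x y
      using v(1) that[folded E_def] by (auto simp: G_def T)
    ultimately obtain z c where "exchange (lookup v) z c"
      using exchange_exists[of "lookup v" x0] x0 le unfolding V_def by blast
    then have zc: "z \<in> V" "z \<noteq> c" "lookup u z < lookup v z"
      "\<And>x y. {x, y} \<in> E \<Longrightarrow> k \<le> swapped z c x + swapped z c y"
      "energy K \<tau> (swapped z c) V < energy K \<tau> (lookup u) V"
      unfolding exchange_def V_def E_def by blast+
    have eq: "lookup (swap u z c) = swapped z c"
      using zc(2) by (auto simp: lookup_swap fun_eq_iff)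
    have "keys (swap u z c) \<subseteq> V"
      using keys_swap[of u z c] zc(1) u by (auto simp: G_def T)
    then have "swap u z c \<in> ?T"
      unfolding T eq using zc(4) by blast
    \<comment> \<open>The exchanged cover need not be minimal; a minimal cover dividing it has no
      more energy.\<close>
    then obtain w where w: "w \<in> G" "w \<preceq> swap u z c"
      using below by blast
    have "energy K \<tau> (lookup w) V \<le> energy K \<tau> (swapped z c) V"
      using w(2) unfolding divides_def eq by (intro energy_mono) blast
    then show ?thesis
      using zc(3,5) w divides_trans[OF w(2) swap_divides]
      by (intro exI[of _ z] bexI[of _ w]) auto
  qed
  then obtain ts where ts: "distinct ts" "set ts = G" "mono_lq ts"
    using mono_lq_sort[OF fin, of "\<lambda>t. energy K \<tau> (lookup t) V"] by blast
  show ?thesis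
    unfolding has_linear_quotients_iff
  proof (intro exI[of _ ts] conjI)
    show "\<forall>t\<in>set ts. keys t \<subseteq> V"
      unfolding ts(2) by (simp add: G_def T)
    show "\<forall>s\<in>set ts. \<forall>t\<in>set ts. s \<preceq> t \<longrightarrow> s = t"
      unfolding ts(2) by (simp add: G_def)
  qed (use ts ideal in simp_all)
qed

theorem corollary4p14:
  fixes p n :: nat and m :: "nat \<Rightarrow> nat"
    and V :: "clique_vertex set"
    and J :: "nat \<Rightarrow> (clique_vertex, 'k::field) mpoly set"
  assumes "1 < p" and "1 \<le> n" and "\<And>i. i \<in> {1..n} \<Longrightarrow> 1 \<le> m i"
    and V: "V = n_clique_vertices p n m"
    and J: "\<And>k. J k = cover_ideal_symbolic_power V (n_clique_edges p n m) k"
  shows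
    "(((\<forall>i\<in>{1..n}. 1 < m i) \<or>
        (\<exists>!i. i \<in> {1..n} \<and> m i = 1 \<and> (\<forall>j\<in>{1..n}. j \<noteq> i \<longrightarrow> 1 < m j)))
       \<longleftrightarrow> (\<forall>k\<ge>1. has_linear_quotients V (J k))) \<and>
     ((\<forall>k\<ge>1. has_linear_quotients V (J k)) \<longleftrightarrow> (\<forall>k\<ge>1. componentwise_linear V (J k))) \<and>
     ((\<forall>k\<ge>1. componentwise_linear V (J k)) \<longleftrightarrow> (\<exists>k\<ge>2. componentwise_linear V (J k)))"
proof -
  \<comment> \<open>Both alternatives of the first condition together: at most one block has exactly
    one private vertex.\<close>
  let ?single = "\<forall>i\<in>{1..n}. \<forall>j\<in>{1..n}. m i = 1 \<longrightarrow> m j = 1 \<longrightarrow> i = j"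
  have J': "J k = mono_ideal V (covers V (n_clique_edges p n m) k)" for k
    unfolding J V by (rule cover_ideal_symbolic_power_eq[OF clique_edges])
  have one: "(\<forall>i\<in>{1..n}. 1 < m i) \<or>
      (\<exists>!i. i \<in> {1..n} \<and> m i = 1 \<and> (\<forall>j\<in>{1..n}. j \<noteq> i \<longrightarrow> 1 < m j)) \<longleftrightarrow> ?single"
  proof
    assume s: ?single
    show "(\<forall>i\<in>{1..n}. 1 < m i) \<or>
      (\<exists>!i. i \<in> {1..n} \<and> m i = 1 \<and> (\<forall>j\<in>{1..n}. j \<noteq> i \<longrightarrow> 1 < m j))"
    proof (cases "\<forall>i\<in>{1..n}. 1 < m i")
      case False
      then obtain i where i: "i \<in> {1..n}" "m i = 1"
        using assms(3) by (metis le_neq_implies_less)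
      have "1 < m j" if "j \<in> {1..n}" "j \<noteq> i" for j
        using s i that assms(3)[OF that(1)] by (metis le_neq_implies_less)
      then have "\<exists>!i. i \<in> {1..n} \<and> m i = 1 \<and> (\<forall>j\<in>{1..n}. j \<noteq> i \<longrightarrow> 1 < m j)"
        using i s by (intro ex1I[of _ i]) blast+
      then show ?thesis ..
    qed simp
  next
    assume alt: "(\<forall>i\<in>{1..n}. 1 < m i) \<or>
      (\<exists>!i. i \<in> {1..n} \<and> m i = 1 \<and> (\<forall>j\<in>{1..n}. j \<noteq> i \<longrightarrow> 1 < m j))"
    have "\<exists>i0. \<forall>j\<in>{1..n}. j \<noteq> i0 \<longrightarrow> 1 < m j"
      using alt by blast
    then obtain i0 where "\<And>j. j \<in> {1..n} \<Longrightarrow> j \<noteq> i0 \<Longrightarrow> 1 < m j"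
      by blast
    then have "j = i0" if "j \<in> {1..n}" "m j = 1" for j
      using that by force
    then show ?single by blast
  qed
  have two: "has_linear_quotients V (J k)" if ?single "1 \<le> k" for k
    unfolding J' V
    by (rule clique_has_linear_quotients[OF assms(1-3) that(2)]) (use that(1) in blast)+
  have three: "componentwise_linear V (J k)" if "has_linear_quotients V (J k)" for k
    using has_linear_quotients_imp_componentwise_linear[OF _ that] finite_clique_vertices
    unfolding V by simp
  have four: ?single if "2 \<le> k" "componentwise_linear V (J k)" for k
  proof (intro ballI impI, rule ccontr)
    fix i j assume ij: "i \<in> {1..n}" "j \<in> {1..n}" "m i = 1" "m j = 1" "i \<noteq> j"
    show False
      using clique_not_componentwise_linear[OF assms(1) that(1) assms(3) ij(1,2,5,3,4), where 'k='k] that(2)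
      unfolding J' V by contradiction
  qed
  have weaken: "\<exists>k\<ge>2. componentwise_linear V (J k)" if "\<forall>k\<ge>1. componentwise_linear V (J k)"
    using that by (intro exI[of _ 2]) simp
  show ?thesis
    unfolding one using two three four weaken by blast
qed

end
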